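(* Suppose that $\lambda\ge[1-(1+m)(c/2)]^+$. Then: 1. the value function $v(\cdot,\cdot)$ is continuously differentiable everywhere; 2. the boundary function $\gamma(\cdot)$ is continuously differentiable on the interior of its support $[0,\xi]$, coincides with the boundary function $a_0(x)=-x+\frac{\lambda}{c}\sqrt2$ of the region $A_0$ on the interval $\big[0,\frac{\lambda\sqrt2}{2c}\big]$, and fits smoothly to this function at the right end-point of the same interval; 3. the function $v(\cdot,\cdot)$ is the solution $w=v$ of the variational inequalities $$(\widetilde{\mathcal A}-\lambda)w(x,y)+g(x,y)=0,\quad (x,y)\in\mathbf C;\qquad w(x,y)=0,\quad(x,y)\in\Gamma;$$ $$(\widetilde{\mathcal A}-\lambda)w(x,y)+g(x,y)>0,\quad (x,y)\in\Gamma\setminus\partial\Gamma;\qquad w(x,y)<0,\quad (x,y)\in\mathbf C.$$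
   Context: Fix constants $\lambda>0$, $\mu>1$, $c>0$, $m\in(-1,1)$; $\mathbb R_+=[0,\infty)$. On a probability space $(\Omega,\mathcal H,\mathbb P_0)$ let $N$ be a homogeneous Poisson process with rate $\mu$ and jump times $0=\sigma_0<\sigma_1<\sigma_2<\cdots$; $\mathbb F$ is the right-continuous enlargement with $\mathbb P_0$-null sets of its natural filtration, and $\mathcal S$ is the collection of all $\mathbb F$-stopping times. For $\phi_0,\phi_1\in\mathbb R$ let $x(t,\phi_0)$, $y(t,\phi_1)$, $t\in\mathbb R$, be the solutions of $$\frac{d}{dt}x(t,\phi_0)=(\lambda+1)x(t,\phi_0)+\frac{\lambda(1-m)}{\sqrt2},\ x(0,\phi_0)=\phi_0;\qquad \frac{d}{dt}y(t,\phi_1)=(\lambda-1)y(t,\phi_1)+\frac{\lambda(1+m)}{\sqrt2},\ y(0,\phi_1)=\phi_1,$$ and let $S(\phi_0,\phi_1)=\big((1-\frac1\mu)\phi_0,(1+\frac1\mu)\phi_1\big)$. The process $\widetilde\Phi=(\widetilde\Phi^{(0)},\widetilde\Phi^{(1)})$ in $\mathbb R_+^2$ started at $(\phi_0,\phi_1)$ satisfies $\widetilde\Phi_0=(\phi_0,\phi_1)$, $\widetilde\Phi_t=\big(x(t-\sigma_n,\widetilde\Phi^{(0)}_{\sigma_n}),y(t-\sigma_n,\widetilde\Phi^{(1)}_{\sigma_n})\big)$ for $\sigma_n\le t<\sigma_{n+1}$, $n\ge0$, and $\widetilde\Phi_{\sigma_n}=S(\widetilde\Phi_{\sigma_n-})$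 for $n\ge1$. $\mathbb E_0^{\phi_0,\phi_1}$ is the $\mathbb P_0$-expectation when $\widetilde\Phi_0=(\phi_0,\phi_1)$. With $g(\phi_0,\phi_1)=\phi_0+\phi_1-\frac{\lambda}{c}\sqrt2$, the value function is $$v(\phi_0,\phi_1)=\inf_{\tau\in\mathcal S}\mathbb E_0^{\phi_0,\phi_1}\Big[\int_0^\tau e^{-\lambda t}g(\widetilde\Phi_t)\,dt\Big],\qquad(\phi_0,\phi_1)\in\mathbb R_+^2.$$ The optimal stopping region is $\Gamma=\{(x,y)\in\mathbb R_+^2:v(x,y)=0\}$ and $\mathbf C=\mathbb R_+^2\setminus\Gamma$. The boundary function is $\gamma(x)=\inf\{y\in\mathbb R_+:(x,y)\in\Gamma\}$, $x\in\mathbb R_+$ (it is decreasing, convex and continuous, and $\Gamma=\{(x,y)\in\mathbb R_+^2:y\ge\gamma(x)\}$); $\xi=\inf\{x\in\mathbb R_+:\gamma(x)=0\}<\infty$, so its support is $[0,\xi]$; and $\partial\Gamma=\{(x,\gamma(x)):x\in[0,\xi]\}$. The region $A_0$ is $\{(x,y)\in\mathbb R_+^2:g(x,y)<0\}$. "Fits smoothly" means that the first derivatives also agree at that point. $\widetilde{\mathcal A}$ is the infinitesimal generator of $\widetilde\Phi$ acting on continuously differentiable functions: $$\widetilde{\mathcal A}f(\phi_0,\phi_1)=D_{\phi_0}f(\phi_0,\phi_1)\Big[(\lambda+1)\phi_0+\frac{\lambda(1-m)}{\sqrt2}\Big]+D_{\phi_1}f(\phi_0,\phi_1)\Big[(\lambda-1)\phi_1+\frac{\lambda(1+m)}{\sqrt2}\Big]+\mu\big[f(S(\phi_0,\phi_1))-f(\phi_0,\phi_1)\big].$$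 The variational inequalities are posed for bounded and continuous functions $w:\mathbb R_+^2\to(-\infty,0]$ that are continuously differentiable on $\mathbb R_+^2\setminus\partial\Gamma$ and whose first-order derivatives are locally bounded near $\partial\Gamma$. *)

theory Defs
  imports "HOL-Probability.Probability"
begin

section \<open>The Poisson process and its filtration\<close>

definition poisson_process :: "'a measure \<Rightarrow> real \<Rightarrow> (real \<Rightarrow> 'a \<Rightarrow> nat) \<Rightarrow> bool" where
  "poisson_process M \<mu> N \<longleftrightarrow>
     (\<forall>t\<ge>0. N t \<in> measurable M (count_space UNIV)) \<and>
     (\<forall>\<omega>\<in>space M. N 0 \<omega> = 0 \<and> mono_on {0..} (\<lambda>t. N t \<omega>) \<and>
        (\<forall>t\<ge>0. continuous (at_right t) (\<lambda>s. real (N s \<omega>)))) \<and>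
     (\<forall>s t. 0 \<le> s \<and> s < t \<longrightarrow>
        distr M (count_space UNIV) (\<lambda>\<omega>. N t \<omega> - N s \<omega>) = measure_pmf (poisson_pmf (\<mu> * (t - s)))) \<and>
     (\<forall>(ts :: nat \<Rightarrow> real) n. 0 \<le> ts 0 \<and> strict_mono ts \<longrightarrow>
        prob_space.indep_vars M (\<lambda>_. count_space UNIV)
          (\<lambda>i \<omega>. N (ts (Suc i)) \<omega> - N (ts i) \<omega>) {..<n})"

text \<open>The divergence of the jump times makes the set in the last conjunct finite, so that
  \<open>card\<close> is a genuine count.\<close>

definition jump_times :: "'a measure \<Rightarrow> (real \<Rightarrow> 'a \<Rightarrow> nat) \<Rightarrow> (nat \<Rightarrow> 'a \<Rightarrow> real) \<Rightarrow> bool" where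
  "jump_times M N \<sigma> \<longleftrightarrow>
     (\<forall>\<omega>\<in>space M. \<sigma> 0 \<omega> = 0 \<and> strict_mono (\<lambda>n. \<sigma> n \<omega>) \<and>
        filterlim (\<lambda>n. \<sigma> n \<omega>) at_top sequentially \<and>
        (\<forall>t\<ge>0. N t \<omega> = card {n. 1 \<le> n \<and> \<sigma> n \<omega> \<le> t}))"

definition natural_generator :: "'a measure \<Rightarrow> (real \<Rightarrow> 'a \<Rightarrow> nat) \<Rightarrow> ennreal \<Rightarrow> 'a set set" where
  "natural_generator M N t =
     {N s -` A \<inter> space M | s A. 0 \<le> s \<and> ennreal s \<le> t}"

text \<open>Time runs over \<open>[0, \<infinity>]\<close> because the library's \<open>stopping_time\<close> uses one type for the time
  index and for the values of the stopping time, and stopping times may be infinite.  Adding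
  \<open>\<infinity>\<close> to the index set of the intersection changes nothing for \<open>t < \<infinity>\<close>; at \<open>t = \<infinity>\<close> it
  avoids an empty intersection.\<close>

definition augmented_filtration :: "'a measure \<Rightarrow> (real \<Rightarrow> 'a \<Rightarrow> nat) \<Rightarrow> ennreal \<Rightarrow> 'a measure" where
  "augmented_filtration M N t =
     sigma (space M)
       (\<Inter>u\<in>insert \<infinity> {t<..}. sigma_sets (space M) (natural_generator M N u \<union> null_sets M))"


section \<open>The process between and at the jumps\<close>

definition linear_ode_solution :: "real \<Rightarrow> real \<Rightarrow> real \<Rightarrow> real \<Rightarrow> real" where
  "linear_ode_solution a b z =
     (THE f. f 0 = z \<and> (\<forall>t. (f has_real_derivative a * f t + b) (at t)))"

definition x_flow :: "real \<Rightarrow> real \<Rightarrow> real \<Rightarrow> real \<Rightarrow> real" where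
  "x_flow lam m t z = linear_ode_solution (lam + 1) (lam * (1 - m) / sqrt 2) z t"

definition y_flow :: "real \<Rightarrow> real \<Rightarrow> real \<Rightarrow> real \<Rightarrow> real" where
  "y_flow lam m t z = linear_ode_solution (lam - 1) (lam * (1 + m) / sqrt 2) z t"

definition flow :: "real \<Rightarrow> real \<Rightarrow> real \<Rightarrow> real \<times> real \<Rightarrow> real \<times> real" where
  "flow lam m t p = (x_flow lam m t (fst p), y_flow lam m t (snd p))"

definition jump_map :: "real \<Rightarrow> real \<times> real \<Rightarrow> real \<times> real" where
  "jump_map \<mu> p = ((1 - 1 / \<mu>) * fst p, (1 + 1 / \<mu>) * snd p)"

text \<open>In the next two definitions \<open>s\<close> is the sequence of jump times of one path.  The flow is
  continuous, so \<open>flow lam m (s (Suc n) - s n) _\<close> is the left limit at the jump time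
  \<open>s (Suc n)\<close>; see \<open>Phi_left_limit\<close> and \<open>Phi_jump\<close> below.\<close>

primrec Phi_at_jump ::
  "real \<Rightarrow> real \<Rightarrow> real \<Rightarrow> (nat \<Rightarrow> real) \<Rightarrow> real \<times> real \<Rightarrow> nat \<Rightarrow> real \<times> real" where
  "Phi_at_jump lam \<mu> m s p 0 = p"
| "Phi_at_jump lam \<mu> m s p (Suc n) =
     jump_map \<mu> (flow lam m (s (Suc n) - s n) (Phi_at_jump lam \<mu> m s p n))"

definition Phi ::
  "real \<Rightarrow> real \<Rightarrow> real \<Rightarrow> (nat \<Rightarrow> real) \<Rightarrow> real \<times> real \<Rightarrow> real \<Rightarrow> real \<times> real" where
  "Phi lam \<mu> m s p t =
     (let n = (THE n. s n \<le> t \<and> t < s (Suc n))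
      in flow lam m (t - s n) (Phi_at_jump lam \<mu> m s p n))"


section \<open>The optimal stopping problem\<close>

definition quadrant :: "(real \<times> real) set" where
  "quadrant = {0..} \<times> {0..}"

definition running_cost :: "real \<Rightarrow> real \<Rightarrow> real \<times> real \<Rightarrow> real" where
  "running_cost lam c p = fst p + snd p - lam / c * sqrt 2"

text \<open>The Lebesgue integral with values in the extended reals, positive part minus negative part
  (\<open>e2ennreal\<close> maps negative numbers to 0).  The Bochner integral would return 0 for the
  stopping rules, such as \<open>\<tau> = \<infinity>\<close>, whose cost is \<open>+\<infinity>\<close>.  No \<open>\<infinity> - \<infinity>\<close> arises below, since
  \<open>running_cost\<close> is bounded below on the quadrant.\<close>

definition ereal_integral :: "'a measure \<Rightarrow> ('a \<Rightarrow> ereal) \<Rightarrow> ereal" where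
  "ereal_integral M f =
     enn2ereal (\<integral>\<^sup>+x. e2ennreal (f x) \<partial>M) - enn2ereal (\<integral>\<^sup>+x. e2ennreal (- f x) \<partial>M)"

definition stopping_cost ::
  "real \<Rightarrow> real \<Rightarrow> real \<Rightarrow> real \<Rightarrow> 'a measure \<Rightarrow> (nat \<Rightarrow> 'a \<Rightarrow> real) \<Rightarrow> real \<times> real
     \<Rightarrow> ('a \<Rightarrow> ennreal) \<Rightarrow> ereal" where
  "stopping_cost lam \<mu> c m M \<sigma> p \<tau> =
     ereal_integral M (\<lambda>\<omega>. ereal_integral lborel (\<lambda>t.
       ereal (indicat_real {t. 0 \<le> t \<and> ennreal t \<le> \<tau> \<omega>} t *
              (exp (- lam * t) * running_cost lam c (Phi lam \<mu> m (\<lambda>n. \<sigma> n \<omega>) p t)))))"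

text \<open>For \<open>p\<close> in the quadrant the infimum lies in \<open>[- sqrt 2 / c, 0]\<close>, so \<open>real_of_ereal\<close> loses
  nothing.\<close>

definition value_function ::
  "real \<Rightarrow> real \<Rightarrow> real \<Rightarrow> real \<Rightarrow> 'a measure \<Rightarrow> (real \<Rightarrow> 'a \<Rightarrow> nat) \<Rightarrow> (nat \<Rightarrow> 'a \<Rightarrow> real)
     \<Rightarrow> real \<times> real \<Rightarrow> real" where
  "value_function lam \<mu> c m M N \<sigma> p =
     real_of_ereal (INF \<tau>\<in>{\<tau>. stopping_time (augmented_filtration M N) \<tau>}.
       stopping_cost lam \<mu> c m M \<sigma> p \<tau>)"

definition stopping_region :: "(real \<times> real \<Rightarrow> real) \<Rightarrow> (real \<times> real) set" where
  "stopping_region v = {p \<in> quadrant. v p = 0}"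

definition boundary_function :: "(real \<times> real) set \<Rightarrow> real \<Rightarrow> real" where
  "boundary_function \<Gamma> x = Inf {y. 0 \<le> y \<and> (x, y) \<in> \<Gamma>}"

definition support_end :: "(real \<Rightarrow> real) \<Rightarrow> real" where
  "support_end \<gamma> = Inf {x. 0 \<le> x \<and> \<gamma> x = 0}"

text \<open>This is not \<open>frontier \<Gamma>\<close>: the parts of the coordinate axes bordering \<open>\<Gamma>\<close> are excluded.\<close>

definition boundary_curve :: "(real \<Rightarrow> real) \<Rightarrow> (real \<times> real) set" where
  "boundary_curve \<gamma> = {(x, \<gamma> x) | x. x \<in> {0..support_end \<gamma>}}"

definition a0 :: "real \<Rightarrow> real \<Rightarrow> real \<Rightarrow> real" where
  "a0 lam c x = - x + lam / c * sqrt 2"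

definition fits_smoothly_at :: "(real \<Rightarrow> real) \<Rightarrow> (real \<Rightarrow> real) \<Rightarrow> real \<Rightarrow> bool" where
  "fits_smoothly_at f h x \<longleftrightarrow>
     f x = h x \<and> (\<exists>D. (f has_real_derivative D) (at x) \<and> (h has_real_derivative D) (at x))"


section \<open>Calculus on the quadrant and the variational inequalities\<close>

text \<open>Derivatives are taken relative to the quadrant, hence one-sided on the coordinate axes.\<close>

definition C1_on_quadrant_part :: "(real \<times> real) set \<Rightarrow> (real \<times> real \<Rightarrow> real) \<Rightarrow> bool" where
  "C1_on_quadrant_part U f \<longleftrightarrow>
     (\<exists>f' :: real \<times> real \<Rightarrow> (real \<times> real) \<Rightarrow>\<^sub>L real.
        (\<forall>p\<in>U. (f has_derivative blinfun_apply (f' p)) (at p within quadrant)) \<and>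
        continuous_on U f')"

definition D0 :: "(real \<times> real \<Rightarrow> real) \<Rightarrow> real \<times> real \<Rightarrow> real" where
  "D0 f p = vector_derivative (\<lambda>s. f (s, snd p)) (at (fst p) within {0..})"

definition D1 :: "(real \<times> real \<Rightarrow> real) \<Rightarrow> real \<times> real \<Rightarrow> real" where
  "D1 f p = vector_derivative (\<lambda>s. f (fst p, s)) (at (snd p) within {0..})"

definition generator ::
  "real \<Rightarrow> real \<Rightarrow> real \<Rightarrow> (real \<times> real \<Rightarrow> real) \<Rightarrow> real \<times> real \<Rightarrow> real" where
  "generator lam \<mu> m f p =
     D0 f p * ((lam + 1) * fst p + lam * (1 - m) / sqrt 2) +
     D1 f p * ((lam - 1) * snd p + lam * (1 + m) / sqrt 2) +
     \<mu> * (f (jump_map \<mu> p) - f p)"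

definition admissible :: "(real \<times> real) set \<Rightarrow> (real \<times> real \<Rightarrow> real) \<Rightarrow> bool" where
  "admissible B w \<longleftrightarrow>
     bounded (w ` quadrant) \<and> continuous_on quadrant w \<and> (\<forall>p\<in>quadrant. w p \<le> 0) \<and>
     C1_on_quadrant_part (quadrant - B) w \<and>
     (\<forall>p\<in>B. \<exists>\<epsilon>>0. \<exists>K. \<forall>q\<in>(quadrant - B) \<inter> ball p \<epsilon>. \<bar>D0 w q\<bar> \<le> K \<and> \<bar>D1 w q\<bar> \<le> K)"

definition solves_variational_inequalities ::
  "real \<Rightarrow> real \<Rightarrow> real \<Rightarrow> real \<Rightarrow> (real \<times> real) set \<Rightarrow> (real \<times> real) set
     \<Rightarrow> (real \<times> real \<Rightarrow> real) \<Rightarrow> bool" where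
  "solves_variational_inequalities lam \<mu> c m \<Gamma> B w \<longleftrightarrow>
     admissible B w \<and>
     (\<forall>p\<in>quadrant - \<Gamma>. generator lam \<mu> m w p - lam * w p + running_cost lam c p = 0) \<and>
     (\<forall>p\<in>\<Gamma>. w p = 0) \<and>
     (\<forall>p\<in>\<Gamma> - B. generator lam \<mu> m w p - lam * w p + running_cost lam c p > 0) \<and>
     (\<forall>p\<in>quadrant - \<Gamma>. w p < 0)"


section \<open>The process has the properties that characterise it\<close>

lemma linear_ode_ex1:
  "\<exists>!f. f 0 = (z::real) \<and> (\<forall>t. (f has_real_derivative a * f t + b) (at t))"
proof (rule ex_ex1I)
  define h where "h t = (if a = 0 then z + b * t else - b / a + (z + b / a) * exp (a * t))" for t
  have "(h has_real_derivative a * h t + b) (at t)" for t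
    unfolding h_def by (cases "a = 0") (auto intro!: derivative_eq_intros simp: field_simps)
  moreover have "h 0 = z"
    by (simp add: h_def)
  ultimately show "\<exists>f. f 0 = z \<and> (\<forall>t. (f has_real_derivative a * f t + b) (at t))"
    by blast
next
  fix f k :: "real \<Rightarrow> real"
  assume f: "f 0 = z \<and> (\<forall>t. (f has_real_derivative a * f t + b) (at t))"
    and k: "k 0 = z \<and> (\<forall>t. (k has_real_derivative a * k t + b) (at t))"
  define d where "d t = exp (- a * t) * (f t - k t)" for t
  have "(d has_real_derivative 0) (at t)" for t
    unfolding d_def using f k
    by (auto intro!: derivative_eq_intros simp: algebra_simps)
  then have "d t = d 0" for t
    using DERIV_isconst_all by blast
  then show "f = k"
    using f k by (auto simp: d_def)
qed

lemma linear_ode_solution: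
  "linear_ode_solution a b z 0 = z"
  "(linear_ode_solution a b z has_real_derivative a * linear_ode_solution a b z t + b) (at t)"
  using theI'[OF linear_ode_ex1[of z a b]] unfolding linear_ode_solution_def by auto

lemma flow_0: "flow lam m 0 p = p"
  by (simp add: flow_def x_flow_def y_flow_def linear_ode_solution)

lemma isCont_flow: "isCont (\<lambda>t. flow lam m t p) t"
  unfolding flow_def x_flow_def y_flow_def
  by (intro isCont_Pair DERIV_isCont[OF linear_ode_solution(2)])

lemma Phi_between_jumps:
  assumes "strict_mono s" "s n \<le> t" "t < s (Suc n)"
  shows "Phi lam \<mu> m s p t = flow lam m (t - s n) (Phi_at_jump lam \<mu> m s p n)"
proof -
  have "(THE n. s n \<le> t \<and> t < s (Suc n)) = n"
  proof (rule the_equality)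
    fix k assume k: "s k \<le> t \<and> t < s (Suc k)"
    have "s k < s (Suc n)" "s n < s (Suc k)"
      using assms k by auto
    then show "k = n"
      using assms(1) by (simp add: strict_mono_less)
  qed (use assms in simp)
  then show ?thesis
    by (simp add: Phi_def)
qed

lemma Phi_at_jump_time:
  assumes "strict_mono s"
  shows "Phi lam \<mu> m s p (s n) = Phi_at_jump lam \<mu> m s p n"
  using assms by (subst Phi_between_jumps[of s n]) (auto simp: flow_0 strict_mono_less)

lemma Phi_left_limit:
  assumes "strict_mono s"
  shows "(Phi lam \<mu> m s p \<longlongrightarrow> flow lam m (s (Suc n) - s n) (Phi_at_jump lam \<mu> m s p n))
           (at_left (s (Suc n)))"
proof (rule Lim_transform_eventually)
  show "((\<lambda>t. flow lam m (t - s n) (Phi_at_jump lam \<mu> m s p n))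
      \<longlongrightarrow> flow lam m (s (Suc n) - s n) (Phi_at_jump lam \<mu> m s p n)) (at_left (s (Suc n)))"
    by (intro isCont_tendsto_compose[OF isCont_flow] tendsto_intros)
  have "s n < s (Suc n)"
    using assms by (simp add: strict_mono_less)
  then have "\<forall>\<^sub>F t in at_left (s (Suc n)). t \<in> {s n<..<s (Suc n)}"
    by (rule eventually_at_left_real)
  then show "\<forall>\<^sub>F t in at_left (s (Suc n)).
      flow lam m (t - s n) (Phi_at_jump lam \<mu> m s p n) = Phi lam \<mu> m s p t"
    by eventually_elim (simp add: Phi_between_jumps[OF assms, of n])
qed

lemma Phi_jump:
  assumes "strict_mono s"
  shows "Phi lam \<mu> m s p (s (Suc n)) = jump_map \<mu> (Lim (at_left (s (Suc n))) (Phi lam \<mu> m s p))"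
  using tendsto_Lim[OF _ Phi_left_limit[OF assms]] by (simp add: Phi_at_jump_time[OF assms])

end

theory Submission
  imports Defs
begin

text \<open>
  Write \<open>\<Phi>\<close> for the process, \<open>F\<close> for the flow between the jumps, \<open>S\<close> for the jump map and
  \<open>G w = g + \<mu> * (w \<circ> S)\<close>.  The lower bound on \<open>lam\<close> says that \<open>y\<close> does not decrease along the flow
  below the level of \<open>a0\<close> at \<open>0\<close>.  Hence \<open>G w\<close> changes sign at most once along a trajectory, from
  negative to positive, for all functions \<open>w\<close> that matter.  So the value function
  is the fixed point of the operator that sends \<open>w\<close> to the integral of
  \<open>exp (- (lam + \<mu>) * t) * min 0 (G w (F t p))\<close>, and \<open>\<Gamma>\<close> is the set where \<open>G v \<ge> 0\<close>.

  The operator preserves monotonicity, Lipschitz bounds and concavity in each coordinate.  The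
  one-sided partial derivatives of its fixed point solve a linear fixed point equation that contracts
  and preserves continuity, because a trajectory meets the zero set of \<open>G v\<close> at most once.  So \<open>v\<close> is
  continuously differentiable, and the implicit function theorem for \<open>G v = 0\<close>, where the
  derivative in \<open>y\<close> is at least \<open>1\<close>, gives the smoothness of \<open>\<gamma>\<close>.  At the right end-point of the
  linear part \<open>S\<close> maps into \<open>\<Gamma>\<close>, where the gradient of \<open>v\<close> vanishes, and the slope is \<open>-1\<close>.

  The fixed point is identified with the value function on a time grid of mesh \<open>h\<close>: up to an error
  of order \<open>h\<^sup>2\<close> per step only the number of jumps in the step matters, and the discounted process
  \<open>v \<circ> \<Phi>\<close> with the accumulated cost is a submartingale, and a martingale until \<open>\<Phi>\<close> enters \<open>\<Gamma>\<close>.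
  Rounding a stopping time up to the grid removes the right-continuous enlargement of the filtration.
\<close>

section \<open>The flow and the Bellman operator\<close>

text \<open>Integrating out the first jump, an exponential time of rate \<mu>, leaves a
  deterministic problem: along \<open>F\<close> the cost accrues at rate \<open>G w\<close> with
  weight \<open>exp (- kap * t)\<close>. As \<open>G w\<close> turns from negative to positive at
  most once, stopping at that moment is best, and the infimum over times is the integral of the
  negative part. The sign pattern has two sources: x grows at least at speed \<open>b0\<close>, and
  y can fall only above \<open>thr\<close>, where \<open>w\<close> vanishes after a jump and
  \<open>G w\<close> is just the cost.

  A shift of the start along a coordinate is stretched by \<open>exp (a * t)\<close> under the flow
  and by s at a jump. Since \<open>kap - a = \<mu> * s\<close>, differentiating the fixed point
  equation leaves the kernel \<open>\<nu> * exp (- \<nu> * t)\<close> with \<nu> = \<mu> * s; its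
  mass on the finite horizon \<open>hor\<close> is less than 1, which is where the contraction comes
  from.

  The obstacle in the identification is the unbounded cost. For the lower bound it is replaced by a
  bounded minorant; for the upper bound its growth is controlled by 2 to the number of jumps, whose
  expectation is finite.\<close>

definition exp_primitive :: "real \<Rightarrow> real \<Rightarrow> real" where
  "exp_primitive a t = (if a = 0 then t else (exp (a * t) - 1) / a)"

lemma exp_primitive_0 [simp]: "exp_primitive a 0 = 0"
  by (simp add: exp_primitive_def)

lemma DERIV_exp_primitive: "(exp_primitive a has_real_derivative exp (a * t)) (at t)"
  unfolding exp_primitive_def
  by (cases "a = 0") (auto intro!: derivative_eq_intros simp: fun_eq_iff)

lemma exp_primitive_eq: "1 + a * exp_primitive a t = exp (a * t)"
  by (simp add: exp_primitive_def)

lemma exp_primitive_add: "exp_primitive a (s + t) = exp (a * t) * exp_primitive a s + exp_primitive a t"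
  by (simp add: exp_primitive_def field_simps exp_add)

lemma exp_primitive_nonneg: "0 \<le> t \<Longrightarrow> 0 \<le> exp_primitive a t"
  by (auto simp: exp_primitive_def zero_le_divide_iff mult_le_0_iff zero_le_mult_iff)

lemma exp_primitive_ge:
  assumes "0 \<le> a" "0 \<le> t"
  shows "t \<le> exp_primitive a t"
proof (cases "a = 0")
  case False
  then show ?thesis
    using assms exp_ge_add_one_self[of "a * t"] by (simp add: exp_primitive_def field_simps)
qed (simp add: exp_primitive_def)

lemma exp_primitive_le:
  assumes "0 \<le> t" "t \<le> 1"
  shows "exp_primitive a t \<le> exp \<bar>a\<bar> * t"
proof (cases "t = 0")
  case False
  then have "t > 0" using assms by simp
  obtain z where z: "0 < z" "z < t" "exp_primitive a t - exp_primitive a 0 = (t - 0) * exp (a * z)"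
    using MVT2[OF \<open>t > 0\<close>, of "exp_primitive a" "\<lambda>t. exp (a * t)"] DERIV_exp_primitive by blast
  have "a * z \<le> \<bar>a\<bar>"
    using z assms mult_mono[of a "\<bar>a\<bar>" z 1] by auto
  then show ?thesis
    using z assms mult_left_mono[of "exp (a * z)" "exp \<bar>a\<bar>" t] by (simp add: mult.commute)
qed simp

lemma continuous_on_exp_primitive [continuous_intros]:
  "continuous_on A f \<Longrightarrow> continuous_on A (\<lambda>x. exp_primitive a (f x))"
  by (rule continuous_on_compose2[of UNIV])
    (auto intro!: DERIV_continuous_on DERIV_exp_primitive)

text \<open>Since \<open>exp_primitive\<close> is the integral of the exponential from 0, one
  formula also covers the rate 0, which occurs in the second coordinate when
  \<open>lam = 1\<close>.\<close>

lemma linear_ode_solution_eq: "linear_ode_solution a b z t = exp (a * t) * z + b * exp_primitive a t"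
proof -
  have "linear_ode_solution a b z = (\<lambda>t. exp (a * t) * z + b * exp_primitive a t)"
  proof (rule ex1E[OF linear_ode_ex1[of z a b]])
    fix f assume uniq: "\<forall>g. g 0 = z \<and> (\<forall>t. (g has_real_derivative a * g t + b) (at t)) \<longrightarrow> g = f"
    have "linear_ode_solution a b z = f"
      using uniq linear_ode_solution by blast
    moreover have "((\<lambda>t. exp (a * t) * z + b * exp_primitive a t) has_real_derivative
        a * (exp (a * t) * z + b * exp_primitive a t) + b) (at t)" for t
      by (rule derivative_eq_intros DERIV_exp_primitive refl)+
        (simp flip: exp_primitive_eq add: algebra_simps)
    then have "(\<lambda>t. exp (a * t) * z + b * exp_primitive a t) = f"
      using uniq by simp
    ultimately show ?thesis by simp
  qed
  then show ?thesis by simp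
qed

lemma linear_ode_solution_add:
  "linear_ode_solution a b z (s + t) = linear_ode_solution a b (linear_ode_solution a b z s) t"
  by (simp add: linear_ode_solution_eq exp_primitive_add exp_add algebra_simps)

text \<open>The displacement is a factor, nonnegative for nonnegative times, times the velocity at
  the start. So its sign is that of the initial drift, and its size is linear in short
  times.\<close>

lemma linear_ode_solution_diff:
  "linear_ode_solution a b z t - z = exp_primitive a t * (a * z + b)"
  by (simp add: linear_ode_solution_eq flip: exp_primitive_eq) (simp add: algebra_simps)

section \<open>Constants of the problem, the deterministic flow and the jump map\<close>

locale disorder =
  fixes lam \<mu> c m :: real
  assumes lam_pos: "0 < lam" and mu_gt_1: "1 < \<mu>" and c_pos: "0 < c"
    and m_bounds: "-1 < m" "m < 1" and lam_ge: "1 - (1 + m) * (c / 2) \<le> lam"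
begin

text \<open>\<open>bnd\<close> bounds the value function, since the discounted cost is at least
  \<open>- thr / lam\<close>; \<open>G w\<close> below is nonnegative once \<open>fst p + snd p \<ge> cap\<close>, which the flow achieves
  from any starting point by time \<open>hor\<close>.\<close>

definition thr :: real where "thr = lam / c * sqrt 2"
definition bnd :: real where "bnd = thr / lam"
definition b0 :: real where "b0 = lam * (1 - m) / sqrt 2"
definition b1 :: real where "b1 = lam * (1 + m) / sqrt 2"
text \<open>Discount rate plus jump rate: the weight \<open>exp (- kap * t)\<close> is the discount
  factor times the probability that no jump has occurred by time t.\<close>

definition kap :: real where "kap = lam + \<mu>"
definition cap :: real where "cap = thr + \<mu> * bnd"
definition hor :: real where "hor = cap / b0"

abbreviation F :: "real \<Rightarrow> real \<times> real \<Rightarrow> real \<times> real" where "F \<equiv> flow lam m"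
abbreviation S :: "real \<times> real \<Rightarrow> real \<times> real" where "S \<equiv> jump_map \<mu>"
abbreviation g :: "real \<times> real \<Rightarrow> real" where "g \<equiv> running_cost lam c"
abbreviation Q :: "(real \<times> real) set" where "Q \<equiv> quadrant"

lemma Q_iff: "p \<in> Q \<longleftrightarrow> 0 \<le> fst p \<and> 0 \<le> snd p"
  by (cases p) (simp add: quadrant_def)

lemma const_pos: "0 < thr" "0 < bnd" "0 < b0" "0 < b1" "0 < kap" "0 < cap" "0 < hor"
  using lam_pos mu_gt_1 c_pos m_bounds
  by (auto simp: thr_def bnd_def b0_def b1_def kap_def cap_def hor_def
      intro!: divide_pos_pos mult_pos_pos add_pos_pos)

lemma g_eq: "g p = fst p + snd p - thr"
  by (simp add: running_cost_def thr_def)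

lemma F_eq: "F t p = (exp ((lam + 1) * t) * fst p + b0 * exp_primitive (lam + 1) t,
                     exp ((lam - 1) * t) * snd p + b1 * exp_primitive (lam - 1) t)"
  by (simp add: flow_def x_flow_def y_flow_def linear_ode_solution_eq b0_def b1_def)

lemma S_eq: "S p = ((1 - 1 / \<mu>) * fst p, (1 + 1 / \<mu>) * snd p)"
  by (simp add: jump_map_def)

lemma F_0 [simp]: "F 0 p = p"
  by (rule flow_0)

lemma F_add: "F (s + t) p = F t (F s p)"
  by (simp add: flow_def x_flow_def y_flow_def linear_ode_solution_add)

lemma F_in_Q: "p \<in> Q \<Longrightarrow> 0 \<le> t \<Longrightarrow> F t p \<in> Q"
  using const_pos by (simp add: Q_iff F_eq exp_primitive_nonneg)

lemma S_in_Q: "p \<in> Q \<Longrightarrow> S p \<in> Q"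
  using mu_gt_1 by (simp add: Q_iff S_eq)

lemma F_fst_ge:
  assumes "p \<in> Q" "0 \<le> t"
  shows "fst p + b0 * t \<le> fst (F t p)"
proof -
  have "1 * fst p \<le> exp ((lam + 1) * t) * fst p"
    using assms lam_pos by (intro mult_right_mono) (auto simp: Q_iff)
  moreover have "b0 * t \<le> b0 * exp_primitive (lam + 1) t"
    using assms lam_pos const_pos by (intro mult_left_mono exp_primitive_ge) auto
  ultimately show ?thesis by (simp add: F_eq)
qed

text \<open>The only place where the lower bound on \<open>lam\<close> enters.\<close>

lemma drift_at_thr: "0 \<le> (lam - 1) * thr + b1"
proof -
  have "b1 = lam * (1 + m) * (sqrt 2 / 2)"
    unfolding b1_def using real_sqrt_mult_self[of 2] by (simp add: field_simps)
  then have "(lam - 1) * thr + b1 = (lam * sqrt 2 / c) * (lam - 1 + (1 + m) * (c / 2))"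
    using c_pos unfolding thr_def by (simp add: field_simps)
  then show ?thesis
    using lam_pos c_pos lam_ge by (simp only:) (intro mult_nonneg_nonneg, auto)
qed

text \<open>The drift of y is affine in the level, positive at 0 and nonnegative at
  \<open>thr\<close>, hence nonnegative at \<open>z = min (snd p) thr\<close>. The solution started
  at z never falls below z, and the flow preserves the order of starting points.\<close>

lemma F_snd_ge:
  assumes "p \<in> Q" "0 \<le> t"
  shows "min (snd p) thr \<le> snd (F t p)"
proof -
  define z where "z = min (snd p) thr"
  have z: "0 \<le> z" "z \<le> thr" "z \<le> snd p"
    using assms const_pos by (auto simp: z_def Q_iff)
  have "0 \<le> (lam - 1) * z + b1"
  proof (cases "lam \<ge> 1")
    case False
    then have "(lam - 1) * thr \<le> (lam - 1) * z" using z by (simp add: mult_le_cancel_left)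
    then show ?thesis using drift_at_thr by simp
  qed (use z const_pos in simp)
  then have "0 \<le> exp_primitive (lam - 1) t * ((lam - 1) * z + b1)"
    using assms exp_primitive_nonneg by simp
  also have "\<dots> = exp ((lam - 1) * t) * z + b1 * exp_primitive (lam - 1) t - z"
    by (simp flip: linear_ode_solution_diff add: linear_ode_solution_eq)
  also have "\<dots> \<le> snd (F t p) - z"
    using z by (simp add: F_eq)
  finally show ?thesis by (simp add: z_def)
qed

lemma continuous_on_F: "continuous_on A f \<Longrightarrow> continuous_on A h \<Longrightarrow> continuous_on A (\<lambda>x. F (f x) (h x))"
  unfolding F_eq by (intro continuous_intros)

lemma continuous_on_S: "continuous_on A h \<Longrightarrow> continuous_on A (\<lambda>x. S (h x))"
  unfolding S_eq by (intro continuous_intros)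

lemma continuous_on_g: "continuous_on A h \<Longrightarrow> continuous_on A (\<lambda>x. g (h x))"
  unfolding g_eq by (intro continuous_intros)

text \<open>The flow, the jump map and the cost are affine in each coordinate; \<open>coord e a s\<close> records
  a coordinate vector \<open>e\<close> with its rate \<open>a\<close> under the flow and its factor \<open>s\<close> under a jump.\<close>

definition coord :: "real \<times> real \<Rightarrow> real \<Rightarrow> real \<Rightarrow> bool" where
  "coord e a s \<longleftrightarrow> (e, a, s) \<in> {((1, 0), lam + 1, 1 - 1 / \<mu>), ((0, 1), lam - 1, 1 + 1 / \<mu>)}"

lemma coord_x: "coord (1, 0) (lam + 1) (1 - 1 / \<mu>)"
  and coord_y: "coord (0, 1) (lam - 1) (1 + 1 / \<mu>)"
  by (simp_all add: coord_def)

text \<open>The third fact is the structural one: the rate left over after the stretching by the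
  flow, \<open>kap - a\<close>, equals the jump rate times the jump factor. It holds in both
  coordinates, as \<mu> - 1 and \<mu> + 1.\<close>

lemma coordD:
  assumes "coord e a s"
  shows "e \<in> Q" "0 < s" "kap - a = \<mu> * s" "g (p + h *\<^sub>R e) = g p + h"
    "F t (p + h *\<^sub>R e) = F t p + (exp (a * t) * h) *\<^sub>R e"
    "S (p + h *\<^sub>R e) = S p + (s * h) *\<^sub>R e"
proof -
  consider "e = (1, 0)" "a = lam + 1" "s = 1 - 1 / \<mu>" | "e = (0, 1)" "a = lam - 1" "s = 1 + 1 / \<mu>"
    using assms by (auto simp: coord_def)
  then show "e \<in> Q" "0 < s" "kap - a = \<mu> * s" "g (p + h *\<^sub>R e) = g p + h"
    "F t (p + h *\<^sub>R e) = F t p + (exp (a * t) * h) *\<^sub>R e"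
    "S (p + h *\<^sub>R e) = S p + (s * h) *\<^sub>R e"
    using mu_gt_1
    by (cases; simp add: Q_iff kap_def g_eq F_eq S_eq distrib_left right_diff_distrib add_pos_pos)+
qed

lemma coord_in_Q: "coord e a s \<Longrightarrow> p \<in> Q \<Longrightarrow> 0 \<le> h \<Longrightarrow> p + h *\<^sub>R e \<in> Q"
  using coordD(1) by (auto simp: Q_iff)

text \<open>The cost rate of the process killed at its first jump: running cost plus jump rate times
  the value found after the jump.\<close>

definition G :: "(real \<times> real \<Rightarrow> real) \<Rightarrow> real \<times> real \<Rightarrow> real" where
  "G w p = g p + \<mu> * w (S p)"

text \<open>Instead of taking an infimum over deterministic stopping times one may truncate the integrand,
  because \<open>G w\<close> changes sign at most once along a trajectory (\<open>G_flow_ge\<close>).\<close>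

definition H :: "(real \<times> real \<Rightarrow> real) \<Rightarrow> real \<times> real \<Rightarrow> real" where
  "H w p = integral {0..hor} (\<lambda>t. exp (- kap * t) * min 0 (G w (F t p)))"

text \<open>\<open>slope s\<close> is a Lipschitz constant that \<open>H\<close> preserves; \<open>good\<close> collects properties which
  \<open>H\<close> preserves and which survive pointwise limits.\<close>

definition slope :: "real \<Rightarrow> real" where
  "slope s = exp (\<mu> * s * hor) / (\<mu> * s)"

definition good :: "(real \<times> real \<Rightarrow> real) \<Rightarrow> bool" where
  "good w \<longleftrightarrow>
     (\<forall>p\<in>Q. - bnd \<le> w p \<and> w p \<le> 0) \<and>
     (\<forall>e a s. coord e a s \<longrightarrow> (\<forall>p\<in>Q. \<forall>h\<ge>0.
        0 \<le> w (p + h *\<^sub>R e) - w p \<and> w (p + h *\<^sub>R e) - w p \<le> slope s * h \<and>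
        (\<forall>u\<in>{0..1}. (1 - u) * w p + u * w (p + h *\<^sub>R e) \<le> w (p + (u * h) *\<^sub>R e)))) \<and>
     (\<forall>p\<in>Q. (\<forall>j. 0 \<le> g ((S ^^ j) p)) \<longrightarrow> w p = 0)"

text \<open>The last property exhibits a set on which every candidate vanishes, before the fixed
  point is known. Only jumps are iterated in it, since nonnegativity of \<open>G w\<close> at the
  start already makes the integrand of \<open>H\<close> vanish along the whole trajectory.\<close>

lemma goodD:
  assumes "good w" "p \<in> Q"
  shows "- bnd \<le> w p" "w p \<le> 0"
    "coord e a s \<Longrightarrow> 0 \<le> h \<Longrightarrow> w p \<le> w (p + h *\<^sub>R e)"
    "coord e a s \<Longrightarrow> 0 \<le> h \<Longrightarrow> w (p + h *\<^sub>R e) - w p \<le> slope s * h"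
    "coord e a s \<Longrightarrow> 0 \<le> h \<Longrightarrow> 0 \<le> u \<Longrightarrow> u \<le> 1 \<Longrightarrow>
       (1 - u) * w p + u * w (p + h *\<^sub>R e) \<le> w (p + (u * h) *\<^sub>R e)"
    "(\<And>j. 0 \<le> g ((S ^^ j) p)) \<Longrightarrow> w p = 0"
proof -
  show "- bnd \<le> w p" "w p \<le> 0"
    using assms unfolding good_def by blast+
  {
    assume "coord e a s" "0 \<le> h"
    then have *: "0 \<le> w (p + h *\<^sub>R e) - w p \<and> w (p + h *\<^sub>R e) - w p \<le> slope s * h \<and>
        (\<forall>u\<in>{0..1}. (1 - u) * w p + u * w (p + h *\<^sub>R e) \<le> w (p + (u * h) *\<^sub>R e))"
      using assms unfolding good_def by blast
    then show "w p \<le> w (p + h *\<^sub>R e)" "w (p + h *\<^sub>R e) - w p \<le> slope s * h"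
      by linarith+
    assume "0 \<le> u" "u \<le> 1"
    then show "(1 - u) * w p + u * w (p + h *\<^sub>R e) \<le> w (p + (u * h) *\<^sub>R e)"
      using *[THEN conjunct2, THEN conjunct2, THEN bspec, of u] by simp
  }
  show "w p = 0" if "\<And>j. 0 \<le> g ((S ^^ j) p)"
    using assms that unfolding good_def by blast
qed

lemma slope_pos: "coord e a s \<Longrightarrow> 0 < slope s"
  using coordD(2) mu_gt_1 by (simp add: slope_def)

lemma good_mono:
  assumes "good w" "p \<in> Q" "fst p \<le> fst q" "snd p \<le> snd q"
  shows "w p \<le> w q"
proof -
  have 1: "p + (fst q - fst p) *\<^sub>R (1, 0) \<in> Q"
    using assms by (auto simp: Q_iff)
  have "w p \<le> w (p + (fst q - fst p) *\<^sub>R (1, 0))"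
    using assms goodD(3)[OF assms(1,2) coord_x] by simp
  also have "\<dots> \<le> w (p + (fst q - fst p) *\<^sub>R (1, 0) + (snd q - snd p) *\<^sub>R (0, 1))"
    using assms goodD(3)[OF assms(1) 1 coord_y] by simp
  also have "p + (fst q - fst p) *\<^sub>R (1, 0) + (snd q - snd p) *\<^sub>R (0, 1) = q"
    by (simp add: prod_eq_iff)
  finally show ?thesis .
qed

definition lip :: real where "lip = slope (1 - 1 / \<mu>) + slope (1 + 1 / \<mu>)"

lemma lip_pos: "0 < lip"
  using slope_pos[OF coord_x] slope_pos[OF coord_y] by (simp add: lip_def)

lemma slope_le_lip: "coord e a s \<Longrightarrow> slope s \<le> lip"
  using slope_pos[OF coord_x] slope_pos[OF coord_y] by (auto simp: lip_def coord_def)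

lemma good_coord_lip:
  assumes "good w" "p \<in> Q" "p + h *\<^sub>R e \<in> Q" "coord e a s"
  shows "\<bar>w (p + h *\<^sub>R e) - w p\<bar> \<le> lip * \<bar>h\<bar>"
proof (cases "h \<ge> 0")
  case True
  have "slope s * h \<le> lip * h"
    using True assms slope_le_lip by (intro mult_right_mono)
  then show ?thesis
    using goodD(3,4)[OF assms(1,2,4) True] True by simp
next
  case False
  then have h: "0 \<le> -h" by simp
  have "w p - w (p + h *\<^sub>R e) \<le> slope s * (-h)"
    using goodD(4)[OF assms(1,3,4) h] by simp
  also have "\<dots> \<le> lip * (-h)"
    using h assms slope_le_lip by (intro mult_right_mono)
  finally show ?thesis
    using goodD(3)[OF assms(1,3,4) h] False by (simp add: abs_if)
qed

lemma good_lip: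
  assumes "good w" "p \<in> Q" "q \<in> Q"
  shows "\<bar>w q - w p\<bar> \<le> lip * (\<bar>fst q - fst p\<bar> + \<bar>snd q - snd p\<bar>)"
proof -
  define r where "r = p + (fst q - fst p) *\<^sub>R (1, 0)"
  have r: "r \<in> Q" "q = r + (snd q - snd p) *\<^sub>R (0, 1)"
    using assms by (auto simp: Q_iff r_def prod_eq_iff)
  have "\<bar>w r - w p\<bar> \<le> lip * \<bar>fst q - fst p\<bar>"
    unfolding r_def using good_coord_lip[OF assms(1,2) _ coord_x] r(1) by (simp add: r_def)
  moreover have "\<bar>w q - w r\<bar> \<le> lip * \<bar>snd q - snd p\<bar>"
    using good_coord_lip[OF assms(1) r(1) _ coord_y, of "snd q - snd p"] r(2) assms(3) by simp
  ultimately show ?thesis by (simp add: algebra_simps)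
qed

lemma good_continuous: "good w \<Longrightarrow> continuous_on Q w"
proof -
  assume w: "good w"
  have "lipschitz_on (2 * lip) Q w"
  proof (rule lipschitz_onI)
    fix p q assume "p \<in> Q" "q \<in> Q"
    then have "dist (w p) (w q) \<le> lip * (\<bar>fst p - fst q\<bar> + \<bar>snd p - snd q\<bar>)"
      using good_lip[OF w, of q p] by (simp add: dist_real_def)
    also have "\<dots> \<le> lip * (dist p q + dist p q)"
      using dist_fst_le[of p q] dist_snd_le[of p q] lip_pos
      by (intro mult_left_mono add_mono) (auto simp only: dist_real_def)
    finally show "dist (w p) (w q) \<le> 2 * lip * dist p q" by simp
  qed (use lip_pos in simp)
  then show ?thesis by (rule lipschitz_on_continuous_on)
qed

lemma continuous_on_G:
  assumes "continuous_on Q w" "continuous_on A h" "\<And>x. x \<in> A \<Longrightarrow> h x \<in> Q"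
  shows "continuous_on A (\<lambda>x. G w (h x))"
  unfolding G_def
  by (intro continuous_intros continuous_on_g assms continuous_on_compose2[OF assms(1)] continuous_on_S)
    (use S_in_Q assms(3) in blast)+

text \<open>The running cost alone contributes slope one; the jump term only helps, by monotonicity.
  This strict growth is behind the uniqueness of zeros along trajectories and the Lipschitz bound
  for \<gamma>.\<close>

lemma G_mono_shift:
  assumes "good w" "p \<in> Q" "fst p \<le> fst q" "snd p \<le> snd q"
  shows "G w p + (fst q - fst p) + (snd q - snd p) \<le> G w q"
proof -
  have "0 \<le> 1 - 1 / \<mu>" "0 \<le> 1 + 1 / \<mu>"
    using mu_gt_1 by (auto simp: field_simps)
  then have "fst (S p) \<le> fst (S q)" "snd (S p) \<le> snd (S q)"
    unfolding S_eq fst_conv snd_conv by (auto intro: mult_left_mono assms)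
  then have "\<mu> * w (S p) \<le> \<mu> * w (S q)"
    using mu_gt_1 by (intro mult_left_mono good_mono[OF assms(1) S_in_Q[OF assms(2)]]) auto
  then show ?thesis
    unfolding G_def g_eq by linarith
qed

lemma G_coord:
  assumes "good w" "p \<in> Q" "coord e a s" "0 \<le> h"
  shows "G w p + h \<le> G w (p + h *\<^sub>R e)" "G w (p + h *\<^sub>R e) - G w p \<le> (1 + \<mu> * s * slope s) * h"
    "0 \<le> u \<Longrightarrow> u \<le> 1 \<Longrightarrow> (1 - u) * G w p + u * G w (p + h *\<^sub>R e) \<le> G w (p + (u * h) *\<^sub>R e)"
proof -
  note c = coordD[OF assms(3)]
  have sh: "0 \<le> s * h" using c assms by simp
  note w = goodD[OF assms(1) S_in_Q[OF assms(2)]]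
  show "G w p + h \<le> G w (p + h *\<^sub>R e)"
    using w(3)[OF assms(3) sh] mu_gt_1 by (simp add: G_def c)
  have "\<mu> * (w (S p + (s * h) *\<^sub>R e) - w (S p)) \<le> \<mu> * (slope s * (s * h))"
    using w(4)[OF assms(3) sh] mu_gt_1 by (intro mult_left_mono) auto
  then show "G w (p + h *\<^sub>R e) - G w p \<le> (1 + \<mu> * s * slope s) * h"
    by (simp add: G_def c algebra_simps)
  assume u: "0 \<le> u" "u \<le> 1"
  have "\<mu> * ((1 - u) * w (S p) + u * w (S p + (s * h) *\<^sub>R e)) \<le> \<mu> * w (S p + (u * (s * h)) *\<^sub>R e)"
    using w(5)[OF assms(3) sh u] mu_gt_1 by (intro mult_left_mono) auto
  then show "(1 - u) * G w p + u * G w (p + h *\<^sub>R e) \<le> G w (p + (u * h) *\<^sub>R e)"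
    by (simp add: G_def c algebra_simps)
qed

lemma G_ge:
  assumes "good w" "p \<in> Q"
  shows "g p - \<mu> * bnd \<le> G w p" "G w p \<le> g p" "fst p + snd p - cap \<le> G w p" "- cap \<le> G w p"
proof -
  show "g p - \<mu> * bnd \<le> G w p" "G w p \<le> g p"
    using goodD(1,2)[OF assms(1) S_in_Q[OF assms(2)]] mu_gt_1 mult_left_mono[of "-bnd" "w (S p)" \<mu>]
    by (auto simp: G_def mult_le_0_iff)
  then show "fst p + snd p - cap \<le> G w p" "- cap \<le> G w p"
    using assms(2) by (auto simp: g_eq cap_def Q_iff)
qed

text \<open>Jumps increase y, so all iterates under \<open>S\<close> stay above \<open>thr\<close>,
  where the cost is nonnegative; hence \<open>w\<close> vanishes after the jump and only the cost
  remains.\<close>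

lemma G_above_thr:
  assumes "good w" "p \<in> Q" "thr \<le> snd p"
  shows "fst p \<le> G w p"
proof -
  have pw: "(S ^^ j) p \<in> Q \<and> thr \<le> snd ((S ^^ j) p)" for j
  proof (induction j)
    case (Suc j)
    have "snd ((S ^^ j) p) \<le> snd ((S ^^ Suc j) p)"
      using Suc mu_gt_1 mult_right_mono[of 1 "1 + 1 / \<mu>" "snd ((S ^^ j) p)"]
      by (simp add: S_eq[of "(S ^^ j) p"] Q_iff)
    then show ?case using Suc S_in_Q by auto
  qed (use assms in auto)
  have "w (S p) = 0"
  proof (rule goodD(6)[OF assms(1) S_in_Q[OF assms(2)]])
    fix j show "0 \<le> g ((S ^^ j) (S p))"
      using pw[of "Suc j"] by (simp add: g_eq Q_iff funpow_Suc_right del: funpow.simps)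
  qed
  then show ?thesis using assms by (simp add: G_def g_eq)
qed

text \<open>Below \<open>thr\<close> neither coordinate decreases along the flow, so
  \<open>G_mono_shift\<close> applies. From above \<open>thr\<close> the y-coordinate may fall, but
  not below \<open>thr\<close>, and there \<open>G w\<close> dominates x. The truncation by 0 is for
  the second case, where \<open>G w\<close> itself may decrease. The term \<open>b0 * t\<close>
  makes the sign change strict.\<close>

lemma G_flow_ge:
  assumes "good w" "p \<in> Q" "0 \<le> t"
  shows "b0 * t + min 0 (G w p) \<le> G w (F t p)"
proof (cases "snd p \<le> thr")
  case True
  have "G w p + (fst (F t p) - fst p) + (snd (F t p) - snd p) \<le> G w (F t p)"
    using F_fst_ge[OF assms(2,3)] F_snd_ge[OF assms(2,3)] True assms
      mult_nonneg_nonneg[OF less_imp_le[OF const_pos(3)] assms(3)]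
    by (intro G_mono_shift) auto
  then show ?thesis
    using F_fst_ge[OF assms(2,3)] F_snd_ge[OF assms(2,3)] True by simp
next
  case False
  then have "fst (F t p) \<le> G w (F t p)"
    using F_snd_ge[OF assms(2,3)] assms by (intro G_above_thr F_in_Q) auto
  then show ?thesis
    using F_fst_ge[OF assms(2,3)] assms(2) by (simp add: Q_iff min_def)
qed

lemma G_flow_hor:
  assumes "good w" "p \<in> Q" "hor \<le> t"
  shows "0 \<le> G w (F t p)"
proof -
  have t: "0 \<le> t" using assms const_pos by simp
  have "cap \<le> b0 * t"
    using assms const_pos by (simp add: hor_def field_simps)
  moreover have "- cap \<le> min 0 (G w p)"
    using G_ge[OF assms(1,2)] const_pos by simp
  ultimately show ?thesis using G_flow_ge[OF assms(1,2) t] by linarith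
qed

lemma min_G_bounds:
  assumes "good w" "p \<in> Q"
  shows "- cap \<le> min 0 (G w p)" "min 0 (G w p) \<le> 0"
  using G_ge[OF assms] const_pos by auto

lemma continuous_on_integrand:
  assumes "good w" "p \<in> Q" "A \<subseteq> {0..}"
  shows "continuous_on A (\<lambda>t. exp (- kap * t) * min 0 (G w (F t p)))"
  by (intro continuous_intros continuous_on_G good_continuous continuous_on_F assms)
    (use assms F_in_Q[OF assms(2)] in auto)

lemma integrable_integrand:
  assumes "good w" "p \<in> Q" "0 \<le> x"
  shows "(\<lambda>t. exp (- kap * t) * min 0 (G w (F t p))) integrable_on {x..y}"
  using assms by (intro integrable_continuous_real continuous_on_integrand) auto

lemma integral_exp_decay:
  assumes "0 < (\<nu>::real)" "0 \<le> r"
  shows "((\<lambda>t. exp (- \<nu> * t)) has_integral (1 - exp (- \<nu> * r)) / \<nu>) {0..r}"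
proof -
  have "((\<lambda>t. exp (- \<nu> * t)) has_integral (- exp (- \<nu> * r) / \<nu> - - exp (- \<nu> * 0) / \<nu>)) {0..r}"
    using assms
    by (intro fundamental_theorem_of_calculus)
      (auto intro!: derivative_eq_intros simp flip: has_real_derivative_iff_has_vector_derivative)
  then show ?thesis by (simp add: diff_divide_distrib)
qed

end

section \<open>The fixed point of the Bellman operator\<close>

context disorder
begin

section \<open>The operator preserves the class \<open>good\<close>\<close>

abbreviation integrand :: "(real \<times> real \<Rightarrow> real) \<Rightarrow> real \<times> real \<Rightarrow> real \<Rightarrow> real" where
  "integrand w p t \<equiv> exp (- kap * t) * min 0 (G w (F t p))"

text \<open>The bounds are self-consistent: the integral of \<open>- cap\<close> with weight
  \<open>exp (- kap * t)\<close> over all times is again \<open>- bnd\<close>.\<close>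

lemma cap_eq: "cap = kap * bnd"
  using lam_pos by (simp add: cap_def kap_def bnd_def field_simps)

lemma integrand_nonpos: "integrand w p t \<le> 0"
  by (simp add: mult_le_0_iff)

text \<open>A shift of the start becomes at time t a shift in the same direction, stretched by
  \<open>exp (a * t)\<close>. So each claim reduces, for fixed t, to \<open>G_coord\<close> and to
  \<open>min 0\<close> being increasing, 1-Lipschitz and concave.\<close>

lemma H_coord:
  assumes w: "good w" and p: "p \<in> Q" and c: "coord e a s" and h: "0 \<le> h"
  shows "H w p \<le> H w (p + h *\<^sub>R e)" "H w (p + h *\<^sub>R e) - H w p \<le> slope s * h"
    "0 \<le> u \<Longrightarrow> u \<le> 1 \<Longrightarrow> (1 - u) * H w p + u * H w (p + h *\<^sub>R e) \<le> H w (p + (u * h) *\<^sub>R e)"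
proof -
  note cD = coordD[OF c]
  define \<nu> where "\<nu> = \<mu> * s"
  have \<nu>: "0 < \<nu>" "kap - a = \<nu>" using cD mu_gt_1 by (auto simp: \<nu>_def)
  define q where "q = p + h *\<^sub>R e"
  have q: "q \<in> Q" using coord_in_Q[OF c p h] by (simp add: q_def)
  have int: "integrand w r integrable_on {0..hor}" if "r \<in> Q" for r
    using integrable_integrand[OF w that] by simp
  have Fq: "F t q = F t p + (exp (a * t) * h) *\<^sub>R e" for t
    by (simp add: q_def cD)
  have nn: "0 \<le> exp (a * t) * h" for t using h by simp
  show "H w p \<le> H w (p + h *\<^sub>R e)"
    unfolding H_def q_def[symmetric]
  proof (rule integral_le[OF int[OF p] int[OF q]])
    fix t assume "t \<in> {0..hor}"
    then have "G w (F t p) \<le> G w (F t q)"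
      using G_coord(1)[OF w F_in_Q[OF p] c nn, of t t] nn[of t] by (simp add: Fq)
    then show "integrand w p t \<le> integrand w q t"
      by (intro mult_left_mono) auto
  qed
  have "H w q - H w p = integral {0..hor} (\<lambda>t. integrand w q t - integrand w p t)"
    unfolding H_def by (rule integral_diff[OF int[OF q] int[OF p], symmetric])
  also have "\<dots> \<le> integral {0..hor} (\<lambda>t. (1 + \<nu> * slope s) * h * exp (- \<nu> * t))"
  proof (rule integral_le)
    show "(\<lambda>t. integrand w q t - integrand w p t) integrable_on {0..hor}"
      by (intro integrable_diff int p q)
    show "(\<lambda>t. (1 + \<nu> * slope s) * h * exp (- \<nu> * t)) integrable_on {0..hor}"
      by (intro integrable_continuous_real continuous_intros)
    fix t assume "t \<in> {0..hor}"
    then have "G w (F t q) - G w (F t p) \<le> (1 + \<nu> * slope s) * (exp (a * t) * h)"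
      using G_coord(2)[OF w F_in_Q[OF p] c nn, of t t] by (simp add: Fq \<nu>_def)
    moreover have "0 \<le> (1 + \<nu> * slope s) * (exp (a * t) * h)"
      using nn[of t] \<nu> slope_pos[OF c] by simp
    ultimately have "min 0 (G w (F t q)) - min 0 (G w (F t p)) \<le> (1 + \<nu> * slope s) * (exp (a * t) * h)"
      by (auto simp: min_def)
    then have "integrand w q t - integrand w p t \<le> exp (- kap * t) * ((1 + \<nu> * slope s) * (exp (a * t) * h))"
      unfolding right_diff_distrib[symmetric] by (intro mult_left_mono) auto
    also have "\<dots> = (1 + \<nu> * slope s) * h * (exp (- kap * t) * exp (a * t))"
      by simp
    also have "exp (- kap * t) * exp (a * t) = exp (- \<nu> * t)"
      using \<nu>(2) by (simp flip: exp_add add: algebra_simps)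
    finally show "integrand w q t - integrand w p t \<le> (1 + \<nu> * slope s) * h * exp (- \<nu> * t)" .
  qed
  also have "\<dots> = (1 + \<nu> * slope s) * h * ((1 - exp (- \<nu> * hor)) / \<nu>)"
    using integral_exp_decay[OF \<nu>(1), of hor] const_pos
    by (simp add: integral_unique)
  \<comment> \<open>This step dictates the form of \<open>slope\<close>: with
    \<open>\<nu> * slope s = exp (\<nu> * hor)\<close> the product collapses to
    \<open>exp (\<nu> * hor) - exp (- \<nu> * hor)\<close>, which stays below
    \<open>\<nu> * slope s\<close>.\<close>
  also have "\<dots> = ((1 + exp (\<nu> * hor)) * (1 - exp (- \<nu> * hor)) / \<nu>) * h"
    using \<nu> by (simp add: slope_def \<nu>_def)
  also have "\<dots> \<le> slope s * h"
  proof (intro mult_right_mono h)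
    have "(1 + exp (\<nu> * hor)) * (1 - exp (- \<nu> * hor)) = exp (\<nu> * hor) - exp (- \<nu> * hor)"
      by (simp add: algebra_simps flip: exp_add)
    also have "\<dots> \<le> exp (\<nu> * hor)" by simp
    finally show "(1 + exp (\<nu> * hor)) * (1 - exp (- \<nu> * hor)) / \<nu> \<le> slope s"
      unfolding slope_def \<nu>_def[symmetric] using \<nu> by (intro divide_right_mono) auto
  qed
  finally show "H w (p + h *\<^sub>R e) - H w p \<le> slope s * h" by (simp add: q_def)
  assume u: "0 \<le> u" "u \<le> 1"
  define r where "r = p + (u * h) *\<^sub>R e"
  have r: "r \<in> Q" using coord_in_Q[OF c p, of "u * h"] u h by (simp add: r_def)
  have "(1 - u) * H w p + u * H w q = integral {0..hor} (\<lambda>t. (1 - u) * integrand w p t + u * integrand w q t)"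
    unfolding H_def
    using int[OF p] int[OF q] by (subst integral_add) (auto intro!: integrable_on_mult_right)
  also have "\<dots> \<le> integral {0..hor} (integrand w r)"
  proof (rule integral_le)
    show "(\<lambda>t. (1 - u) * integrand w p t + u * integrand w q t) integrable_on {0..hor}"
      by (intro integrable_add integrable_on_mult_right int p q)
    show "integrand w r integrable_on {0..hor}" by (rule int[OF r])
    fix t assume "t \<in> {0..hor}"
    then have "(1 - u) * G w (F t p) + u * G w (F t q) \<le> G w (F t r)"
      using G_coord(3)[OF w F_in_Q[OF p] c nn u, of t t] by (simp add: Fq r_def cD mult_ac)
    moreover have "(1 - u) * min 0 (G w (F t p)) \<le> (1 - u) * G w (F t p)"
        "u * min 0 (G w (F t q)) \<le> u * G w (F t q)"
        "(1 - u) * min 0 (G w (F t p)) \<le> 0" "u * min 0 (G w (F t q)) \<le> 0"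
      using u by (auto intro!: mult_left_mono simp: mult_le_0_iff)
    ultimately have "(1 - u) * min 0 (G w (F t p)) + u * min 0 (G w (F t q)) \<le> min 0 (G w (F t r))"
      by linarith
    then have "exp (- kap * t) * ((1 - u) * min 0 (G w (F t p)) + u * min 0 (G w (F t q)))
        \<le> integrand w r t"
      by (intro mult_left_mono) auto
    then show "(1 - u) * integrand w p t + u * integrand w q t \<le> integrand w r t"
      by (simp add: algebra_simps)
  qed
  finally show "(1 - u) * H w p + u * H w (p + h *\<^sub>R e) \<le> H w (p + (u * h) *\<^sub>R e)"
    by (simp add: H_def q_def r_def)
qed

lemma integral_integrand_0:
  assumes "good w" "p \<in> Q" "0 \<le> x" "\<And>t. x \<le> t \<Longrightarrow> t \<le> y \<Longrightarrow> 0 \<le> G w (F t p)"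
  shows "integral {x..y} (integrand w p) = 0"
  using assms by (intro integral_unique has_integral_is_0) auto

lemma H_eq_0:
  assumes "good w" "p \<in> Q" "0 \<le> G w p"
  shows "H w p = 0"
  unfolding H_def
proof (rule integral_integrand_0[OF assms(1,2)])
  fix t :: real assume "0 \<le> t"
  have "0 \<le> b0 * t" using \<open>0 \<le> t\<close> const_pos by simp
  then show "0 \<le> G w (F t p)"
    using G_flow_ge[OF assms(1,2) \<open>0 \<le> t\<close>] assms(3) by simp
qed simp

lemma H_bounds:
  assumes "good w" "p \<in> Q"
  shows "- bnd \<le> H w p" "H w p \<le> 0"
proof -
  note int = integrable_integrand[OF assms order_refl, of hor]
  have "- bnd \<le> - cap * ((1 - exp (- kap * hor)) / kap)"
    using const_pos by (simp add: cap_eq)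
  also have "\<dots> = integral {0..hor} (\<lambda>t. - cap * exp (- kap * t))"
    using integral_exp_decay[of kap hor] const_pos by (simp add: integral_unique)
  also have "\<dots> \<le> H w p"
    unfolding H_def
  proof (rule integral_le[OF _ int])
    show "(\<lambda>t. - cap * exp (- kap * t)) integrable_on {0..hor}"
      by (intro integrable_continuous_real continuous_intros)
    fix t assume "t \<in> {0..hor}"
    then have "exp (- kap * t) * - cap \<le> integrand w p t"
      using min_G_bounds[OF assms(1) F_in_Q[OF assms(2)], of t] by (intro mult_left_mono) auto
    then show "- cap * exp (- kap * t) \<le> integrand w p t" by (simp add: mult.commute)
  qed
  finally show "- bnd \<le> H w p" .
  have "H w p \<le> integral {0..hor} (\<lambda>t. 0)"
    unfolding H_def by (rule integral_le[OF int]) (simp_all add: mult_le_0_iff integrable_0)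
  then show "H w p \<le> 0" by simp
qed

lemma good_H:
  assumes w: "good w"
  shows "good (H w)"
proof -
  have "H w p = 0" if p: "p \<in> Q" and pos: "\<And>j. 0 \<le> g ((S ^^ j) p)" for p
  proof (rule H_eq_0[OF w p])
    have "w (S p) = 0"
    proof (rule goodD(6)[OF w S_in_Q[OF p]])
      show "0 \<le> g ((S ^^ j) (S p))" for j
        using pos[of "Suc j"] by (simp add: funpow_Suc_right del: funpow.simps)
    qed
    then show "0 \<le> G w p"
      using pos[of 0] by (simp add: G_def)
  qed
  then show ?thesis
    unfolding good_def using H_bounds[OF w] H_coord[OF w] by (auto simp del: split_paired_All)
qed

lemma good_0: "good (\<lambda>_. 0)"
  using const_pos slope_pos unfolding good_def by (auto simp: less_imp_le simp del: split_paired_All)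

lemma H_mono:
  assumes "good w" "good w'" "\<And>p. p \<in> Q \<Longrightarrow> w p \<le> w' p" "p \<in> Q"
  shows "H w p \<le> H w' p"
  unfolding H_def
proof (intro integral_le integrable_integrand assms order_refl)
  fix t assume "t \<in> {0..hor}"
  then have "w (S (F t p)) \<le> w' (S (F t p))"
    by (intro assms(3) S_in_Q F_in_Q[OF assms(4)]) auto
  then have "\<mu> * w (S (F t p)) \<le> \<mu> * w' (S (F t p))"
    using mu_gt_1 by (intro mult_left_mono) auto
  then show "integrand w p t \<le> integrand w' p t"
    by (intro mult_left_mono) (auto simp: G_def)
qed

text \<open>Value iteration from 0, the largest function in the class, so that the iterates decrease
  and converge pointwise.\<close>

definition v_iter :: "nat \<Rightarrow> real \<times> real \<Rightarrow> real" where
  "v_iter n = (H ^^ n) (\<lambda>_. 0)"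

lemma v_iter_Suc: "v_iter (Suc n) = H (v_iter n)"
  by (simp add: v_iter_def)

lemma good_v_iter: "good (v_iter n)"
  by (induction n) (simp_all add: v_iter_def good_0 good_H)

lemma v_iter_decr: "p \<in> Q \<Longrightarrow> v_iter (Suc n) p \<le> v_iter n p"
proof (induction n arbitrary: p)
  case 0
  then show ?case
    using goodD(2)[OF good_v_iter[of 1]] by (simp add: v_iter_def)
next
  case (Suc n)
  then show ?case
    unfolding v_iter_Suc[of "Suc n"] v_iter_Suc[of n]
    by (intro H_mono good_v_iter) (simp_all flip: v_iter_Suc add: good_v_iter)
qed

definition v_lim :: "real \<times> real \<Rightarrow> real" where
  "v_lim p = lim (\<lambda>n. v_iter n p)"

lemma v_iter_tendsto:
  assumes "p \<in> Q"
  shows "(\<lambda>n. v_iter n p) \<longlonglongrightarrow> v_lim p"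
proof -
  have "decseq (\<lambda>n. v_iter n p)"
    using v_iter_decr[OF assms] by (simp add: decseq_Suc_iff)
  then obtain l where "(\<lambda>n. v_iter n p) \<longlonglongrightarrow> l"
    using decseq_convergent[of "\<lambda>n. v_iter n p" "-bnd"] goodD(1)[OF good_v_iter assms] by blast
  then show ?thesis by (simp add: v_lim_def limI)
qed

lemma good_v_lim: "good v_lim"
  unfolding good_def
proof (intro conjI ballI allI impI)
  fix p assume p: "p \<in> Q"
  note lim = v_iter_tendsto[OF p]
  show "- bnd \<le> v_lim p"
    by (rule LIMSEQ_le_const[OF lim]) (use goodD(1)[OF good_v_iter p] in auto)
  show "v_lim p \<le> 0"
    by (rule LIMSEQ_le_const2[OF lim]) (use goodD(2)[OF good_v_iter p] in auto)
  show "v_lim p = 0" if "\<forall>j. 0 \<le> g ((S ^^ j) p)"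
    by (rule LIMSEQ_unique[OF lim]) (use goodD(6)[OF good_v_iter p] that in simp)
  fix e a s h assume c: "coord e a s" and h: "0 \<le> (h::real)"
  note lim_h = v_iter_tendsto[OF coord_in_Q[OF c p h]]
  show "0 \<le> v_lim (p + h *\<^sub>R e) - v_lim p"
    by (rule LIMSEQ_le_const[OF tendsto_diff[OF lim_h lim]])
      (use goodD(3)[OF good_v_iter p c h] in auto)
  show "v_lim (p + h *\<^sub>R e) - v_lim p \<le> slope s * h"
    by (rule LIMSEQ_le_const2[OF tendsto_diff[OF lim_h lim]])
      (use goodD(4)[OF good_v_iter p c h] in auto)
  fix u :: real assume u: "u \<in> {0..1}"
  then have uh: "0 \<le> u * h" using h by simp
  show "(1 - u) * v_lim p + u * v_lim (p + h *\<^sub>R e) \<le> v_lim (p + (u * h) *\<^sub>R e)"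
    by (rule LIMSEQ_le[OF tendsto_add[OF tendsto_mult_left[OF lim] tendsto_mult_left[OF lim_h]]
          v_iter_tendsto[OF coord_in_Q[OF c p uh]]])
      (use goodD(5)[OF good_v_iter p c h] u in auto)
qed

lemma H_v_lim:
  assumes p: "p \<in> Q"
  shows "H v_lim p = v_lim p"
proof -
  have "(\<lambda>n. H (v_iter n) p) \<longlonglongrightarrow> H v_lim p"
    unfolding H_def
  proof (rule dominated_convergence(2))
    show "integrand (v_iter n) p integrable_on {0..hor}" for n
      by (rule integrable_integrand[OF good_v_iter p order_refl])
    show "(\<lambda>_. cap) integrable_on {0..hor}" by (rule integrable_const_ivl)
    fix t assume t: "t \<in> {0..hor}"
    then have Ft: "F t p \<in> Q" using p F_in_Q by simp
    have "exp (- kap * t) \<le> 1" using t const_pos by simp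
    moreover have "\<bar>min 0 (G (v_iter n) (F t p))\<bar> \<le> cap" for n
      using min_G_bounds[OF good_v_iter Ft, of n] by linarith
    ultimately show "norm (integrand (v_iter n) p t) \<le> cap" for n
      using mult_mono[of "exp (- kap * t)" 1 "\<bar>min 0 (G (v_iter n) (F t p))\<bar>" cap] 
      by (simp add: abs_mult)
    show "(\<lambda>n. integrand (v_iter n) p t) \<longlonglongrightarrow> integrand v_lim p t"
      unfolding G_def by (intro tendsto_intros v_iter_tendsto S_in_Q Ft)
  qed
  then have "(\<lambda>n. v_iter (Suc n) p) \<longlonglongrightarrow> H v_lim p"
    by (simp add: v_iter_Suc)
  then show ?thesis
    using LIMSEQ_Suc[OF v_iter_tendsto[OF p]] LIMSEQ_unique by blast
qed

text \<open>The value function and \<open>v_lim\<close> are compared on the quadrant only, although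
  both are functions on the whole plane. This lemma and \<open>H_cong\<close> transfer the fixed
  point property to the value function itself.\<close>

lemma good_cong:
  assumes w: "good w" and eq: "\<And>p. p \<in> Q \<Longrightarrow> w' p = w p"
  shows "good w'"
  unfolding good_def
proof (intro conjI ballI allI impI)
  fix p assume p: "p \<in> Q"
  note D = goodD[OF w p]
  show "- bnd \<le> w' p" "w' p \<le> 0" using D(1,2) eq[OF p] by auto
  show "w' p = 0" if "\<forall>j. 0 \<le> g ((S ^^ j) p)" using D(6) that eq[OF p] by simp
  fix e a s h assume c: "coord e a s" and h: "0 \<le> (h::real)"
  have eq_h: "w' (p + h *\<^sub>R e) = w (p + h *\<^sub>R e)" by (rule eq[OF coord_in_Q[OF c p h]])
  show "0 \<le> w' (p + h *\<^sub>R e) - w' p" "w' (p + h *\<^sub>R e) - w' p \<le> slope s * h"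
    using D(3,4)[OF c h] eq[OF p] eq_h by auto
  fix u :: real assume u: "u \<in> {0..1}"
  then have uh: "0 \<le> u * h" using h by simp
  show "(1 - u) * w' p + u * w' (p + h *\<^sub>R e) \<le> w' (p + (u * h) *\<^sub>R e)"
    using D(5)[OF c h, of u] u unfolding eq[OF p] eq_h eq[OF coord_in_Q[OF c p uh]] by simp
qed

lemma H_cong:
  assumes eq: "\<And>p. p \<in> Q \<Longrightarrow> w' p = w p" and p: "p \<in> Q"
  shows "H w' p = H w p"
  unfolding H_def G_def
proof (rule integral_cong)
  fix t assume "t \<in> {0..hor}"
  then have "w' (S (F t p)) = w (S (F t p))" by (intro eq S_in_Q F_in_Q p) simp
  then show "exp (- kap * t) * min 0 (g (F t p) + \<mu> * w' (S (F t p))) =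
      exp (- kap * t) * min 0 (g (F t p) + \<mu> * w (S (F t p)))" by simp
qed

end

text \<open>Instantiated twice: with \<open>v_lim\<close>, to identify it with the value function,
  and then with the value function, to read off the results for its own stopping region and
  boundary.\<close>

locale disorder_value = disorder +
  fixes v :: "real \<times> real \<Rightarrow> real"
  assumes good_v: "good v" and fixed: "p \<in> Q \<Longrightarrow> H v p = v p"
begin

abbreviation Gv :: "real \<times> real \<Rightarrow> real" where "Gv \<equiv> G v"

lemmas v_ge = goodD(1)[OF good_v] and v_le = goodD(2)[OF good_v]

lemma G_flow_nonneg:
  assumes "p \<in> Q" "0 \<le> Gv p" "0 \<le> t"
  shows "0 \<le> Gv (F t p)"
proof -
  have "0 \<le> b0 * t" using assms const_pos by simp
  then show ?thesis using G_flow_ge[OF good_v assms(1,3)] assms(2) by simp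
qed

text \<open>A continuous integrand of constant sign with integral zero vanishes everywhere, in
  particular at time 0, where it is the negative part of \<open>Gv p\<close>.\<close>

lemma v_eq_0_iff:
  assumes p: "p \<in> Q"
  shows "v p = 0 \<longleftrightarrow> 0 \<le> Gv p"
proof
  show "v p = 0" if "0 \<le> Gv p"
    using H_eq_0[OF good_v p that] fixed[OF p] by simp
  assume "v p = 0"
  then have "integral {0..hor} (\<lambda>t. - integrand v p t) = 0"
    using fixed[OF p] by (simp add: H_def)
  moreover have "continuous_on {0..hor} (\<lambda>t. - integrand v p t)"
    by (intro continuous_on_minus continuous_on_integrand[OF good_v p]) auto
  ultimately have "\<forall>t\<in>{0..hor}. - integrand v p t = 0"
    using integral_eq_0_iff[of 0 hor "\<lambda>t. - integrand v p t"] const_pos integrand_nonpos by simp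
  from bspec[OF this, of 0] show "0 \<le> Gv p"
    using const_pos by (simp add: min_def split: if_splits)
qed

lemma v_neg_iff: "p \<in> Q \<Longrightarrow> v p < 0 \<longleftrightarrow> Gv p < 0"
  using v_eq_0_iff[of p] v_le[of p] by linarith

lemma dynamic_programming:
  assumes p: "p \<in> Q" and h: "0 \<le> h"
  shows "v p = integral {0..h} (integrand v p) + exp (- kap * h) * v (F h p)"
proof -
  note int = integrable_integrand[OF good_v p]
  \<comment> \<open>Past \<open>hor\<close> the integrand vanishes, so the fixed horizon can be
    lengthened by h before the first stretch of length h is split off.\<close>
  have z: "integral {hor..hor + h} (integrand v p) = 0"
    using const_pos h by (intro integral_integrand_0[OF good_v p]) (auto intro: G_flow_hor[OF good_v p])
  have "v p = integral {0..hor} (integrand v p) + integral {hor..hor + h} (integrand v p)"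
    using fixed[OF p] z by (simp add: H_def)
  also have "\<dots> = integral {0..hor + h} (integrand v p)"
    using const_pos h by (intro Henstock_Kurzweil_Integration.integral_combine int) auto
  also have "\<dots> = integral {0..h} (integrand v p) + integral {h..hor + h} (integrand v p)"
    using const_pos h by (intro Henstock_Kurzweil_Integration.integral_combine[symmetric] int) auto
  also have "integral {h..hor + h} (integrand v p) = integral {0..hor} (\<lambda>t. integrand v p (t + h))"
    using integral_shift[of 0 h hor "integrand v p"] continuous_on_integrand[OF good_v p, of "{0 + h..hor + h}"] h
    by (auto simp: o_def add.commute)
  also have "\<dots> = integral {0..hor} (\<lambda>t. exp (- kap * h) * integrand v (F h p) t)"
  proof -
    have "exp (- kap * (t + h)) = exp (- kap * h) * exp (- kap * t)" for t
      by (simp add: algebra_simps flip: exp_add)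
    then show ?thesis
      by (simp only: F_add[symmetric] add.commute[of h] mult.assoc)
  qed
  also have "\<dots> = exp (- kap * h) * v (F h p)"
    using fixed[OF F_in_Q[OF p h]] by (simp add: H_def)
  finally show ?thesis .
qed

end

section \<open>Differentiability of the fixed point\<close>

context disorder_value
begin

text \<open>By concavity the supremum of the difference quotients is the right-hand partial derivative.\<close>

definition dv :: "real \<times> real \<Rightarrow> real \<times> real \<Rightarrow> real" where
  "dv e p = (SUP h\<in>{0<..}. (v (p + h *\<^sub>R e) - v p) / h)"

definition dv_op :: "real \<Rightarrow> (real \<times> real \<Rightarrow> real) \<Rightarrow> real \<times> real \<Rightarrow> real" where
  "dv_op \<nu> u p =
     integral {0..hor} (\<lambda>t. exp (- \<nu> * t) * (if Gv (F t p) < 0 then 1 + \<nu> * u (S (F t p)) else 0))"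

lemma quotient_antimono:
  assumes p: "p \<in> Q" and c: "coord e a s" and h: "0 < h" "h \<le> k"
  shows "(v (p + k *\<^sub>R e) - v p) / k \<le> (v (p + h *\<^sub>R e) - v p) / h"
proof -
  have k: "0 < k" using h by simp
  have "(1 - h / k) * v p + (h / k) * v (p + k *\<^sub>R e) \<le> v (p + (h / k * k) *\<^sub>R e)"
    using goodD(5)[OF good_v p c, of k "h / k"] h k by simp
  then have "(h / k) * (v (p + k *\<^sub>R e) - v p) \<le> v (p + h *\<^sub>R e) - v p"
    using k by (simp add: algebra_simps)
  then show ?thesis
    using h k by (simp add: field_simps)
qed

lemma bdd_above_quotient:
  assumes p: "p \<in> Q" and c: "coord e a s"
  shows "bdd_above ((\<lambda>h. (v (p + h *\<^sub>R e) - v p) / h) ` {0<..})"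
proof (rule bdd_aboveI)
  fix y assume "y \<in> (\<lambda>h. (v (p + h *\<^sub>R e) - v p) / h) ` {0<..}"
  then show "y \<le> slope s"
    using goodD(4)[OF good_v p c] by (auto simp: field_simps)
qed

lemma quotient_le_dv:
  assumes "p \<in> Q" "coord e a s" "0 < h"
  shows "(v (p + h *\<^sub>R e) - v p) / h \<le> dv e p"
  unfolding dv_def using assms by (intro cSUP_upper bdd_above_quotient) auto

lemma dv_bounds:
  assumes p: "p \<in> Q" and c: "coord e a s"
  shows "0 \<le> dv e p" "dv e p \<le> slope s"
proof -
  have "0 \<le> (v (p + 1 *\<^sub>R e) - v p) / 1"
    using goodD(3)[OF good_v p c, of 1] by simp
  also have "\<dots> \<le> dv e p"
    by (rule quotient_le_dv[OF p c]) simp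
  finally show "0 \<le> dv e p" .
  show "dv e p \<le> slope s"
    unfolding dv_def using goodD(4)[OF good_v p c]
    by (intro cSUP_least) (auto simp: field_simps)
qed

lemma quotient_tendsto_dv:
  assumes p: "p \<in> Q" and c: "coord e a s"
  shows "((\<lambda>h. (v (p + h *\<^sub>R e) - v p) / h) \<longlongrightarrow> dv e p) (at_right 0)"
proof (rule order_tendstoI)
  fix y assume "y < dv e p"
  then obtain k where k: "0 < k" "y < (v (p + k *\<^sub>R e) - v p) / k"
    unfolding dv_def using less_cSUP_iff[OF _ bdd_above_quotient[OF p c]] by auto
  have "\<forall>\<^sub>F h in at_right 0. h \<in> {0<..<k}"
    using k by (intro eventually_at_right_real)
  then show "\<forall>\<^sub>F h in at_right 0. y < (v (p + h *\<^sub>R e) - v p) / h"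
  proof eventually_elim
    case (elim h)
    then show ?case
      using k(2) quotient_antimono[OF p c, of h k] by simp
  qed
next
  fix y assume y: "dv e p < y"
  have "\<forall>\<^sub>F h in at_right (0::real). 0 < h"
    by (simp add: eventually_at_right_less)
  then show "\<forall>\<^sub>F h in at_right 0. (v (p + h *\<^sub>R e) - v p) / h < y"
  proof eventually_elim
    case (elim h)
    then show ?case
      using y quotient_le_dv[OF p c, of h] by simp
  qed
qed

lemma increment_le_dv:
  assumes "p \<in> Q" "coord e a s" "0 \<le> h"
  shows "v (p + h *\<^sub>R e) - v p \<le> dv e p * h"
  using quotient_le_dv[OF assms(1,2), of h] assms(3) by (cases "h = 0") (auto simp: field_simps)

text \<open>Concavity: the right derivative at the far end is at most the slope of the chord. With
  \<open>increment_le_dv\<close> every increment lies between the right derivatives at its two ends,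
  so continuity of \<open>dv\<close> will give a two-sided derivative.\<close>

lemma dv_le_increment:
  assumes p: "p \<in> Q" and c: "coord e a s" and h: "0 \<le> h"
  shows "dv e (p + h *\<^sub>R e) * h \<le> v (p + h *\<^sub>R e) - v p"
proof (cases "h = 0")
  case False
  then have h: "0 < h" using h by simp
  have "dv e (p + h *\<^sub>R e) \<le> (v (p + h *\<^sub>R e) - v p) / h"
    unfolding dv_def
  proof (rule cSUP_least)
    fix k :: real assume "k \<in> {0<..}"
    then have k: "0 < k" by simp
    \<comment> \<open>The weight that makes \<open>p + h *\<^sub>R e\<close> the convex combination
      of \<open>p\<close> and \<open>p + (h + k) *\<^sub>R e\<close>.\<close>
    define u where "u = h / (h + k)"
    have u: "0 \<le> u" "u \<le> 1" "u * (h + k) = h"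
      using h k by (auto simp: u_def field_simps)
    have "(1 - u) * v p + u * v (p + (h + k) *\<^sub>R e) \<le> v (p + h *\<^sub>R e)"
      using goodD(5)[OF good_v p c _ u(1,2), of "h + k"] h k u(3) by simp
    then have "(h + k) * ((1 - u) * v p + u * v (p + (h + k) *\<^sub>R e)) \<le> (h + k) * v (p + h *\<^sub>R e)"
      using h k by (intro mult_left_mono) auto
    moreover have "(h + k) * (1 - u) = k" "(h + k) * u = h"
      using h k by (auto simp: u_def field_simps)
    ultimately have "k * v p + h * v (p + (h + k) *\<^sub>R e) \<le> (h + k) * v (p + h *\<^sub>R e)"
      by (simp add: distrib_left mult.assoc[symmetric])
    then have "h * (v (p + (h + k) *\<^sub>R e) - v (p + h *\<^sub>R e)) \<le> k * (v (p + h *\<^sub>R e) - v p)"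
      by (simp add: algebra_simps)
    then show "(v (p + h *\<^sub>R e + k *\<^sub>R e) - v (p + h *\<^sub>R e)) / k \<le> (v (p + h *\<^sub>R e) - v p) / h"
      using h k by (simp add: field_simps scaleR_add_left)
  qed simp
  then show ?thesis using h by (simp add: field_simps)
qed simp

text \<open>At a zero of \<open>Gv\<close> the right derivative of the truncation is 0, because
  \<open>Gv\<close> increases in direction e. So the strict inequality in the limit is correct at
  every point.\<close>

lemma min_G_quotient_tendsto:
  assumes q: "q \<in> Q" and c: "coord e a s" and \<theta>: "0 < \<theta>"
  shows "((\<lambda>h. (min 0 (Gv (q + (\<theta> * h) *\<^sub>R e)) - min 0 (Gv q)) / h) \<longlongrightarrow>
      (if Gv q < 0 then \<theta> * (1 + \<mu> * s * dv e (S q)) else 0)) (at_right 0)"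
proof (cases "Gv q < 0")
  case False
  have "\<forall>\<^sub>F h in at_right (0::real). 0 < h"
    by (simp add: eventually_at_right_less)
  then have "\<forall>\<^sub>F h in at_right 0. (min 0 (Gv (q + (\<theta> * h) *\<^sub>R e)) - min 0 (Gv q)) / h = 0"
  proof eventually_elim
    case (elim h)
    then have "0 \<le> \<theta> * h" using \<theta> by simp
    then show ?case
      using False G_coord(1)[OF good_v q c, of "\<theta> * h"] by simp
  qed
  then show ?thesis using False by (simp add: tendsto_eventually)
next
  case True
  note cD = coordD[OF c]
  define B where "B = 1 + \<mu> * s * slope s"
  have B: "0 < B"
    using mu_gt_1 cD slope_pos[OF c] by (simp add: B_def add_pos_pos)
  \<comment> \<open>B is a Lipschitz constant of \<open>Gv\<close> in direction e; for these h the
    shifted point still has \<open>Gv < 0\<close> and the truncation is inactive.\<close>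
  have ev: "\<forall>\<^sub>F h in at_right 0. h \<in> {0<..< - Gv q / (B * \<theta>)}"
    using True B \<theta> by (intro eventually_at_right_real) (simp add: divide_neg_pos)
  have "\<forall>\<^sub>F h in at_right 0. \<theta> + \<mu> * ((s * \<theta>) * ((v (S q + ((s * \<theta>) * h) *\<^sub>R e) - v (S q)) / ((s * \<theta>) * h)))
      = (min 0 (Gv (q + (\<theta> * h) *\<^sub>R e)) - min 0 (Gv q)) / h"
    using ev
  proof eventually_elim
    case (elim h)
    then have h: "0 < h" "h * (B * \<theta>) < - Gv q" using B \<theta> by (auto simp: field_simps)
    have "0 \<le> \<theta> * h" using h \<theta> by simp
    then have "Gv (q + (\<theta> * h) *\<^sub>R e) \<le> Gv q + B * (\<theta> * h)"
      using G_coord(2)[OF good_v q c, of "\<theta> * h"] by (simp add: B_def)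
    also have "\<dots> < 0" using h(2) by (simp add: mult_ac)
    finally have "(min 0 (Gv (q + (\<theta> * h) *\<^sub>R e)) - min 0 (Gv q)) / h =
        (Gv (q + (\<theta> * h) *\<^sub>R e) - Gv q) / h"
      using True by simp
    also have "Gv (q + (\<theta> * h) *\<^sub>R e) - Gv q =
        \<theta> * h + \<mu> * (v (S q + ((s * \<theta>) * h) *\<^sub>R e) - v (S q))"
      by (simp add: G_def cD algebra_simps)
    finally have eq: "(min 0 (Gv (q + (\<theta> * h) *\<^sub>R e)) - min 0 (Gv q)) / h =
        (\<theta> * h + \<mu> * (v (S q + ((s * \<theta>) * h) *\<^sub>R e) - v (S q))) / h" .
    show ?case
      unfolding eq using h \<theta> cD(2) by (simp add: add_divide_distrib)
  qed
  moreover have "((\<lambda>h. \<theta> + \<mu> * ((s * \<theta>) * ((v (S q + ((s * \<theta>) * h) *\<^sub>R e) - v (S q)) / ((s * \<theta>) * h))))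
      \<longlongrightarrow> \<theta> + \<mu> * ((s * \<theta>) * dv e (S q))) (at_right 0)"
  proof -
    have "filterlim (\<lambda>h. (s * \<theta>) * h) (at_right 0) (at_right 0)"
      using filterlim_times_pos[of "\<lambda>h. h" 0 "at_right 0" "s * \<theta>" 0] cD(2) \<theta>
      by (simp add: filterlim_ident)
    then have "((\<lambda>h. (v (S q + ((s * \<theta>) * h) *\<^sub>R e) - v (S q)) / ((s * \<theta>) * h))
        \<longlongrightarrow> dv e (S q)) (at_right 0)"
      by (rule filterlim_compose[OF quotient_tendsto_dv[OF S_in_Q[OF q] c]])
    then show ?thesis by (intro tendsto_intros)
  qed
  ultimately have "((\<lambda>h. (min 0 (Gv (q + (\<theta> * h) *\<^sub>R e)) - min 0 (Gv q)) / h) \<longlongrightarrow>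
      \<theta> + \<mu> * ((s * \<theta>) * dv e (S q))) (at_right 0)"
    by (rule Lim_transform_eventually[rotated])
  then show ?thesis
    using True by (simp add: algebra_simps)
qed

text \<open>Dominated convergence along h = 1 / (n + 1), with the Lipschitz bound as majorant.
  Integrability is part of the conclusion because the regularity of \<open>dv\<close> is not yet
  known; it comes from being a limit of integrable quotients.\<close>

lemma dv_fixed:
  assumes p: "p \<in> Q" and c: "coord e a s"
  defines "\<nu> \<equiv> \<mu> * s"
  shows "(\<lambda>t. exp (- \<nu> * t) * (if Gv (F t p) < 0 then 1 + \<nu> * dv e (S (F t p)) else 0)) integrable_on {0..hor}"
    and "dv e p = dv_op \<nu> (dv e) p"
proof -
  note cD = coordD[OF c]
  define k where "k n = 1 / real (Suc n)" for n
  have k: "0 < k n" for n by (simp add: k_def)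
  have lim_k: "filterlim k (at_right 0) sequentially"
    unfolding filterlim_at k_def using LIMSEQ_inverse_real_of_nat
    by (auto simp: inverse_eq_divide)
  define f where "f n t = (integrand v (p + k n *\<^sub>R e) t - integrand v p t) / k n" for n t
  define f' where "f' t = exp (- \<nu> * t) * (if Gv (F t p) < 0 then 1 + \<nu> * dv e (S (F t p)) else 0)" for t
  have pk: "p + k n *\<^sub>R e \<in> Q" for n
    using coord_in_Q[OF c p] k[of n] by simp
  have nu: "0 < \<nu>" "kap - a = \<nu>" using cD mu_gt_1 by (auto simp: \<nu>_def)
  have int: "f n integrable_on {0..hor}" for n
    unfolding f_def by (intro integrable_on_divide integrable_diff integrable_integrand[OF good_v] pk p order_refl)
  have *: "exp (- kap * t) * exp (a * t) = exp (- \<nu> * t)" for t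
    by (simp flip: exp_add nu(2) add: algebra_simps)
  have bound: "norm (f n t) \<le> 1 + \<nu> * slope s" if t: "t \<in> {0..hor}" for n t
  proof -
    have Ft: "F t p \<in> Q" using F_in_Q[OF p] t by simp
    define d where "d = exp (a * t) * k n"
    have d: "0 \<le> d" using k[of n] by (simp add: d_def)
    have Fk: "F t (p + k n *\<^sub>R e) = F t p + d *\<^sub>R e" by (simp add: cD d_def)
    have "0 \<le> Gv (F t p + d *\<^sub>R e) - Gv (F t p)" "Gv (F t p + d *\<^sub>R e) - Gv (F t p) \<le> (1 + \<nu> * slope s) * d"
      using G_coord(1,2)[OF good_v Ft c d] d by (auto simp: \<nu>_def)
    then have "\<bar>min 0 (Gv (F t p + d *\<^sub>R e)) - min 0 (Gv (F t p))\<bar> \<le> (1 + \<nu> * slope s) * d"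
      by (auto simp: min_def)
    then have "exp (- kap * t) * \<bar>min 0 (Gv (F t p + d *\<^sub>R e)) - min 0 (Gv (F t p))\<bar> / k n
        \<le> exp (- kap * t) * ((1 + \<nu> * slope s) * d) / k n"
      using k[of n] by (intro divide_right_mono mult_left_mono) auto
    also have "\<dots> = (1 + \<nu> * slope s) * (exp (- kap * t) * exp (a * t))"
      using k[of n] by (simp add: d_def)
    also have "\<dots> \<le> (1 + \<nu> * slope s) * 1"
      unfolding * using t nu slope_pos[OF c] by (intro mult_left_mono) auto
    finally show ?thesis
      using k[of n] by (simp add: f_def Fk abs_mult flip: right_diff_distrib)
  qed
  have lim: "(\<lambda>n. f n t) \<longlonglongrightarrow> f' t" if t: "t \<in> {0..hor}" for t
  proof -
    have Ft: "F t p \<in> Q" using F_in_Q[OF p] t by simp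
    have "(\<lambda>n. exp (- kap * t) * ((min 0 (Gv (F t p + (exp (a * t) * k n) *\<^sub>R e)) - min 0 (Gv (F t p))) / k n))
        \<longlonglongrightarrow> exp (- kap * t) * (if Gv (F t p) < 0 then exp (a * t) * (1 + \<mu> * s * dv e (S (F t p))) else 0)"
      by (intro tendsto_mult tendsto_const filterlim_compose[OF min_G_quotient_tendsto[OF Ft c] lim_k]) simp
    moreover have "exp (- kap * t) * (if Gv (F t p) < 0 then exp (a * t) * (1 + \<mu> * s * dv e (S (F t p))) else 0) = f' t"
      unfolding f'_def *[symmetric] by (simp add: \<nu>_def)
    moreover have "exp (- kap * t) * ((min 0 (Gv (F t p + (exp (a * t) * k n) *\<^sub>R e)) - min 0 (Gv (F t p))) / k n) = f n t" for n
      by (simp add: f_def cD right_diff_distrib)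
    ultimately show ?thesis by simp
  qed
  have const: "(\<lambda>_. 1 + \<nu> * slope s) integrable_on {0..hor}"
    by (rule integrable_const_ivl)
  have f': "f' integrable_on {0..hor}" "(\<lambda>n. integral {0..hor} (f n)) \<longlonglongrightarrow> integral {0..hor} f'"
    by (rule dominated_convergence[of f "{0..hor}" "\<lambda>_. 1 + \<nu> * slope s"]; use int const bound lim in blast)+
  then show "(\<lambda>t. exp (- \<nu> * t) * (if Gv (F t p) < 0 then 1 + \<nu> * dv e (S (F t p)) else 0)) integrable_on {0..hor}"
    by (simp add: f'_def[abs_def])
  have "integral {0..hor} (f n) = (v (p + k n *\<^sub>R e) - v p) / k n" for n
  proof -
    have "integral {0..hor} (f n) = (H v (p + k n *\<^sub>R e) - H v p) / k n"
      using integral_diff[OF integrable_integrand[OF good_v pk order_refl] integrable_integrand[OF good_v p order_refl]]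
      unfolding f_def H_def integral_divide by metis
    then show ?thesis by (simp only: fixed p pk)
  qed
  then have "(\<lambda>n. integral {0..hor} (f n)) \<longlonglongrightarrow> dv e p"
    using filterlim_compose[OF quotient_tendsto_dv[OF p c] lim_k] by simp
  then show "dv e p = dv_op \<nu> (dv e) p"
    using LIMSEQ_unique[OF f'(2)] by (simp add: dv_op_def f'_def[abs_def])
qed

text \<open>After a zero, \<open>Gv\<close> has grown by at least \<open>b0\<close> times the
  elapsed time, so there is no second zero.\<close>

lemma finite_zeros_flow:
  assumes "p \<in> Q"
  shows "finite {t. 0 \<le> t \<and> Gv (F t p) = 0}"
proof -
  have "\<not> (0 \<le> t \<and> t < t' \<and> Gv (F t p) = 0 \<and> Gv (F t' p) = 0)" for t t'
  proof safe
    assume t: "0 \<le> t" "t < t'" "Gv (F t p) = 0" "Gv (F t' p) = 0"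
    have "b0 * (t' - t) + min 0 (Gv (F t p)) \<le> Gv (F (t' - t) (F t p))"
      using t assms by (intro G_flow_ge[OF good_v F_in_Q]) auto
    then have "b0 * (t' - t) \<le> 0"
      using t by (simp flip: F_add)
    then show False using const_pos t by (simp add: mult_le_0_iff)
  qed
  then have uniq: "t = t'" if "0 \<le> t" "0 \<le> t'" "Gv (F t p) = 0" "Gv (F t' p) = 0" for t t'
    using that by (metis linorder_neqE_linordered_idom)
  show ?thesis
  proof (cases "{t. 0 \<le> t \<and> Gv (F t p) = 0} = {}")
    case False
    then obtain t0 where "0 \<le> t0" "Gv (F t0 p) = 0" by auto
    then have "{t. 0 \<le> t \<and> Gv (F t p) = 0} \<subseteq> {t0}" using uniq by auto
    then show ?thesis using finite_subset by blast
  qed (simp only: finite.emptyI)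
qed

lemma continuous_on_G_flow:
  assumes "p \<in> Q"
  shows "continuous_on {0..hor} (\<lambda>t. Gv (F t p))"
  by (intro continuous_on_G good_continuous[OF good_v] continuous_on_F continuous_intros)
    (use assms F_in_Q[OF assms] in auto)

lemma dv_op_integrable:
  assumes u: "continuous_on Q u" and p: "p \<in> Q"
  shows "(\<lambda>t. exp (- \<nu> * t) * (if Gv (F t p) < 0 then 1 + \<nu> * u (S (F t p)) else 0)) integrable_on {0..hor}"
proof -
  define f where "f t = exp (- \<nu> * t) * (1 + \<nu> * u (S (F t p)))" for t
  \<comment> \<open>Continuous functions of t that increase to the indicator of the times with
    \<open>Gv < 0\<close>.\<close>
  define i where "i n t = min 1 (real n * max 0 (- Gv (F t p)))" for n t
  have f: "continuous_on {0..hor} f"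
    unfolding f_def
    by (intro continuous_intros continuous_on_compose2[OF u] continuous_on_S continuous_on_F)
      (use S_in_Q[OF F_in_Q[OF p]] in \<open>auto simp: image_subset_iff\<close>)
  have i: "continuous_on {0..hor} (i n)" for n
    unfolding i_def by (intro continuous_intros continuous_on_G_flow p)
  have "(\<lambda>t. if Gv (F t p) < 0 then f t else 0) integrable_on {0..hor}"
  proof (rule dominated_convergence(1))
    show "(\<lambda>t. i n t * f t) integrable_on {0..hor}" for n
      by (intro integrable_continuous_real continuous_intros i f)
    show "(\<lambda>t. \<bar>f t\<bar>) integrable_on {0..hor}"
      by (intro integrable_continuous_real continuous_intros f)
    show "norm (i n t * f t) \<le> \<bar>f t\<bar>" for n t
    proof -
      have "\<bar>i n t\<bar> \<le> 1" by (auto simp: i_def abs_le_iff min_def max_def intro: order_trans[of _ 0])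
      then show ?thesis
        by (simp add: abs_mult mult_left_le_one_le)
    qed
    show "(\<lambda>n. i n t * f t) \<longlonglongrightarrow> (if Gv (F t p) < 0 then f t else 0)" for t
    proof (cases "Gv (F t p) < 0")
      case True
      obtain N where N: "1 < real N * - Gv (F t p)"
        using True reals_Archimedean3[of "- Gv (F t p)"] by (metis neg_0_less_iff_less)
      have "i n t = 1" if "n \<ge> N" for n
      proof -
        have "real N * - Gv (F t p) \<le> real n * - Gv (F t p)"
          using that True by (intro mult_right_mono) auto
        then have "1 \<le> real n * - Gv (F t p)" using N by linarith
        then show ?thesis using True by (simp add: i_def min_absorb1)
      qed
      then have "\<forall>\<^sub>F n in sequentially. i n t * f t = f t"
        by (auto simp: eventually_sequentially intro!: exI[of _ N])
      then show ?thesis using True by (simp add: tendsto_eventually)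
    qed (simp add: i_def)
  qed
  moreover have "(\<lambda>t. if Gv (F t p) < 0 then f t else 0) =
      (\<lambda>t. exp (- \<nu> * t) * (if Gv (F t p) < 0 then 1 + \<nu> * u (S (F t p)) else 0))"
    by (auto simp: f_def)
  ultimately show ?thesis by simp
qed

lemma continuous_dv_op:
  assumes u: "continuous_on Q u" and bd: "\<And>p. p \<in> Q \<Longrightarrow> \<bar>u p\<bar> \<le> C" and \<nu>: "0 < \<nu>"
  shows "continuous_on Q (dv_op \<nu> u)"
  unfolding continuous_on_sequentially
proof (intro allI ballI impI, elim conjE)
  fix x :: "nat \<Rightarrow> real \<times> real" and p assume p: "p \<in> Q" and x: "\<forall>n. x n \<in> Q" and lim: "x \<longlonglongrightarrow> p"
  define f where "f q t = exp (- \<nu> * t) * (if Gv (F t q) < 0 then 1 + \<nu> * u (S (F t q)) else 0)" for q t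
  \<comment> \<open>Off this finite set of times the sign of \<open>Gv\<close> at the limit
    trajectory is strict, hence shared by nearby trajectories, and the integrand converges.\<close>
  define Z where "Z = {t. 0 \<le> t \<and> Gv (F t p) = 0}"
  have Z: "negligible Z" using finite_zeros_flow[OF p] by (simp add: Z_def negligible_finite)
  have int: "f q integrable_on {0..hor} - Z" if "q \<in> Q" for q
    using dv_op_integrable[OF u that, of \<nu>] unfolding f_def
    by (rule integrable_spike_set) (auto intro: negligible_subset[OF Z])
  have eq: "integral ({0..hor} - Z) (f q) = dv_op \<nu> u q" for q
    unfolding dv_op_def f_def
    by (rule integral_spike_set) (auto intro: negligible_subset[OF Z])
  have contF: "continuous_on Q (\<lambda>q. F t q)" for t
    by (intro continuous_on_F continuous_intros)
  have "(\<lambda>n. integral ({0..hor} - Z) (f (x n))) \<longlonglongrightarrow> integral ({0..hor} - Z) (f p)"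
  proof (rule dominated_convergence(2))
    show "f (x n) integrable_on {0..hor} - Z" for n using int x by simp
    show "(\<lambda>_. 1 + \<nu> * C) integrable_on {0..hor} - Z"
      using integrable_const_ivl[of "1 + \<nu> * C" 0 hor]
      by (rule integrable_spike_set) (auto intro: negligible_subset[OF Z])
    fix t assume t: "t \<in> {0..hor} - Z"
    have C: "0 \<le> C" using bd[OF p] by simp
    show "norm (f (x n) t) \<le> 1 + \<nu> * C" for n
    proof -
      have "\<bar>u (S (F t (x n)))\<bar> \<le> C"
        using t x by (intro bd S_in_Q F_in_Q) auto
      then have "\<bar>\<nu> * u (S (F t (x n)))\<bar> \<le> \<nu> * C"
        using \<nu> by (simp add: abs_mult)
      moreover have "0 \<le> \<nu> * C" using \<nu> C by simp
      ultimately have "\<bar>if Gv (F t (x n)) < 0 then 1 + \<nu> * u (S (F t (x n))) else 0\<bar> \<le> 1 + \<nu> * C"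
        by auto
      moreover have "exp (- \<nu> * t) \<le> 1" using t \<nu> by simp
      ultimately show ?thesis
        unfolding f_def real_norm_def abs_mult
        using mult_mono[of "exp (- \<nu> * t)" 1] by fastforce
    qed
    have G: "(\<lambda>n. Gv (F t (x n))) \<longlonglongrightarrow> Gv (F t p)"
    proof (rule continuous_on_tendsto_compose[OF _ lim p])
      show "continuous_on Q (\<lambda>q. Gv (F t q))"
        by (intro continuous_on_G good_continuous[OF good_v] contF F_in_Q) (use t in auto)
    qed (use x in simp)
    have u': "(\<lambda>n. u (S (F t (x n)))) \<longlonglongrightarrow> u (S (F t p))"
    proof (rule continuous_on_tendsto_compose[OF _ lim p])
      show "continuous_on Q (\<lambda>q. u (S (F t q)))"
        by (intro continuous_on_compose2[OF u] continuous_on_S contF) (use t in \<open>simp add: image_subset_iff S_in_Q F_in_Q\<close>)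
    qed (use x in simp)
    show "(\<lambda>n. f (x n) t) \<longlonglongrightarrow> f p t"
    proof (cases "Gv (F t p) < 0")
      case True
      have "\<forall>\<^sub>F n in sequentially. exp (- \<nu> * t) * (1 + \<nu> * u (S (F t (x n)))) = f (x n) t"
        using order_tendstoD(2)[OF G True] by eventually_elim (simp add: f_def)
      moreover have "(\<lambda>n. exp (- \<nu> * t) * (1 + \<nu> * u (S (F t (x n))))) \<longlonglongrightarrow> f p t"
        using True by (simp add: f_def) (intro tendsto_intros u')
      ultimately show ?thesis by (rule Lim_transform_eventually[rotated])
    next
      case False
      then have "0 < Gv (F t p)" using t by (auto simp: Z_def)
      from order_tendstoD(1)[OF G this] have "\<forall>\<^sub>F n in sequentially. f (x n) t = 0"
        by eventually_elim (simp add: f_def)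
      then show ?thesis using False by (simp add: f_def tendsto_eventually)
    qed
  qed
  then show "(dv_op \<nu> u \<circ> x) \<longlonglongrightarrow> dv_op \<nu> u p"
    by (simp add: eq o_def)
qed

text \<open>Differentiating \<open>v = H v\<close> under the integral shows that \<open>dv e\<close> is a fixed point of \<open>dv_op\<close>,
  which contracts the supremum norm by the factor \<open>1 - exp (- \<nu> * hor)\<close> and preserves continuity.\<close>

lemma continuous_dv:
  assumes c: "coord e a s"
  shows "continuous_on Q (dv e)"
proof -
  note cD = coordD[OF c]
  define \<nu> where "\<nu> = \<mu> * s"
  have nu: "0 < \<nu>" using cD mu_gt_1 by (simp add: \<nu>_def)
  define q where "q = 1 - exp (- \<nu> * hor)"
  have q: "0 \<le> q" "q < 1" using nu const_pos by (auto simp: q_def)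
  define u where "u n = (dv_op \<nu> ^^ n) (\<lambda>_. 0)" for n
  have u_Suc: "u (Suc n) = dv_op \<nu> (u n)" for n by (simp add: u_def)
  \<comment> \<open>The iterates of \<open>dv_op\<close> from 0 are compared with
    \<open>dv e\<close> directly; the initial error is at most \<open>slope s\<close>. Thus
    \<open>dv e\<close> is a uniform limit of continuous functions.\<close>
  have *: "continuous_on Q (u n) \<and> (\<forall>p\<in>Q. \<bar>dv e p - u n p\<bar> \<le> q ^ n * slope s)" for n
  proof (induction n)
    case 0
    show ?case using dv_bounds[OF _ c] by (auto simp: u_def abs_le_iff intro: order_trans[of _ 0] simp del: split_paired_All)
  next
    case (Suc n)
    define E where "E = q ^ n * slope s"
    have E: "0 \<le> E" using q slope_pos[OF c] by (simp add: E_def)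
    have "\<bar>u n p\<bar> \<le> E + slope s" if "p \<in> Q" for p
    proof -
      have "\<bar>dv e p - u n p\<bar> \<le> E" using Suc that by (simp add: E_def)
      then show ?thesis using dv_bounds[OF that c] by linarith
    qed
    then have "continuous_on Q (u (Suc n))"
      unfolding u_Suc using Suc nu by (intro continuous_dv_op) blast+
    moreover have "\<bar>dv e p - u (Suc n) p\<bar> \<le> q ^ Suc n * slope s" if p: "p \<in> Q" for p
    proof -
      define f where "f w t = exp (- \<nu> * t) * (if Gv (F t p) < 0 then 1 + \<nu> * w (S (F t p)) else 0)" for w t
      have int: "f (dv e) integrable_on {0..hor}" "f (u n) integrable_on {0..hor}"
        using dv_fixed(1)[OF p c] dv_op_integrable[OF _ p] Suc unfolding f_def \<nu>_def by blast+
      have "dv e p - u (Suc n) p = integral {0..hor} (\<lambda>t. f (dv e) t - f (u n) t)"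
        unfolding u_Suc dv_fixed(2)[OF p c] dv_op_def \<nu>_def[symmetric]
        using integral_diff[OF int] by (simp add: f_def[abs_def])
      also have "norm \<dots> \<le> integral {0..hor} (\<lambda>t. \<nu> * E * exp (- \<nu> * t))"
      proof (rule integral_norm_bound_integral)
        show "(\<lambda>t. f (dv e) t - f (u n) t) integrable_on {0..hor}"
          by (intro integrable_diff int)
        show "(\<lambda>t. \<nu> * E * exp (- \<nu> * t)) integrable_on {0..hor}"
          by (intro integrable_continuous_real continuous_intros)
        fix t assume t: "t \<in> {0..hor}"
        have "\<bar>dv e (S (F t p)) - u n (S (F t p))\<bar> \<le> E"
          using Suc t p by (auto simp: E_def intro: S_in_Q F_in_Q simp del: split_paired_All)
        then have "exp (- \<nu> * t) * \<nu> * \<bar>dv e (S (F t p)) - u n (S (F t p))\<bar> \<le> exp (- \<nu> * t) * \<nu> * E"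
          using nu by (intro mult_left_mono) auto
        then show "norm (f (dv e) t - f (u n) t) \<le> \<nu> * E * exp (- \<nu> * t)"
          using nu E by (auto simp: f_def abs_mult mult_ac simp flip: right_diff_distrib)
      qed
      also have "\<dots> = \<nu> * E * ((1 - exp (- \<nu> * hor)) / \<nu>)"
        using integral_exp_decay[OF nu, of hor] const_pos by (simp add: integral_unique)
      also have "\<dots> = q ^ Suc n * slope s"
        using nu by (simp add: q_def E_def)
      finally show ?thesis by simp
    qed
    ultimately show ?case by blast
  qed
  have "uniform_limit Q u (dv e) sequentially"
  proof (rule uniform_limitI)
    fix \<epsilon> :: real assume "0 < \<epsilon>"
    have "(\<lambda>n. q ^ n * slope s) \<longlonglongrightarrow> 0 * slope s"
      using q by (intro tendsto_intros LIMSEQ_power_zero) auto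
    then have "\<forall>\<^sub>F n in sequentially. q ^ n * slope s < \<epsilon>"
      using \<open>0 < \<epsilon>\<close> by (intro order_tendstoD) auto
    then show "\<forall>\<^sub>F n in sequentially. \<forall>p\<in>Q. dist (u n p) (dv e p) < \<epsilon>"
    proof eventually_elim
      case (elim n)
      show ?case
      proof
        fix p assume "p \<in> Q"
        then have "\<bar>dv e p - u n p\<bar> \<le> q ^ n * slope s" using * by blast
        then show "dist (u n p) (dv e p) < \<epsilon>"
          using elim by (simp add: dist_real_def abs_minus_commute)
      qed
    qed
  qed
  then show ?thesis
    by (rule uniform_limit_theorem[rotated]) (use * in auto)
qed

lemma increment_approx:
  assumes "coord e a s" "r \<in> Q" "r + h *\<^sub>R e \<in> Q"
    and "\<bar>dv e r - d\<bar> \<le> \<epsilon>" "\<bar>dv e (r + h *\<^sub>R e) - d\<bar> \<le> \<epsilon>"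
  shows "\<bar>v (r + h *\<^sub>R e) - v r - d * h\<bar> \<le> \<epsilon> * \<bar>h\<bar>"
proof -
  have main: "\<bar>v (r + h *\<^sub>R e) - v r - d * h\<bar> \<le> \<epsilon> * h"
    if r: "r \<in> Q" and h: "0 \<le> h" and b: "\<bar>dv e r - d\<bar> \<le> \<epsilon>" "\<bar>dv e (r + h *\<^sub>R e) - d\<bar> \<le> \<epsilon>" for r and h :: real
  proof -
    have "(dv e r - d) * h \<le> \<epsilon> * h" "- \<epsilon> * h \<le> (dv e (r + h *\<^sub>R e) - d) * h"
      using b h by (intro mult_right_mono; simp)+
    then show ?thesis
      using increment_le_dv[OF r assms(1) h] dv_le_increment[OF r assms(1) h]
      by (simp add: abs_le_iff algebra_simps)
  qed
  show ?thesis
  proof (cases "0 \<le> h")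
    case True
    then show ?thesis using main assms by simp
  next
    case False
    then show ?thesis
      using main[of "r + h *\<^sub>R e" "- h"] assms by (simp add: abs_minus_commute algebra_simps)
  qed
qed

definition v_deriv :: "real \<times> real \<Rightarrow> (real \<times> real) \<Rightarrow>\<^sub>L real" where
  "v_deriv p = dv (1, 0) p *\<^sub>R Blinfun fst + dv (0, 1) p *\<^sub>R Blinfun snd"

lemma v_deriv_apply: "blinfun_apply (v_deriv p) q = dv (1, 0) p * fst q + dv (0, 1) p * snd q"
  by (simp add: v_deriv_def blinfun.bilinear_simps bounded_linear_Blinfun_apply
      bounded_linear_fst bounded_linear_snd)

lemma continuous_on_v_deriv: "continuous_on Q v_deriv"
  unfolding v_deriv_def
  by (intro continuous_intros continuous_dv[OF coord_x] continuous_dv[OF coord_y])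

lemma v_has_derivative:
  assumes p: "p \<in> Q"
  shows "(v has_derivative blinfun_apply (v_deriv p)) (at p within Q)"
  unfolding has_derivative_within_alt2
proof (intro conjI allI impI)
  show "bounded_linear (blinfun_apply (v_deriv p))" by (rule blinfun.bounded_linear_right)
  fix \<epsilon> :: real assume "0 < \<epsilon>"
  then have eps: "0 < \<epsilon> / 2" by simp
  obtain d1 where d1: "0 < d1" "\<And>q. q \<in> Q \<Longrightarrow> dist q p < d1 \<Longrightarrow> dist (dv (1, 0) q) (dv (1, 0) p) < \<epsilon> / 2"
    using continuous_dv[OF coord_x] p eps unfolding continuous_on_iff by meson
  obtain d2 where d2: "0 < d2" "\<And>q. q \<in> Q \<Longrightarrow> dist q p < d2 \<Longrightarrow> dist (dv (0, 1) q) (dv (0, 1) p) < \<epsilon> / 2"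
    using continuous_dv[OF coord_y] p eps unfolding continuous_on_iff by meson
  have "\<forall>\<^sub>F q in at p within Q. q \<in> Q \<and> dist q p < min d1 d2"
    using d1(1) d2(1) by (auto simp: eventually_at intro!: exI[of _ "min d1 d2"])
  then show "\<forall>\<^sub>F q in at p within Q. norm (v q - v p - blinfun_apply (v_deriv p) (q - p)) \<le> \<epsilon> * norm (q - p)"
  proof eventually_elim
    case (elim q)
    then have q: "q \<in> Q" "dist q p < d1" "dist q p < d2" by auto
    \<comment> \<open>The corner of the path from p to q by coordinate steps; it lies in the
      quadrant, so the argument also works on the axes.\<close>
    define r where "r = (fst p, snd q)"
    have r: "r \<in> Q" using p q(1) by (simp add: Q_iff r_def)
    have dr: "dist r p \<le> dist q p"
      by (cases p, cases q) (simp add: r_def dist_Pair_Pair)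
    have qr: "q = r + (fst q - fst p) *\<^sub>R (1, 0)" and rp: "r = p + (snd q - snd p) *\<^sub>R (0, 1)"
      by (simp_all add: r_def prod_eq_iff)
    have "\<bar>v q - v r - dv (1, 0) p * (fst q - fst p)\<bar> \<le> \<epsilon> / 2 * \<bar>fst q - fst p\<bar>"
      using increment_approx[OF coord_x r, of "fst q - fst p" "dv (1, 0) p" "\<epsilon> / 2"] q d1(2)[of q] d1(2)[OF r] dr
      unfolding qr[symmetric] by (simp add: dist_real_def)
    moreover have "\<bar>v r - v p - dv (0, 1) p * (snd q - snd p)\<bar> \<le> \<epsilon> / 2 * \<bar>snd q - snd p\<bar>"
      using increment_approx[OF coord_y p, of "snd q - snd p" "dv (0, 1) p" "\<epsilon> / 2"] q d2(2)[OF r] dr r eps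
      unfolding rp[symmetric] by (simp add: dist_real_def)
    moreover have "\<epsilon> / 2 * \<bar>fst q - fst p\<bar> \<le> \<epsilon> / 2 * norm (q - p)" "\<epsilon> / 2 * \<bar>snd q - snd p\<bar> \<le> \<epsilon> / 2 * norm (q - p)"
      using norm_fst_le[of "fst (q - p)" "snd (q - p)"] norm_snd_le[of "snd (q - p)" "fst (q - p)"] eps
      by (auto intro!: mult_left_mono simp flip: minus_prod_def)
    ultimately show ?case
      unfolding v_deriv_apply real_norm_def fst_diff snd_diff abs_le_iff by linarith
  qed
qed

lemma v_C1: "C1_on_quadrant_part Q v"
  unfolding C1_on_quadrant_part_def using v_has_derivative continuous_on_v_deriv by blast

end

section \<open>The free boundary and the variational inequalities\<close>

lemma at_within_atLeast_neq_bot: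
  assumes "0 \<le> (x::real)"
  shows "at x within {0..} \<noteq> bot"
proof -
  have "x islimpt {x<..<x + 1}" by (intro islimpt_greaterThanLessThan1) simp
  then have "x islimpt {0..}" by (rule islimpt_subset) (use assms in auto)
  then show ?thesis by (simp add: trivial_limit_within)
qed

lemma partial_derivatives_eq:
  assumes p: "p \<in> quadrant" and f: "(f has_derivative f') (at p within quadrant)"
  shows "D0 f p = f' (1, 0)" "D1 f p = f' (0, 1)"
proof -
  interpret f': bounded_linear f' by (rule has_derivative_bounded_linear[OF f])
  have p': "0 \<le> fst p" "0 \<le> snd p" using p by (auto simp: quadrant_def)
  have "((\<lambda>s. f (s, snd p)) has_derivative (\<lambda>h. f' (h, 0))) (at (fst p) within {0..})"
  proof (rule has_derivative_in_compose[where f = "\<lambda>s. (s, snd p)" and f' = "\<lambda>h. (h, 0)"])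
    show "((\<lambda>s. (s, snd p)) has_derivative (\<lambda>h. (h, 0))) (at (fst p) within {0..})"
      by (intro has_derivative_Pair has_derivative_ident has_derivative_const)
    show "(f has_derivative f') (at (fst p, snd p) within (\<lambda>s. (s, snd p)) ` {0..})"
      unfolding prod.collapse by (rule has_derivative_subset[OF f]) (use p' in \<open>auto simp: quadrant_def\<close>)
  qed
  moreover have "(\<lambda>h. f' (h, 0)) = (\<lambda>h. h *\<^sub>R f' (1, 0))"
  proof
    fix h show "f' (h, 0) = h *\<^sub>R f' (1, 0)" using f'.scaleR[of h "(1, 0)"] by simp
  qed
  ultimately have "((\<lambda>s. f (s, snd p)) has_vector_derivative f' (1, 0)) (at (fst p) within {0..})"
    by (simp only: has_vector_derivative_def)
  then show "D0 f p = f' (1, 0)"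
    unfolding D0_def by (rule vector_derivative_within[OF at_within_atLeast_neq_bot[OF p'(1)]])
  have "((\<lambda>s. f (fst p, s)) has_derivative (\<lambda>h. f' (0, h))) (at (snd p) within {0..})"
  proof (rule has_derivative_in_compose[where f = "\<lambda>s. (fst p, s)" and f' = "\<lambda>h. (0, h)"])
    show "((\<lambda>s. (fst p, s)) has_derivative (\<lambda>h. (0, h))) (at (snd p) within {0..})"
      by (intro has_derivative_Pair has_derivative_ident has_derivative_const)
    show "(f has_derivative f') (at (fst p, snd p) within (\<lambda>s. (fst p, s)) ` {0..})"
      unfolding prod.collapse by (rule has_derivative_subset[OF f]) (use p' in \<open>auto simp: quadrant_def\<close>)
  qed
  moreover have "(\<lambda>h. f' (0, h)) = (\<lambda>h. h *\<^sub>R f' (0, 1))"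
  proof
    fix h show "f' (0, h) = h *\<^sub>R f' (0, 1)" using f'.scaleR[of h "(0, 1)"] by simp
  qed
  ultimately have "((\<lambda>s. f (fst p, s)) has_vector_derivative f' (0, 1)) (at (snd p) within {0..})"
    by (simp only: has_vector_derivative_def)
  then show "D1 f p = f' (0, 1)"
    unfolding D1_def by (rule vector_derivative_within[OF at_within_atLeast_neq_bot[OF p'(2)]])
qed

context disorder
begin

definition drift :: "real \<times> real \<Rightarrow> real \<times> real" where
  "drift p = ((lam + 1) * fst p + b0, (lam - 1) * snd p + b1)"

lemma F_has_vector_derivative: "((\<lambda>t. F t p) has_vector_derivative drift (F t p)) (at t within A)"
proof -
  have "((\<lambda>t. F t p) has_vector_derivative drift (F t p)) (at t)"
    unfolding flow_def x_flow_def y_flow_def drift_def fst_conv snd_conv b0_def b1_def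
    by (intro has_vector_derivative_Pair linear_ode_solution(2)[THEN has_real_derivative_iff_has_vector_derivative[THEN iffD1]])
  then show ?thesis by (rule has_vector_derivative_at_within)
qed

text \<open>The first-order part is the derivative along the flow; the jump part merges with the
  cost into \<open>G w\<close> and raises the decay rate from \<open>lam\<close> to
  \<open>kap\<close>. The equation thereby becomes an ordinary differential equation along
  trajectories.\<close>

lemma generator_eq:
  assumes p: "p \<in> Q" and w: "(w has_derivative w') (at p within Q)"
  shows "generator lam \<mu> m w p - lam * w p + g p = w' (drift p) + G w p - kap * w p"
proof -
  interpret w': bounded_linear w' by (rule has_derivative_bounded_linear[OF w])
  have "drift p = fst (drift p) *\<^sub>R (1, 0) + snd (drift p) *\<^sub>R (0, 1)"
    by (simp add: prod_eq_iff)
  then have "w' (drift p) = fst (drift p) * w' (1, 0) + snd (drift p) * w' (0, 1)"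
    by (metis w'.add w'.scaleR real_scaleR_def)
  then show ?thesis
    unfolding generator_def partial_derivatives_eq[OF p w]
    by (simp add: drift_def b0_def b1_def kap_def G_def algebra_simps)
qed

lemma derivative_along_flow:
  assumes p: "p \<in> Q" and A: "A \<subseteq> {0..}" and t: "0 \<le> t"
    and w: "(w has_derivative w') (at (F t p) within Q)"
  shows "((\<lambda>s. w (F s p)) has_vector_derivative w' (drift (F t p))) (at t within A)"
proof -
  interpret w': bounded_linear w' by (rule has_derivative_bounded_linear[OF w])
  have "((\<lambda>s. w (F s p)) has_derivative (\<lambda>h. w' (h *\<^sub>R drift (F t p)))) (at t within A)"
  proof (rule has_derivative_in_compose[where f = "\<lambda>s. F s p"])
    show "((\<lambda>s. F s p) has_derivative (\<lambda>h. h *\<^sub>R drift (F t p))) (at t within A)"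
      using F_has_vector_derivative by (simp add: has_vector_derivative_def)
    show "(w has_derivative w') (at (F t p) within (\<lambda>s. F s p) ` A)"
      by (rule has_derivative_subset[OF w]) (use A F_in_Q[OF p] in auto)
  qed
  then show ?thesis by (simp add: has_vector_derivative_def w'.scaleR)
qed

text \<open>A jump changes the sum of the coordinates by (y - x) / \<mu> and keeps the order x \<le>
  y. On the line x + y = \<open>thr\<close> this order means x \<le> \<open>thr / 2\<close>, which
  is the origin of the interval on which the boundary is linear.\<close>

lemma g_jumps_nonneg:
  assumes "p \<in> Q" "fst p \<le> snd p" "thr \<le> fst p + snd p"
  shows "0 \<le> g ((S ^^ j) p)"
proof -
  have "(S ^^ j) p \<in> Q \<and> fst ((S ^^ j) p) \<le> snd ((S ^^ j) p) \<and> thr \<le> fst ((S ^^ j) p) + snd ((S ^^ j) p)"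
  proof (induction j)
    case (Suc j)
    define q where "q = (S ^^ j) p"
    have q: "0 \<le> fst q" "0 \<le> snd q" "fst q \<le> snd q" "thr \<le> fst q + snd q" "q \<in> Q"
      using Suc by (auto simp: q_def Q_iff)
    have "fst q / \<mu> \<le> snd q / \<mu>" "0 \<le> fst q / \<mu>" "0 \<le> snd q / \<mu>"
      using q mu_gt_1 by (auto intro: divide_right_mono)
    then have "fst (S q) \<le> snd (S q)" "thr \<le> fst (S q) + snd (S q)"
      using q by (auto simp: S_eq algebra_simps)
    then show ?case using S_in_Q[OF q(5)] by (simp add: q_def)
  qed (use assms in simp)
  then show ?thesis by (simp add: g_eq)
qed

end

context disorder_value
begin

section \<open>Geometry of the free boundary\<close>

lemma continuous_on_Gv: "continuous_on A h \<Longrightarrow> (\<And>x. x \<in> A \<Longrightarrow> h x \<in> Q) \<Longrightarrow> continuous_on A (\<lambda>x. Gv (h x))"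
  by (rule continuous_on_G[OF good_continuous[OF good_v]])

text \<open>This is the smooth fit of the value at the boundary: a trajectory that starts with
  \<open>Gv\<close> nonnegative keeps it so, and the integrand in the equation for the derivative
  vanishes.\<close>

lemma dv_eq_0:
  assumes p: "p \<in> Q" and c: "coord e a s" and G: "0 \<le> Gv p"
  shows "dv e p = 0"
proof -
  have "dv_op (\<mu> * s) (dv e) p = integral {0..hor} (\<lambda>t. 0)"
    unfolding dv_op_def
  proof (rule integral_cong)
    fix t assume "t \<in> {0..hor}"
    then have "0 \<le> Gv (F t p)" using G_flow_nonneg[OF p G] by simp
    then show "exp (- (\<mu> * s) * t) * (if Gv (F t p) < 0 then 1 + \<mu> * s * dv e (S (F t p)) else 0) = 0"
      by simp
  qed
  then show ?thesis using dv_fixed(2)[OF p c] by simp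
qed

definition \<Gamma> :: "(real \<times> real) set" where "\<Gamma> = stopping_region v"
definition \<gamma> :: "real \<Rightarrow> real" where "\<gamma> = boundary_function \<Gamma>"
definition \<xi> :: real where "\<xi> = support_end \<gamma>"

lemma \<Gamma>_iff: "p \<in> \<Gamma> \<longleftrightarrow> p \<in> Q \<and> 0 \<le> Gv p"
  unfolding \<Gamma>_def stopping_region_def using v_eq_0_iff[of p] by auto

lemma pair_in_Q: "(x, y) \<in> Q \<longleftrightarrow> 0 \<le> x \<and> 0 \<le> y"
  by (simp add: Q_iff)

lemma Gv_mono_pair:
  assumes "0 \<le> x" "0 \<le> y" "x \<le> x'" "y \<le> y'"
  shows "Gv (x, y) + (x' - x) + (y' - y) \<le> Gv (x', y')"
  using G_mono_shift[OF good_v, of "(x, y)" "(x', y')"] assms by (simp add: pair_in_Q)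

definition clip :: real where
  "clip = 1 + \<mu> * (1 - 1 / \<mu>) * slope (1 - 1 / \<mu>) + \<mu> * (1 + 1 / \<mu>) * slope (1 + 1 / \<mu>)"

lemma clip_pos: "0 < clip" and
  Gv_lip_pair: "0 \<le> x \<Longrightarrow> 0 \<le> y \<Longrightarrow> 0 \<le> h \<Longrightarrow> Gv (x + h, y) - Gv (x, y) \<le> clip * h"
    "0 \<le> x \<Longrightarrow> 0 \<le> y \<Longrightarrow> 0 \<le> h \<Longrightarrow> Gv (x, y + h) - Gv (x, y) \<le> clip * h"
proof -
  have a: "0 < \<mu> * (1 - 1 / \<mu>) * slope (1 - 1 / \<mu>)"
    by (intro mult_pos_pos slope_pos[OF coord_x] coordD(2)[OF coord_x]) (use mu_gt_1 in simp)
  have b: "0 < \<mu> * (1 + 1 / \<mu>) * slope (1 + 1 / \<mu>)"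
    by (intro mult_pos_pos slope_pos[OF coord_y] coordD(2)[OF coord_y]) (use mu_gt_1 in simp)
  show "0 < clip" using a b by (simp add: clip_def)
  assume p: "0 \<le> x" "0 \<le> y" "0 \<le> h"
  have "Gv (x + h, y) - Gv (x, y) \<le> (1 + \<mu> * (1 - 1 / \<mu>) * slope (1 - 1 / \<mu>)) * h"
    using G_coord(2)[OF good_v _ coord_x p(3), of "(x, y)"] p by (simp add: pair_in_Q)
  also have "\<dots> \<le> clip * h" using b p by (intro mult_right_mono) (auto simp: clip_def)
  finally show "Gv (x + h, y) - Gv (x, y) \<le> clip * h" .
  have "Gv (x, y + h) - Gv (x, y) \<le> (1 + \<mu> * (1 + 1 / \<mu>) * slope (1 + 1 / \<mu>)) * h"
    using G_coord(2)[OF good_v _ coord_y p(3), of "(x, y)"] p by (simp add: pair_in_Q)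
  also have "\<dots> \<le> clip * h" using a p by (intro mult_right_mono) (auto simp: clip_def)
  finally show "Gv (x, y + h) - Gv (x, y) \<le> clip * h" .
qed

text \<open>Each vertical section of \<Gamma> is closed, contains \<open>thr\<close> and is an upper
  set since \<open>Gv\<close> increases in y; so the infimum that defines \<gamma> is
  attained.\<close>

lemma \<gamma>_le_iff:
  assumes x: "0 \<le> x" and y: "0 \<le> y"
  shows "\<gamma> x \<le> y \<longleftrightarrow> 0 \<le> Gv (x, y)"
proof -
  define A where "A = {y. 0 \<le> y \<and> (x, y) \<in> \<Gamma>}"
  have A: "A = {y \<in> {0..}. 0 \<le> Gv (x, y)}"
    using x by (auto simp: A_def \<Gamma>_iff pair_in_Q)
  have "continuous_on {0..} (\<lambda>y. Gv (x, y))"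
    by (intro continuous_on_Gv continuous_intros) (use x in \<open>simp add: pair_in_Q\<close>)
  then have "closed ({0..} \<inter> (\<lambda>y. Gv (x, y)) -` {0..})"
    by (rule continuous_closed_preimage) auto
  then have cl: "closed A" unfolding A by (simp add: Int_def vimage_def)
  have "x \<le> Gv (x, thr)"
    using G_above_thr[OF good_v, of "(x, thr)"] x const_pos by (simp add: pair_in_Q)
  then have ne: "thr \<in> A" using x const_pos by (simp add: A)
  have bdd: "bdd_below A" by (auto simp: A intro!: bdd_belowI[of _ 0])
  have In: "\<gamma> x \<in> A"
    unfolding \<gamma>_def boundary_function_def A_def[symmetric]
    using closed_contains_Inf[OF _ bdd cl] ne by auto
  show ?thesis
  proof
    assume "0 \<le> Gv (x, y)"
    then have "y \<in> A" using y by (simp add: A)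
    then show "\<gamma> x \<le> y"
      unfolding \<gamma>_def boundary_function_def A_def[symmetric] using bdd by (rule cInf_lower)
  next
    assume "\<gamma> x \<le> y"
    then show "0 \<le> Gv (x, y)"
      using In Gv_mono_pair[of x "\<gamma> x" x y] x by (simp add: A)
  qed
qed

lemma \<gamma>_nonneg: "0 \<le> x \<Longrightarrow> 0 \<le> \<gamma> x"
proof -
  assume x: "0 \<le> x"
  have "(x, thr) \<in> \<Gamma>"
    using G_above_thr[OF good_v, of "(x, thr)"] x const_pos by (simp add: pair_in_Q \<Gamma>_iff)
  then show ?thesis
    unfolding \<gamma>_def boundary_function_def using const_pos by (intro cInf_greatest) (auto intro!: exI[of _ thr])
qed

lemma Gv_\<gamma>_nonneg: "0 \<le> x \<Longrightarrow> 0 \<le> Gv (x, \<gamma> x)"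
  using \<gamma>_le_iff[of x "\<gamma> x"] \<gamma>_nonneg by simp

lemma Gv_\<gamma>:
  assumes x: "0 \<le> x" and pos: "0 < \<gamma> x"
  shows "Gv (x, \<gamma> x) = 0"
proof (rule ccontr)
  assume "Gv (x, \<gamma> x) \<noteq> 0"
  then have G: "0 < Gv (x, \<gamma> x)" using Gv_\<gamma>_nonneg[OF x] by simp
  \<comment> \<open>If \<open>Gv\<close> were positive at the boundary point, its Lipschitz bound
    would leave room to lower y by this h inside \<Gamma>.\<close>
  define h where "h = min (\<gamma> x) (Gv (x, \<gamma> x) / clip)"
  have h: "0 < h" "h \<le> \<gamma> x" "h \<le> Gv (x, \<gamma> x) / clip"
    using G pos clip_pos by (auto simp: h_def)
  then have "clip * h \<le> Gv (x, \<gamma> x)" using clip_pos by (simp add: field_simps)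
  then have "0 \<le> Gv (x, \<gamma> x - h)"
    using Gv_lip_pair(2)[of x "\<gamma> x - h" h] x h by simp
  then have "\<gamma> x \<le> \<gamma> x - h" using \<gamma>_le_iff[of x "\<gamma> x - h"] x h by simp
  then show False using h by simp
qed

lemma \<gamma>_eq_0_iff: "0 \<le> x \<Longrightarrow> \<gamma> x = 0 \<longleftrightarrow> 0 \<le> Gv (x, 0)"
  using \<gamma>_le_iff[of x 0] \<gamma>_nonneg[of x] by auto

lemma \<xi>_le_iff:
  assumes x: "0 \<le> x"
  shows "\<xi> \<le> x \<longleftrightarrow> \<gamma> x = 0"
proof -
  define A where "A = {x. 0 \<le> x \<and> \<gamma> x = 0}"
  have A: "A = {x \<in> {0..}. 0 \<le> Gv (x, 0)}"
    using \<gamma>_eq_0_iff by (auto simp: A_def)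
  have "continuous_on {0..} (\<lambda>x. Gv (x, 0))"
    by (intro continuous_on_Gv continuous_intros) (simp add: pair_in_Q)
  then have "closed ({0..} \<inter> (\<lambda>x. Gv (x, 0)) -` {0..})"
    by (rule continuous_closed_preimage) auto
  then have cl: "closed A" unfolding A by (simp add: Int_def vimage_def)
  have "0 \<le> Gv (cap, 0)"
    using G_ge(3)[OF good_v, of "(cap, 0)"] const_pos by (simp add: pair_in_Q)
  then have ne: "cap \<in> A" using const_pos by (simp add: A)
  have bdd: "bdd_below A" by (auto simp: A intro!: bdd_belowI[of _ 0])
  have In: "\<xi> \<in> A"
    unfolding \<xi>_def support_end_def A_def[symmetric]
    using closed_contains_Inf[OF _ bdd cl] ne by auto
  show ?thesis
  proof
    assume "\<gamma> x = 0"
    then have "x \<in> A" using x by (simp add: A_def)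
    then show "\<xi> \<le> x"
      unfolding \<xi>_def support_end_def A_def[symmetric] using bdd by (rule cInf_lower)
  next
    assume "\<xi> \<le> x"
    then have "0 \<le> Gv (x, 0)"
      using In Gv_mono_pair[of \<xi> 0 x 0] x by (simp add: A)
    then show "\<gamma> x = 0" using \<gamma>_eq_0_iff[OF x] by simp
  qed
qed

text \<open>On this part of the line x + y = \<open>thr\<close> the cost stays nonnegative under all
  jumps, so \<open>v\<close> vanishes there. Conversely \<open>Gv\<close> is at most the cost, so no
  point of \<Gamma> lies below the line.\<close>

lemma \<gamma>_near_axis:
  assumes "0 \<le> x" "x \<le> thr / 2"
  shows "\<gamma> x = thr - x"
proof (rule antisym)
  have p: "(x, thr - x) \<in> Q" using assms const_pos by (simp add: pair_in_Q)
  have "v (x, thr - x) = 0"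
    by (rule goodD(6)[OF good_v p]) (use g_jumps_nonneg[OF p] assms in simp)
  then have "0 \<le> Gv (x, thr - x)" using v_eq_0_iff[OF p] by simp
  then show "\<gamma> x \<le> thr - x" using \<gamma>_le_iff assms const_pos by simp
  have "0 \<le> g (x, \<gamma> x)"
    using Gv_\<gamma>_nonneg[of x] G_ge(2)[OF good_v, of "(x, \<gamma> x)"] \<gamma>_nonneg[of x] assms
    by (simp add: pair_in_Q)
  then show "thr - x \<le> \<gamma> x" by (simp add: g_eq)
qed

lemma \<xi>_gt: "thr / 2 < \<xi>"
proof -
  have "\<gamma> (thr / 2) = thr / 2" using \<gamma>_near_axis[of "thr / 2"] const_pos by simp
  then show ?thesis using \<xi>_le_iff[of "thr / 2"] const_pos by force
qed

text \<open>When x moves, the change of \<open>Gv\<close> is at most \<open>clip\<close> times the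
  displacement, and a change of y compensates it with slope at least one.\<close>

lemma \<gamma>_lipschitz:
  assumes "0 \<le> x" "x \<le> x'"
  shows "\<gamma> x' \<le> \<gamma> x" "\<gamma> x - \<gamma> x' \<le> clip * (x' - x)"
proof -
  have x': "0 \<le> x'" using assms by simp
  note nn = \<gamma>_nonneg[OF assms(1)] \<gamma>_nonneg[OF x']
  have "0 \<le> Gv (x', \<gamma> x)"
    using Gv_\<gamma>_nonneg[OF assms(1)] Gv_mono_pair[of x "\<gamma> x" x' "\<gamma> x"] assms nn by simp
  then show le: "\<gamma> x' \<le> \<gamma> x" using \<gamma>_le_iff[of x' "\<gamma> x"] x' nn by simp
  show "\<gamma> x - \<gamma> x' \<le> clip * (x' - x)"
  proof (cases "\<gamma> x = 0")
    case True
    have "0 \<le> clip * (x' - x)" using clip_pos assms by simp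
    then show ?thesis using nn True by linarith
  next
    case False
    then have "Gv (x, \<gamma> x) = 0" using Gv_\<gamma>[OF assms(1)] nn by simp
    moreover have "Gv (x, \<gamma> x') + (\<gamma> x - \<gamma> x') \<le> Gv (x, \<gamma> x)"
      using Gv_mono_pair[of x "\<gamma> x'" x "\<gamma> x"] assms nn le by simp
    moreover have "Gv (x', \<gamma> x') - Gv (x, \<gamma> x') \<le> clip * (x' - x)"
      using Gv_lip_pair(1)[of x "\<gamma> x'" "x' - x"] assms nn by simp
    ultimately show ?thesis using Gv_\<gamma>_nonneg[OF x'] by linarith
  qed
qed

lemma \<gamma>_lipschitz_abs:
  assumes "0 \<le> x" "0 \<le> x'"
  shows "\<bar>\<gamma> x' - \<gamma> x\<bar> \<le> clip * \<bar>x' - x\<bar>"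
  using \<gamma>_lipschitz[of x x'] \<gamma>_lipschitz[of x' x] assms by (cases "x \<le> x'") auto

text \<open>\<open>Gx\<close> and \<open>Gy\<close> are the partial derivatives of
  \<open>Gv\<close>; in the chain rule \<mu> times the jump factors simplifies to \<mu> - 1 and
  \<mu> + 1.\<close>

definition Gx :: "real \<times> real \<Rightarrow> real" where
  "Gx p = 1 + (\<mu> - 1) * dv (1, 0) (S p)"

definition Gy :: "real \<times> real \<Rightarrow> real" where
  "Gy p = 1 + (\<mu> + 1) * dv (0, 1) (S p)"

lemma Gy_ge: "p \<in> Q \<Longrightarrow> 1 \<le> Gy p"
  using dv_bounds(1)[OF S_in_Q coord_y] mu_gt_1 by (simp add: Gy_def)

lemma Gv_has_derivative:
  assumes p: "p \<in> Q"
  shows "(Gv has_derivative (\<lambda>d. Gx p * fst d + Gy p * snd d)) (at p within Q)"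
proof -
  have "((\<lambda>q. v (S q)) has_derivative (\<lambda>d. v_deriv (S p) (S d))) (at p within Q)"
  proof (rule has_derivative_in_compose[where f = S])
    show "(S has_derivative S) (at p within Q)"
      unfolding S_eq[abs_def] by (auto intro!: derivative_eq_intros)
    show "(v has_derivative v_deriv (S p)) (at (S p) within S ` Q)"
      by (rule has_derivative_subset[OF v_has_derivative[OF S_in_Q[OF p]]]) (auto intro: S_in_Q)
  qed
  then have "((\<lambda>q. fst q + snd q - thr + \<mu> * v (S q)) has_derivative
      (\<lambda>d. fst d + snd d + \<mu> * v_deriv (S p) (S d))) (at p within Q)"
    by (auto intro!: derivative_eq_intros)
  moreover have "fst d + snd d + \<mu> * v_deriv (S p) (S d) = Gx p * fst d + Gy p * snd d" for d
    using mu_gt_1 by (simp add: v_deriv_apply S_eq Gx_def Gy_def field_simps)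
  moreover have "(\<lambda>q. fst q + snd q - thr + \<mu> * v (S q)) = Gv"
    by (simp add: fun_eq_iff G_def g_eq)
  ultimately show ?thesis by simp
qed

text \<open>The implicit function theorem by hand. On the interior of the support \<gamma> is
  positive, so \<open>Gv\<close> vanishes identically along the graph; expanding it there and
  dividing by \<open>Gy\<close>, which is at least one, gives the derivative. The remainder is
  controlled because \<gamma> is already Lipschitz.\<close>

lemma \<gamma>_has_derivative:
  assumes x: "0 < x" "x < \<xi>"
  shows "(\<gamma> has_real_derivative - Gx (x, \<gamma> x) / Gy (x, \<gamma> x)) (at x)"
proof -
  define p where "p = (x, \<gamma> x)"
  have p: "p \<in> Q" using x \<gamma>_nonneg by (simp add: p_def pair_in_Q)
  have pos: "Gv (t, \<gamma> t) = 0" if "t \<in> {0<..<\<xi>}" for t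
  proof (rule Gv_\<gamma>)
    show "0 \<le> t" using that by simp
    then show "0 < \<gamma> t" using \<gamma>_nonneg[of t] \<xi>_le_iff[of t] that by force
  qed
  define D where "D = - Gx p / Gy p"
  have Gy: "1 \<le> Gy p" by (rule Gy_ge[OF p])
  have ev: "\<forall>\<^sub>F t in at x. t \<in> {0<..<\<xi>} \<and> t \<noteq> x"
    using x by (auto simp: eventually_at_filter intro!: eventually_mono[OF eventually_nhds_in_open[of "{0<..<\<xi>}"]])
  have lim\<gamma>: "(\<gamma> \<longlongrightarrow> \<gamma> x) (at x)"
  proof (rule tendsto_sandwich[of "\<lambda>t. \<gamma> x - clip * \<bar>t - x\<bar>" _ _ "\<lambda>t. \<gamma> x + clip * \<bar>t - x\<bar>"])
    have "\<bar>\<gamma> t - \<gamma> x\<bar> \<le> clip * \<bar>t - x\<bar>" if "t \<in> {0<..<\<xi>} \<and> t \<noteq> x" for t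
      using \<gamma>_lipschitz_abs[of x t] x that by simp
    then have *: "\<forall>\<^sub>F t in at x. \<bar>\<gamma> t - \<gamma> x\<bar> \<le> clip * \<bar>t - x\<bar>"
      by (rule eventually_mono[OF ev])
    show "\<forall>\<^sub>F t in at x. \<gamma> x - clip * \<bar>t - x\<bar> \<le> \<gamma> t"
      using * by eventually_elim linarith
    show "\<forall>\<^sub>F t in at x. \<gamma> t \<le> \<gamma> x + clip * \<bar>t - x\<bar>"
      using * by eventually_elim linarith
  qed (auto intro!: tendsto_eq_intros)
  have lim: "filterlim (\<lambda>t. (t, \<gamma> t)) (at p within Q) (at x)"
    unfolding filterlim_at
  proof
    show "\<forall>\<^sub>F t in at x. (t, \<gamma> t) \<in> Q \<and> (t, \<gamma> t) \<noteq> p"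
      using ev by eventually_elim (use \<gamma>_nonneg in \<open>auto simp: p_def pair_in_Q\<close>)
    show "((\<lambda>t. (t, \<gamma> t)) \<longlongrightarrow> p) (at x)"
      unfolding p_def by (intro tendsto_intros lim\<gamma>)
  qed
  have "(\<gamma> has_derivative (*) D) (at x)"
    unfolding has_derivative_within_alt2
  proof (intro conjI allI impI)
    show "bounded_linear ((*) D)" by (rule bounded_linear_mult_right)
    fix \<epsilon> :: real assume \<epsilon>: "0 < \<epsilon>"
    \<comment> \<open>A step t - x in the argument moves the point of the graph by at most 1 +
      \<open>clip\<close> times as much.\<close>
    define \<eta> where "\<eta> = \<epsilon> / (1 + clip)"
    have \<eta>: "0 < \<eta>" "\<eta> * (1 + clip) = \<epsilon>" using \<epsilon> clip_pos by (auto simp: \<eta>_def)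
    have "\<forall>\<^sub>F q in at p within Q. norm (Gv q - Gv p - (Gx p * fst (q - p) + Gy p * snd (q - p))) \<le> \<eta> * norm (q - p)"
      using Gv_has_derivative[OF p] \<eta>(1) unfolding has_derivative_within_alt2 by blast
    from eventually_compose_filterlim[OF this lim] ev
    show "\<forall>\<^sub>F t in at x. norm (\<gamma> t - \<gamma> x - D * (t - x)) \<le> \<epsilon> * norm (t - x)"
    proof eventually_elim
      case (elim t)
      have "norm ((t, \<gamma> t) - p) \<le> \<bar>t - x\<bar> + \<bar>\<gamma> t - \<gamma> x\<bar>"
        unfolding p_def using norm_Pair_le[of "t - x" "\<gamma> t - \<gamma> x"] by simp
      also have "\<dots> \<le> (1 + clip) * \<bar>t - x\<bar>"
        using \<gamma>_lipschitz_abs[of x t] elim(2) x by (simp add: algebra_simps)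
      finally have "\<eta> * norm ((t, \<gamma> t) - p) \<le> \<eta> * ((1 + clip) * \<bar>t - x\<bar>)"
        using \<eta>(1) by (intro mult_left_mono) auto
      also have "\<dots> = \<epsilon> * \<bar>t - x\<bar>" using \<eta>(2) by (simp add: mult.assoc[symmetric])
      finally have "\<bar>Gx p * (t - x) + Gy p * (\<gamma> t - \<gamma> x)\<bar> \<le> \<epsilon> * \<bar>t - x\<bar>"
        using elim pos[of t] pos[of x] x by (simp add: p_def)
      moreover have "Gx p * (t - x) + Gy p * (\<gamma> t - \<gamma> x) = Gy p * (\<gamma> t - \<gamma> x - D * (t - x))"
      proof -
        have "Gy p * D = - Gx p" using Gy by (simp add: D_def)
        moreover have "Gy p * (\<gamma> t - \<gamma> x - D * (t - x)) = Gy p * (\<gamma> t - \<gamma> x) - Gy p * D * (t - x)"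
          by (simp add: algebra_simps)
        ultimately show ?thesis by simp
      qed
      ultimately have "Gy p * \<bar>\<gamma> t - \<gamma> x - D * (t - x)\<bar> \<le> \<epsilon> * \<bar>t - x\<bar>"
        using Gy by (simp add: abs_mult)
      moreover have "1 * \<bar>\<gamma> t - \<gamma> x - D * (t - x)\<bar> \<le> Gy p * \<bar>\<gamma> t - \<gamma> x - D * (t - x)\<bar>"
        using Gy by (intro mult_right_mono) auto
      ultimately show ?case by simp
    qed
  qed
  then show ?thesis by (simp add: has_field_derivative_def D_def p_def)
qed

lemma \<gamma>_C1: "\<gamma> C1_differentiable_on interior {0..\<xi>}"
  unfolding C1_differentiable_on_def interior_atLeastAtMost_real
proof (intro exI conjI ballI)
  show "(\<gamma> has_vector_derivative - Gx (x, \<gamma> x) / Gy (x, \<gamma> x)) (at x)" if "x \<in> {0<..<\<xi>}" for x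
    using \<gamma>_has_derivative that by (simp flip: has_real_derivative_iff_has_vector_derivative)
  have "continuous_on {0<..<\<xi>} \<gamma>"
    by (rule DERIV_continuous_on[where D = "\<lambda>x. - Gx (x, \<gamma> x) / Gy (x, \<gamma> x)"])
      (use \<gamma>_has_derivative in \<open>auto intro: has_field_derivative_at_within\<close>)
  then have S: "continuous_on {0<..<\<xi>} (\<lambda>x. S (x, \<gamma> x))"
    by (intro continuous_on_S continuous_intros)
  have "Gy (x, \<gamma> x) \<noteq> 0" if "x \<in> {0<..<\<xi>}" for x
    using Gy_ge[of "(x, \<gamma> x)"] \<gamma>_nonneg[of x] that by (auto simp: pair_in_Q)
  then show "continuous_on {0<..<\<xi>} (\<lambda>x. - Gx (x, \<gamma> x) / Gy (x, \<gamma> x))"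
    unfolding Gx_def Gy_def
    by (intro continuous_intros continuous_on_compose2[OF continuous_dv[OF coord_x] S]
        continuous_on_compose2[OF continuous_dv[OF coord_y] S])
      (use \<gamma>_nonneg in \<open>auto intro!: S_in_Q simp: pair_in_Q\<close>)
qed

lemma \<gamma>_derivative_at_half_thr: "(\<gamma> has_real_derivative - 1) (at (thr / 2))"
proof -
  define p where "p = (thr / 2, thr / 2)"
  have p: "p \<in> Q" using const_pos by (simp add: p_def pair_in_Q)
  have "v (S p) = 0"
  proof (rule goodD(6)[OF good_v S_in_Q[OF p]])
    show "0 \<le> g ((S ^^ j) (S p))" for j
      using g_jumps_nonneg[OF p, of "Suc j"] by (simp add: p_def funpow_Suc_right del: funpow.simps)
  qed
  then have "0 \<le> Gv (S p)" using v_eq_0_iff[OF S_in_Q[OF p]] by simp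
  then have "Gx p = 1" "Gy p = 1"
    using dv_eq_0[OF S_in_Q[OF p] coord_x] dv_eq_0[OF S_in_Q[OF p] coord_y] by (auto simp: Gx_def Gy_def)
  moreover have "\<gamma> (thr / 2) = thr / 2" using \<gamma>_near_axis[of "thr / 2"] const_pos by simp
  ultimately show ?thesis
    using \<gamma>_has_derivative[of "thr / 2"] \<xi>_gt const_pos unfolding p_def by (simp del: eq_divide_eq_numeral1)
qed

lemma half_thr: "lam * sqrt 2 / (2 * c) = thr / 2"
  by (simp add: thr_def)

lemma a0_eq: "a0 lam c x = thr - x"
  by (simp add: a0_def thr_def)

lemma \<gamma>_smooth_fit: "fits_smoothly_at \<gamma> (a0 lam c) (lam * sqrt 2 / (2 * c))"
  unfolding fits_smoothly_at_def half_thr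
proof
  show "\<gamma> (thr / 2) = a0 lam c (thr / 2)"
    using \<gamma>_near_axis[of "thr / 2"] const_pos by (simp add: a0_eq)
  have "(a0 lam c has_real_derivative - 1) (at (thr / 2))"
    unfolding a0_eq[abs_def] by (auto intro!: derivative_eq_intros)
  then show "\<exists>D. (\<gamma> has_real_derivative D) (at (thr / 2)) \<and> (a0 lam c has_real_derivative D) (at (thr / 2))"
    using \<gamma>_derivative_at_half_thr by blast
qed

lemma boundary_curve_subset: "boundary_curve \<gamma> \<subseteq> \<Gamma>"
proof
  fix q assume "q \<in> boundary_curve \<gamma>"
  then obtain x where "q = (x, \<gamma> x)" "0 \<le> x" by (auto simp: boundary_curve_def)
  then show "q \<in> \<Gamma>" using Gv_\<gamma>_nonneg[of x] \<gamma>_nonneg[of x] by (simp add: \<Gamma>_iff pair_in_Q)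
qed

section \<open>The fixed point solves the variational inequalities\<close>

lemma v_admissible: "admissible (boundary_curve \<gamma>) v"
  unfolding admissible_def
proof (intro conjI ballI)
  show "bounded (v ` Q)"
    by (rule bounded_subset[OF bounded_closed_interval[of "- bnd" 0]]) (simp add: image_subset_iff v_ge v_le)
  show "continuous_on Q v" by (rule good_continuous[OF good_v])
  show "v p \<le> 0" if "p \<in> Q" for p using v_le[OF that] .
  show "C1_on_quadrant_part (Q - boundary_curve \<gamma>) v"
    unfolding C1_on_quadrant_part_def
    by (intro exI[of _ v_deriv] conjI ballI v_has_derivative continuous_on_subset[OF continuous_on_v_deriv]) auto
  have *: "\<bar>D0 v q\<bar> \<le> lip" "\<bar>D1 v q\<bar> \<le> lip" if "q \<in> Q" for q
    unfolding partial_derivatives_eq[OF that v_has_derivative[OF that]]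
    using dv_bounds[OF that coord_x] dv_bounds[OF that coord_y] slope_le_lip[OF coord_x] slope_le_lip[OF coord_y]
    by (simp_all add: v_deriv_apply)
  show "\<exists>\<epsilon>>0. \<exists>K. \<forall>q\<in>(Q - boundary_curve \<gamma>) \<inter> ball p \<epsilon>. \<bar>D0 v q\<bar> \<le> K \<and> \<bar>D1 v q\<bar> \<le> K" for p
    by (intro exI[of _ 1] exI[of _ lip] conjI[OF zero_less_one] ballI conjI *) simp_all
qed

text \<open>The right-hand side of \<open>dynamic_programming\<close> does not depend on h, so its
  one-sided derivative at h = 0 is zero; written out, that is the equation.\<close>

lemma v_generator_continuation:
  assumes p: "p \<in> Q" and G: "Gv p < 0"
  shows "generator lam \<mu> m v p - lam * v p + g p = 0"
proof -
  have "((\<lambda>h. integral {0..h} (integrand v p)) has_vector_derivative integrand v p 0) (at 0 within {0..1})"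
    by (rule integral_has_vector_derivative[OF continuous_on_integrand[OF good_v p]]) auto
  moreover have "((\<lambda>h. exp (- kap * h)) has_vector_derivative - kap) (at 0 within {0..1})"
    unfolding has_real_derivative_iff_has_vector_derivative[symmetric]
    by (auto intro!: derivative_eq_intros)
  moreover have "((\<lambda>h. v (F h p)) has_vector_derivative v_deriv (F 0 p) (drift (F 0 p))) (at 0 within {0..1})"
    by (rule derivative_along_flow[OF p _ _ v_has_derivative]) (use p in auto)
  ultimately have "((\<lambda>h. integral {0..h} (integrand v p) + exp (- kap * h) * v (F h p)) has_vector_derivative
      integrand v p 0 + (exp (- kap * 0) * v_deriv (F 0 p) (drift (F 0 p)) + - kap * v (F 0 p))) (at 0 within {0..1})"
    by (intro has_vector_derivative_add has_vector_derivative_mult)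
  moreover have "((\<lambda>h. integral {0..h} (integrand v p) + exp (- kap * h) * v (F h p)) has_vector_derivative 0) (at 0 within {0..1})"
    by (rule has_vector_derivative_transform[OF _ _ has_vector_derivative_const[of "v p"]])
      (use dynamic_programming[OF p] in auto)
  ultimately have "integrand v p 0 + (exp (- kap * 0) * v_deriv (F 0 p) (drift (F 0 p)) + - kap * v (F 0 p)) = 0"
    using vector_derivative_unique_within_closed_interval[of 0 1 0] by simp
  then show ?thesis
    unfolding generator_eq[OF p v_has_derivative[OF p]] using G by simp
qed

text \<open>Over the support, a point of \<Gamma> off the curve lies strictly above it. To the right
  of \<xi> there is no curve, even on the axis, and strictness comes from the growth of
  \<open>Gv\<close> in x beyond \<xi>.\<close>

lemma Gv_pos_off_curve:
  assumes "p \<in> \<Gamma> - boundary_curve \<gamma>"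
  shows "0 < Gv p"
proof -
  obtain x y where p: "p = (x, y)" by (cases p)
  have xy: "0 \<le> x" "0 \<le> y" "\<gamma> x \<le> y"
    using assms \<gamma>_le_iff by (auto simp: p \<Gamma>_iff pair_in_Q)
  show ?thesis
  proof (cases "x \<le> \<xi>")
    case True
    then have "y \<noteq> \<gamma> x" using assms xy by (auto simp: p boundary_curve_def simp flip: \<xi>_def)
    then show ?thesis
      using Gv_mono_pair[of x "\<gamma> x" x y] Gv_\<gamma>_nonneg[of x] \<gamma>_nonneg[of x] xy p by simp
  next
    case False
    have "0 \<le> Gv (\<xi>, 0)"
      using \<xi>_le_iff[of \<xi>] \<gamma>_eq_0_iff[of \<xi>] \<xi>_gt const_pos by simp
    then show ?thesis
      using Gv_mono_pair[of \<xi> 0 x y] False \<xi>_gt const_pos xy p by simp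
  qed
qed

lemma v_solves: "solves_variational_inequalities lam \<mu> c m \<Gamma> (boundary_curve \<gamma>) v"
  unfolding solves_variational_inequalities_def
proof (intro conjI ballI)
  show "admissible (boundary_curve \<gamma>) v" by (rule v_admissible)
  show "generator lam \<mu> m v p - lam * v p + g p = 0" if "p \<in> Q - \<Gamma>" for p
    using v_generator_continuation[of p] that by (auto simp: \<Gamma>_iff)
  show "v p = 0" if "p \<in> \<Gamma>" for p using that v_eq_0_iff by (simp add: \<Gamma>_iff)
  show "v p < 0" if "p \<in> Q - \<Gamma>" for p using that v_neg_iff by (auto simp: \<Gamma>_iff)
  show "0 < generator lam \<mu> m v p - lam * v p + g p" if p: "p \<in> \<Gamma> - boundary_curve \<gamma>" for p
  proof -
    have pQ: "p \<in> Q" "0 \<le> Gv p" using p by (auto simp: \<Gamma>_iff)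
    then have "v p = 0" using v_eq_0_iff by simp
    \<comment> \<open>On \<Gamma> both \<open>v\<close> and its gradient vanish, so the expression
      is just \<open>Gv p\<close>.\<close>
    then show ?thesis
      unfolding generator_eq[OF pQ(1) v_has_derivative[OF pQ(1)]] v_deriv_apply
      using dv_eq_0[OF pQ(1) coord_x pQ(2)] dv_eq_0[OF pQ(1) coord_y pQ(2)] Gv_pos_off_curve[OF p] by simp
  qed
qed

section \<open>Uniqueness for the variational inequalities\<close>

lemma hitting_time:
  assumes p: "p \<in> Q" and G: "Gv p < 0"
  obtains r where "0 < r" "F r p \<in> \<Gamma>" "\<And>t. 0 \<le> t \<Longrightarrow> t < r \<Longrightarrow> F t p \<in> Q - \<Gamma>"
proof -
  have "0 \<le> Gv (F hor p)" by (rule G_flow_hor[OF good_v p order_refl])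
  then obtain r where r: "0 \<le> r" "r \<le> hor" "Gv (F r p) = 0"
    using IVT'[of "\<lambda>t. Gv (F t p)" 0 0 hor] continuous_on_G_flow[OF p] const_pos G by auto
  show ?thesis
  proof (rule that)
    show "0 < r" using r G by (cases "r = 0") auto
    show "F r p \<in> \<Gamma>" using r F_in_Q[OF p] by (simp add: \<Gamma>_iff)
    fix t assume t: "0 \<le> t" "t < r"
    \<comment> \<open>A nonnegative value of \<open>Gv\<close> before r would force a positive value
      at r, by the strict growth along the flow.\<close>
    have "b0 * (r - t) + min 0 (Gv (F t p)) \<le> Gv (F (r - t) (F t p))"
      using t by (intro G_flow_ge[OF good_v F_in_Q[OF p]]) auto
    then have "b0 * (r - t) + min 0 (Gv (F t p)) \<le> 0"
      using r(3) by (simp flip: F_add)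
    moreover have "0 < b0 * (r - t)" using const_pos t by simp
    ultimately show "F t p \<in> Q - \<Gamma>" using F_in_Q[OF p t(1)] by (auto simp: \<Gamma>_iff)
  qed
qed

lemma solution_differentiable:
  assumes "solves_variational_inequalities lam \<mu> c m \<Gamma> (boundary_curve \<gamma>) w"
  shows "\<exists>w'. \<forall>q\<in>Q - \<Gamma>. (w has_derivative blinfun_apply (w' q)) (at q within Q)"
proof -
  have "C1_on_quadrant_part (Q - boundary_curve \<gamma>) w"
    using assms by (simp add: solves_variational_inequalities_def admissible_def)
  then obtain w' where w': "\<forall>q\<in>Q - boundary_curve \<gamma>. (w has_derivative blinfun_apply (w' q)) (at q within Q)"
    unfolding C1_on_quadrant_part_def by blast
  show ?thesis
  proof (intro exI ballI)
    fix q assume "q \<in> Q - \<Gamma>"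
    then have "q \<in> Q - boundary_curve \<gamma>" using boundary_curve_subset by blast
    then show "(w has_derivative blinfun_apply (w' q)) (at q within Q)" using w' by (rule bspec[rotated])
  qed
qed

text \<open>Up to the hitting time of \<open>\<Gamma>\<close> the difference of two solutions is transported along the
  flow, with source \<open>\<mu>\<close> times its value after a jump; this makes its supremum norm contract by the
  factor \<open>\<mu> / kap\<close>.\<close>

lemma solution_difference_contracts:
  assumes w: "solves_variational_inequalities lam \<mu> c m \<Gamma> (boundary_curve \<gamma>) w"
    and z: "solves_variational_inequalities lam \<mu> c m \<Gamma> (boundary_curve \<gamma>) z"
    and M: "\<And>q. q \<in> Q \<Longrightarrow> w q - z q \<le> M" "0 \<le> M" and p: "p \<in> Q"
  shows "w p - z p \<le> \<mu> / kap * M"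
proof (cases "Gv p < 0")
  case False
  then have "w p = 0" "z p = 0"
    using w z p by (auto simp: solves_variational_inequalities_def \<Gamma>_iff)
  then show ?thesis using M const_pos mu_gt_1 by simp
next
  case True
  obtain r where r: "0 < r" "F r p \<in> \<Gamma>" "\<And>t. 0 \<le> t \<Longrightarrow> t < r \<Longrightarrow> F t p \<in> Q - \<Gamma>"
    using hitting_time[OF p True] by blast
  obtain w' where "\<forall>q\<in>Q - \<Gamma>. (w has_derivative blinfun_apply (w' q)) (at q within Q)"
    using solution_differentiable[OF w] by (elim exE) rule
  note w' = bspec[OF this]
  obtain z' where "\<forall>q\<in>Q - \<Gamma>. (z has_derivative blinfun_apply (z' q)) (at q within Q)"
    using solution_differentiable[OF z] by (elim exE) rule
  note z' = bspec[OF this]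
  define d where "d q = w q - z q" for q
  \<comment> \<open>The level \<open>\<mu> / kap * M\<close> balances the decay rate
    \<open>kap\<close> against the largest possible source \<mu> * M. Relative to it the weighted
    difference is nondecreasing, and it ends nonpositive because both solutions vanish on
    \<Gamma>.\<close>
  define \<psi> where "\<psi> t = exp (- kap * t) * (d (F t p) - \<mu> / kap * M)" for t
  have cont: "continuous_on {0..r} \<psi>"
  proof -
    have "continuous_on Q w" "continuous_on Q z"
      using w z by (auto simp: solves_variational_inequalities_def admissible_def)
    moreover have cF: "continuous_on {0..r} (\<lambda>t. F t p)"
      by (intro continuous_on_F continuous_intros)
    moreover have FQ: "(\<lambda>t. F t p) ` {0..r} \<subseteq> Q"
      using F_in_Q[OF p] by auto
    ultimately have "continuous_on {0..r} (\<lambda>t. w (F t p))" "continuous_on {0..r} (\<lambda>t. z (F t p))"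
      using continuous_on_compose2[OF _ cF FQ] by simp_all
    then show ?thesis
      unfolding \<psi>_def d_def by (intro continuous_intros)
  qed
  have deriv: "\<exists>y. (\<psi> has_real_derivative y) (at t) \<and> 0 \<le> y" if t: "0 < t" "t < r" for t
  proof -
    define q where "q = F t p"
    have q: "q \<in> Q - \<Gamma>" using r(3)[of t] t by (simp add: q_def)
    then have qQ: "q \<in> Q" by simp
    have "generator lam \<mu> m w q - lam * w q + g q = 0" "generator lam \<mu> m z q - lam * z q + g q = 0"
      using w z q by (auto simp: solves_variational_inequalities_def)
    then have eq: "w' q (drift q) - z' q (drift q) = kap * d q - \<mu> * d (S q)"
      unfolding generator_eq[OF qQ w'[OF q]] generator_eq[OF qQ z'[OF q]] d_def
      by (simp add: G_def algebra_simps)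
    have "((\<lambda>s. w (F s p)) has_vector_derivative w' q (drift q)) (at t within {0<..<r})"
      "((\<lambda>s. z (F s p)) has_vector_derivative z' q (drift q)) (at t within {0<..<r})"
      unfolding q_def by (rule derivative_along_flow[OF p] ; use t w' z' q in \<open>auto simp: q_def\<close>)+
    then have "((\<lambda>s. w (F s p)) has_real_derivative w' q (drift q)) (at t)"
      "((\<lambda>s. z (F s p)) has_real_derivative z' q (drift q)) (at t)"
      using t by (simp_all add: has_real_derivative_iff_has_vector_derivative at_within_open[of t "{0<..<r}"])
    then have "((\<lambda>s. d (F s p)) has_real_derivative kap * d q - \<mu> * d (S q)) (at t)"
      unfolding d_def by (auto intro!: derivative_eq_intros simp: eq[unfolded d_def, symmetric])
    then have "(\<psi> has_real_derivative exp (- kap * t) * (kap * d q - \<mu> * d (S q)) + - kap * exp (- kap * t) * (d q - \<mu> / kap * M)) (at t)"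
      unfolding \<psi>_def by (auto intro!: derivative_eq_intros simp: q_def)
    moreover have "exp (- kap * t) * (kap * d q - \<mu> * d (S q)) + - kap * exp (- kap * t) * (d q - \<mu> / kap * M)
        = exp (- kap * t) * (\<mu> * (M - d (S q)))"
      using const_pos by (simp add: field_simps)
    moreover have "0 \<le> exp (- kap * t) * (\<mu> * (M - d (S q)))"
      using M(1)[OF S_in_Q[OF qQ]] mu_gt_1 by (simp add: d_def)
    ultimately show ?thesis by auto
  qed
  have "\<psi> 0 \<le> \<psi> r"
    using r(1) deriv cont by (intro DERIV_nonneg_imp_increasing_open[of 0 r \<psi>]) auto
  also have "\<psi> r \<le> 0"
  proof -
    have "d (F r p) = 0"
      using w z r(2) by (simp add: solves_variational_inequalities_def d_def)
    then show ?thesis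
      using M(2) mu_gt_1 const_pos by (simp add: \<psi>_def mult_le_0_iff)
  qed
  finally show ?thesis by (simp add: \<psi>_def d_def)
qed

text \<open>Admissible functions are bounded, so the two differences start with a finite bound,
  which repeated contraction drives to zero.\<close>

lemma solution_unique:
  assumes w: "solves_variational_inequalities lam \<mu> c m \<Gamma> (boundary_curve \<gamma>) w"
    and p: "p \<in> Q"
  shows "w p = v p"
proof -
  have "bounded ((\<lambda>q. w q - v q) ` Q)"
    using w v_solves
    by (auto simp: solves_variational_inequalities_def admissible_def intro: bounded_minus_comp)
  then obtain K where K: "\<And>q. q \<in> Q \<Longrightarrow> \<bar>w q - v q\<bar> \<le> K"
    unfolding bounded_iff by auto
  define \<rho> where "\<rho> = \<mu> / kap"
  have \<rho>: "0 \<le> \<rho>" "\<rho> < 1" using mu_gt_1 lam_pos by (auto simp: \<rho>_def kap_def)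
  have K0: "0 \<le> K" using K[OF p] by simp
  have "\<forall>q\<in>Q. \<bar>w q - v q\<bar> \<le> \<rho> ^ n * K" for n
  proof (induction n)
    case (Suc n)
    have M: "0 \<le> \<rho> ^ n * K" using \<rho> K0 by simp
    have "w q - v q \<le> \<rho> * (\<rho> ^ n * K)" "v q - w q \<le> \<rho> * (\<rho> ^ n * K)" if q: "q \<in> Q" for q
      unfolding \<rho>_def
      by (rule solution_difference_contracts[OF w v_solves _ _ q] solution_difference_contracts[OF v_solves w _ _ q];
          use Suc M in \<open>force simp: abs_le_iff \<rho>_def simp del: split_paired_All\<close>)+
    then show ?case by (auto simp: abs_le_iff mult.assoc simp del: split_paired_All)
  qed (use K in simp)
  then have "\<bar>w p - v p\<bar> \<le> \<rho> ^ n * K" for n using p by blast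
  moreover have "(\<lambda>n. \<rho> ^ n * K) \<longlonglongrightarrow> 0 * K"
    using \<rho> by (intro tendsto_intros LIMSEQ_power_zero) auto
  ultimately have "\<bar>w p - v p\<bar> \<le> 0 * K"
    by (intro LIMSEQ_le_const) auto
  then show ?thesis by simp
qed

end

section \<open>Estimates along the flow\<close>

lemma exp_primitive_mono:
  assumes "a \<le> b" "0 \<le> t"
  shows "exp_primitive a t \<le> exp_primitive b t"
proof -
  define d where "d t = exp_primitive b t - exp_primitive a t" for t
  have "d 0 \<le> d t"
  proof (rule DERIV_nonneg_imp_nondecreasing[OF assms(2)])
    fix x :: real assume "0 \<le> x" "x \<le> t"
    then have "a * x \<le> b * x" using assms by (intro mult_right_mono)
    then have "0 \<le> exp (b * x) - exp (a * x)" by simp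
    moreover have "(d has_real_derivative exp (b * x) - exp (a * x)) (at x)"
      unfolding d_def by (intro DERIV_diff DERIV_exp_primitive)
    ultimately show "\<exists>y. (d has_real_derivative y) (at x) \<and> 0 \<le> y" by blast
  qed
  then show ?thesis by (simp add: d_def)
qed

context disorder
begin

text \<open>The constant absorbs the inhomogeneous terms of the flow: the rate of change of x + y is
  at most (lam + 1) (x + y) + b0 + b1, that is, lam + 1 times \<open>size_fun\<close>.\<close>

definition size_fun :: "real \<times> real \<Rightarrow> real" where
  "size_fun q = fst q + snd q + (b0 + b1) / (lam + 1)"

lemma size_fun_F:
  assumes q: "q \<in> Q" and t: "0 \<le> t"
  shows "size_fun (F t q) \<le> exp ((lam + 1) * t) * size_fun q"
proof -
  have "(lam - 1) * t \<le> (lam + 1) * t" using t by (intro mult_right_mono) auto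
  then have "exp ((lam - 1) * t) * snd q \<le> exp ((lam + 1) * t) * snd q"
    using q by (intro mult_right_mono) (auto simp: Q_iff)
  moreover have "b1 * exp_primitive (lam - 1) t \<le> b1 * exp_primitive (lam + 1) t"
    using t const_pos by (intro mult_left_mono exp_primitive_mono) auto
  moreover have "exp ((lam + 1) * t) * ((b0 + b1) / (lam + 1)) =
      (b0 + b1) / (lam + 1) + (b0 + b1) * exp_primitive (lam + 1) t"
  proof -
    have "(1 + k * e) * (b / k) = b / k + b * e" if "k \<noteq> 0" for k b e :: real
      using that by (simp add: field_simps)
    from this[of "lam + 1"] show ?thesis
      using lam_pos by (simp only: exp_primitive_eq[symmetric, of "lam + 1" t])
  qed
  ultimately show ?thesis
    unfolding size_fun_def F_eq fst_conv snd_conv distrib_left distrib_right by linarith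
qed

lemma mu_inverse: "0 < 1 / \<mu>" "1 / \<mu> < 1" "- 1 \<le> 1 / \<mu>"
proof -
  show "0 < 1 / \<mu>" "1 / \<mu> < 1" using mu_gt_1 by auto
  then show "- 1 \<le> 1 / \<mu>" by linarith
qed

lemma size_fun_S:
  assumes q: "q \<in> Q"
  shows "size_fun (S q) \<le> 2 * size_fun q"
proof -
  have "(1 - 1 / \<mu>) * fst q \<le> 2 * fst q" "(1 + 1 / \<mu>) * snd q \<le> 2 * snd q"
    using q mu_inverse by (auto intro!: mult_right_mono simp: Q_iff)
  moreover have "0 \<le> (b0 + b1) / (lam + 1)" using const_pos lam_pos by simp
  ultimately show ?thesis
    unfolding size_fun_def S_eq fst_conv snd_conv distrib_left by linarith
qed

lemma size_fun_nonneg: "q \<in> Q \<Longrightarrow> 0 \<le> size_fun q"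
  using const_pos lam_pos by (simp add: size_fun_def Q_iff)

lemma g_le_size_fun: "g q \<le> size_fun q"
proof -
  have "0 \<le> (b0 + b1) / (lam + 1)" using const_pos lam_pos by simp
  then show ?thesis using const_pos by (simp add: g_eq size_fun_def)
qed

lemma g_ge: "q \<in> Q \<Longrightarrow> - thr \<le> g q"
  by (simp add: g_eq Q_iff)

text \<open>Uniformity over the unbounded quadrant holds because the flow never leaves the region on
  which the functions in question vanish.\<close>

lemma flow_displacement:
  assumes X: "0 \<le> X"
  obtains C where "0 \<le> C" "\<And>q u. q \<in> Q \<Longrightarrow> fst q \<le> X \<Longrightarrow> snd q \<le> X \<Longrightarrow> 0 \<le> u \<Longrightarrow> u \<le> 1 \<Longrightarrow>
    \<bar>fst (F u q) - fst q\<bar> + \<bar>snd (F u q) - snd q\<bar> \<le> C * u"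
proof
  define C1 where "C1 = exp \<bar>lam + 1\<bar> * ((lam + 1) * X + b0)"
  define C2 where "C2 = exp \<bar>lam - 1\<bar> * (\<bar>lam - 1\<bar> * X + b1)"
  show "0 \<le> C1 + C2" using X lam_pos const_pos by (simp add: C1_def C2_def)
  fix q u assume q: "q \<in> Q" "fst q \<le> X" "snd q \<le> X" and u: "0 \<le> u" "u \<le> (1::real)"
  have "fst (F u q) - fst q = exp_primitive (lam + 1) u * ((lam + 1) * fst q + b0)"
    "snd (F u q) - snd q = exp_primitive (lam - 1) u * ((lam - 1) * snd q + b1)"
    using linear_ode_solution_diff[of "lam + 1" b0 "fst q" u] linear_ode_solution_diff[of "lam - 1" b1 "snd q" u]
    by (simp_all add: F_eq linear_ode_solution_eq)
  then have e: "\<bar>fst (F u q) - fst q\<bar> = exp_primitive (lam + 1) u * \<bar>(lam + 1) * fst q + b0\<bar>"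
    "\<bar>snd (F u q) - snd q\<bar> = exp_primitive (lam - 1) u * \<bar>(lam - 1) * snd q + b1\<bar>"
    using exp_primitive_nonneg[OF u(1)] by (simp_all add: abs_mult)
  have 1: "\<bar>(lam + 1) * fst q + b0\<bar> \<le> (lam + 1) * X + b0"
    using q lam_pos const_pos by (simp add: Q_iff)
  have "\<bar>(lam - 1) * snd q\<bar> \<le> \<bar>lam - 1\<bar> * X"
    using q unfolding abs_mult by (intro mult_left_mono) (auto simp: Q_iff)
  then have 2: "\<bar>(lam - 1) * snd q + b1\<bar> \<le> \<bar>lam - 1\<bar> * X + b1"
    using const_pos by linarith
  have "\<bar>fst (F u q) - fst q\<bar> \<le> (exp \<bar>lam + 1\<bar> * u) * ((lam + 1) * X + b0)"
    unfolding e using 1 exp_primitive_le[OF u] u by (intro mult_mono) auto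
  moreover have "\<bar>snd (F u q) - snd q\<bar> \<le> (exp \<bar>lam - 1\<bar> * u) * (\<bar>lam - 1\<bar> * X + b1)"
    unfolding e using 2 exp_primitive_le[OF u] u by (intro mult_mono) auto
  ultimately show "\<bar>fst (F u q) - fst q\<bar> + \<bar>snd (F u q) - snd q\<bar> \<le> (C1 + C2) * u"
    by (simp add: C1_def C2_def algebra_simps)
qed

lemma flow_modulus:
  assumes lip: "\<And>q r. q \<in> Q \<Longrightarrow> r \<in> Q \<Longrightarrow> \<bar>f r - f q\<bar> \<le> \<Lambda> * (\<bar>fst r - fst q\<bar> + \<bar>snd r - snd q\<bar>)"
    and zero: "\<And>q. q \<in> Q \<Longrightarrow> X \<le> fst q \<or> thr \<le> snd q \<Longrightarrow> f q = 0"
    and \<Lambda>: "0 \<le> \<Lambda>"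
  obtains C where "0 \<le> C" "\<And>q u. q \<in> Q \<Longrightarrow> 0 \<le> u \<Longrightarrow> u \<le> 1 \<Longrightarrow> \<bar>f (F u q) - f q\<bar> \<le> C * u"
proof -
  define Y where "Y = max X thr"
  have Y: "0 \<le> Y" using const_pos by (simp add: Y_def)
  obtain C where C: "0 \<le> C" "\<And>q u. q \<in> Q \<Longrightarrow> fst q \<le> Y \<Longrightarrow> snd q \<le> Y \<Longrightarrow> 0 \<le> u \<Longrightarrow> u \<le> 1 \<Longrightarrow>
    \<bar>fst (F u q) - fst q\<bar> + \<bar>snd (F u q) - snd q\<bar> \<le> C * u"
    using flow_displacement[OF Y] by blast
  show ?thesis
  proof (rule that)
    show "0 \<le> \<Lambda> * C" using \<Lambda> C(1) by simp
    fix q u assume q: "q \<in> Q" and u: "0 \<le> u" "u \<le> (1::real)"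
    show "\<bar>f (F u q) - f q\<bar> \<le> \<Lambda> * C * u"
    proof (cases "X \<le> fst q \<or> thr \<le> snd q")
      case True
      have "0 \<le> b0 * u" using const_pos u by simp
      then have "X \<le> fst (F u q) \<or> thr \<le> snd (F u q)"
        using True F_fst_ge[OF q u(1)] F_snd_ge[OF q u(1)] by linarith
      then show ?thesis using zero[OF q] zero[OF F_in_Q[OF q u(1)]] True \<Lambda> C(1) u by simp
    next
      case False
      then have "fst q \<le> Y" "snd q \<le> Y" by (auto simp: Y_def)
      then have "\<Lambda> * (\<bar>fst (F u q) - fst q\<bar> + \<bar>snd (F u q) - snd q\<bar>) \<le> \<Lambda> * (C * u)"
        by (intro mult_left_mono C(2) q u \<Lambda>)
      then show ?thesis using lip[OF q F_in_Q[OF q u(1)]] by simp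
    qed
  qed
qed

end

context disorder_value
begin

section \<open>Short-time estimates for the fixed point along the flow and across a jump\<close>

definition mneg :: "real \<times> real \<Rightarrow> real" where "mneg q = min 0 (Gv q)"

text \<open>With the bounded running cost \<open>ell\<close>, which lies below \<open>g\<close>, the value process is a
  martingale even inside the stopping region, so one estimate serves all stopping times.\<close>

definition ell :: "real \<times> real \<Rightarrow> real" where "ell q = mneg q - \<mu> * v (S q)"

text \<open>\<open>ell\<close> is the minimum of the cost and \<open>- \<mu> * v (S q)\<close>. On
  \<Gamma> the value changes only through jumps that leave \<Gamma>, and the second expression
  compensates exactly these.\<close>

lemma ell_le_g: "ell q \<le> g q"
  by (simp add: ell_def mneg_def G_def)

lemma ell_eq_g: "Gv q < 0 \<Longrightarrow> ell q = g q"
  by (simp add: ell_def mneg_def G_def)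

definition ellbd :: real where "ellbd = cap + \<mu> * bnd"

lemma ellbd_pos: "0 < ellbd"
  using const_pos mu_gt_1 by (simp add: ellbd_def add_pos_pos)

lemma ell_bound: "q \<in> Q \<Longrightarrow> \<bar>ell q\<bar> \<le> ellbd"
proof -
  assume q: "q \<in> Q"
  have "\<mu> * - bnd \<le> \<mu> * v (S q)" "\<mu> * v (S q) \<le> 0"
    using v_ge[OF S_in_Q[OF q]] v_le[OF S_in_Q[OF q]] mu_gt_1 mult_left_mono[of "- bnd" "v (S q)" \<mu>]
    by (auto simp: mult_le_0_iff)
  then show ?thesis
    using min_G_bounds[OF good_v q] const_pos
    unfolding ell_def mneg_def ellbd_def abs_le_iff by linarith
qed

lemma v_bound: "q \<in> Q \<Longrightarrow> \<bar>v q\<bar> \<le> bnd"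
  using v_ge[of q] v_le[of q] by simp

lemma Gv_nonneg_far:
  assumes "q \<in> Q" "cap \<le> fst q \<or> thr \<le> snd q"
  shows "0 \<le> Gv q"
  using G_ge(3)[OF good_v assms(1)] G_above_thr[OF good_v assms(1)] assms by (auto simp: Q_iff)

lemma v_flow_modulus:
  obtains C where "0 \<le> C" "\<And>q u. q \<in> Q \<Longrightarrow> 0 \<le> u \<Longrightarrow> u \<le> 1 \<Longrightarrow> \<bar>v (F u q) - v q\<bar> \<le> C * u"
proof (rule flow_modulus[of v lip cap])
  show "v q = 0" if "q \<in> Q" "cap \<le> fst q \<or> thr \<le> snd q" for q
    using Gv_nonneg_far[OF that] v_eq_0_iff[OF that(1)] by simp
qed (use good_lip[OF good_v] lip_pos that in auto)

lemma v_S_lip: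
  assumes "q \<in> Q" "r \<in> Q"
  shows "\<bar>v (S r) - v (S q)\<bar> \<le> 2 * lip * (\<bar>fst r - fst q\<bar> + \<bar>snd r - snd q\<bar>)"
proof -
  have "\<bar>v (S r) - v (S q)\<bar> \<le> lip * (\<bar>fst (S r) - fst (S q)\<bar> + \<bar>snd (S r) - snd (S q)\<bar>)"
    by (intro good_lip[OF good_v] S_in_Q assms)
  also have "\<dots> \<le> lip * (2 * \<bar>fst r - fst q\<bar> + 2 * \<bar>snd r - snd q\<bar>)"
  proof (intro mult_left_mono add_mono)
    show "\<bar>fst (S r) - fst (S q)\<bar> \<le> 2 * \<bar>fst r - fst q\<bar>" "\<bar>snd (S r) - snd (S q)\<bar> \<le> 2 * \<bar>snd r - snd q\<bar>"
      unfolding S_eq fst_conv snd_conv right_diff_distrib[symmetric] abs_mult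
      using mu_inverse by (auto intro!: mult_right_mono simp: abs_le_iff)
  qed (use lip_pos in simp)
  finally show ?thesis by (simp add: algebra_simps)
qed

lemma v_S_flow_modulus:
  obtains C where "0 \<le> C" "\<And>q u. q \<in> Q \<Longrightarrow> 0 \<le> u \<Longrightarrow> u \<le> 1 \<Longrightarrow> \<bar>v (S (F u q)) - v (S q)\<bar> \<le> C * u"
\<comment> \<open>A jump shrinks x by 1 - 1 / \<mu>, so x must exceed \<open>cap\<close> by the
  inverse factor for the point after the jump to be beyond \<open>cap\<close>.\<close>
proof (rule flow_modulus[of "\<lambda>q. v (S q)" "2 * lip" "cap / (1 - 1 / \<mu>)"])
  show "v (S q) = 0" if q: "q \<in> Q" "cap / (1 - 1 / \<mu>) \<le> fst q \<or> thr \<le> snd q" for q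
  proof -
    have "0 < 1 - 1 / \<mu>" using mu_gt_1 by simp
    then have "cap \<le> fst (S q) \<or> thr \<le> snd (S q)"
      using q(2) mult_right_mono[of 1 "1 + 1 / \<mu>" "snd q"] q(1) mu_gt_1
      by (auto simp: S_eq Q_iff pos_divide_le_eq mult.commute)
    then show ?thesis
      using Gv_nonneg_far[OF S_in_Q[OF q(1)]] v_eq_0_iff[OF S_in_Q[OF q(1)]] by simp
  qed
qed (use v_S_lip lip_pos that in auto)

lemma mneg_flow_modulus:
  obtains C where "0 \<le> C" "\<And>q u. q \<in> Q \<Longrightarrow> 0 \<le> u \<Longrightarrow> u \<le> 1 \<Longrightarrow> \<bar>mneg (F u q) - mneg q\<bar> \<le> C * u"
proof (rule flow_modulus[of mneg "1 + \<mu> * (2 * lip)" cap])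
  show "mneg q = 0" if "q \<in> Q" "cap \<le> fst q \<or> thr \<le> snd q" for q
    using Gv_nonneg_far[OF that] by (simp add: mneg_def)
  show "\<bar>mneg r - mneg q\<bar> \<le> (1 + \<mu> * (2 * lip)) * (\<bar>fst r - fst q\<bar> + \<bar>snd r - snd q\<bar>)"
    if q: "q \<in> Q" "r \<in> Q" for q r
  proof -
    have "\<bar>mneg r - mneg q\<bar> \<le> \<bar>Gv r - Gv q\<bar>" by (auto simp: mneg_def min_def)
    also have "Gv r - Gv q = (fst r - fst q) + (snd r - snd q) + \<mu> * (v (S r) - v (S q))"
      by (simp add: G_def g_eq algebra_simps)
    also have "\<bar>\<dots>\<bar> \<le> \<bar>fst r - fst q\<bar> + \<bar>snd r - snd q\<bar> + \<mu> * \<bar>v (S r) - v (S q)\<bar>"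
      using mu_gt_1 by (intro order_trans[OF abs_triangle_ineq] add_mono) (auto simp: abs_mult)
    also have "\<mu> * \<bar>v (S r) - v (S q)\<bar> \<le> \<mu> * (2 * lip * (\<bar>fst r - fst q\<bar> + \<bar>snd r - snd q\<bar>))"
      using mu_gt_1 by (intro mult_left_mono v_S_lip q) auto
    finally show ?thesis by (simp add: algebra_simps)
  qed
qed (use mu_gt_1 lip_pos that in auto)

lemma ell_flow_modulus:
  obtains C where "0 \<le> C" "\<And>q u. q \<in> Q \<Longrightarrow> 0 \<le> u \<Longrightarrow> u \<le> 1 \<Longrightarrow> \<bar>ell (F u q) - ell q\<bar> \<le> C * u"
proof -
  obtain C1 where C1: "0 \<le> C1" "\<And>q u. q \<in> Q \<Longrightarrow> 0 \<le> u \<Longrightarrow> u \<le> 1 \<Longrightarrow> \<bar>mneg (F u q) - mneg q\<bar> \<le> C1 * u"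
    using mneg_flow_modulus by blast
  obtain C2 where C2: "0 \<le> C2" "\<And>q u. q \<in> Q \<Longrightarrow> 0 \<le> u \<Longrightarrow> u \<le> 1 \<Longrightarrow> \<bar>v (S (F u q)) - v (S q)\<bar> \<le> C2 * u"
    using v_S_flow_modulus by blast
  show ?thesis
  proof (rule that)
    show "0 \<le> C1 + \<mu> * C2" using C1 C2 mu_gt_1 by simp
    fix q u assume q: "q \<in> Q" and u: "0 \<le> u" "u \<le> (1::real)"
    have "\<bar>\<mu> * (v (S (F u q)) - v (S q))\<bar> \<le> \<mu> * (C2 * u)"
      using C2(2)[OF q u] mu_gt_1 by (simp add: abs_mult)
    then show "\<bar>ell (F u q) - ell q\<bar> \<le> (C1 + \<mu> * C2) * u"
      using C1(2)[OF q u] by (simp add: ell_def abs_le_iff algebra_simps)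
  qed
qed

lemma exp_minus_bounds:
  assumes "0 \<le> (x::real)"
  shows "0 \<le> 1 - exp (- x)" "1 - exp (- x) \<le> x"
  using assms exp_ge_add_one_self[of "- x"] by auto

text \<open>Lets the unknown jump time inside a step be forgotten: the error is of order h, and as a
  jump has probability of order h the contribution to an expectation is of order
  \<open>h\<^sup>2\<close>.\<close>

lemma one_jump_modulus:
  obtains C where "0 \<le> C" "\<And>q u h. q \<in> Q \<Longrightarrow> 0 \<le> u \<Longrightarrow> u \<le> h \<Longrightarrow> h \<le> 1 \<Longrightarrow>
    \<bar>v (F (h - u) (S (F u q))) - v (S q)\<bar> \<le> C * h"
proof -
  obtain C1 where C1: "0 \<le> C1" "\<And>q u. q \<in> Q \<Longrightarrow> 0 \<le> u \<Longrightarrow> u \<le> 1 \<Longrightarrow> \<bar>v (F u q) - v q\<bar> \<le> C1 * u"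
    using v_flow_modulus by blast
  obtain C2 where C2: "0 \<le> C2" "\<And>q u. q \<in> Q \<Longrightarrow> 0 \<le> u \<Longrightarrow> u \<le> 1 \<Longrightarrow> \<bar>v (S (F u q)) - v (S q)\<bar> \<le> C2 * u"
    using v_S_flow_modulus by blast
  show ?thesis
  proof (rule that)
    show "0 \<le> C1 + C2" using C1 C2 by simp
    fix q u h assume q: "q \<in> Q" and u: "0 \<le> u" "u \<le> h" "h \<le> (1::real)"
    have "\<bar>v (F (h - u) (S (F u q))) - v (S (F u q))\<bar> \<le> C1 * (h - u)"
      using u by (intro C1(2) S_in_Q F_in_Q q) auto
    moreover have "\<bar>v (S (F u q)) - v (S q)\<bar> \<le> C2 * u"
      using u by (intro C2(2) q) auto
    moreover have "C1 * (h - u) \<le> C1 * h" "C2 * u \<le> C2 * h"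
      using C1(1) C2(1) u by (auto intro: mult_left_mono)
    ultimately show "\<bar>v (F (h - u) (S (F u q))) - v (S q)\<bar> \<le> (C1 + C2) * h"
      by (simp add: distrib_right)
  qed
qed

lemma dynamic_programming_approx:
  obtains C where "0 \<le> C" "\<And>q h. q \<in> Q \<Longrightarrow> 0 \<le> h \<Longrightarrow> h \<le> 1 \<Longrightarrow>
    \<bar>exp (- kap * h) * v (F h q) - v q + h * mneg q\<bar> \<le> C * h\<^sup>2"
proof -
  obtain C1 where C1: "0 \<le> C1" "\<And>q u. q \<in> Q \<Longrightarrow> 0 \<le> u \<Longrightarrow> u \<le> 1 \<Longrightarrow> \<bar>mneg (F u q) - mneg q\<bar> \<le> C1 * u"
    using mneg_flow_modulus by blast
  \<comment> \<open>C1 accounts for the change of \<open>mneg\<close> along the flow,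
    \<open>kap * cap\<close> for replacing the weight \<open>exp (- kap * t)\<close> by 1.\<close>
  define C where "C = C1 + kap * cap"
  show ?thesis
  proof (rule that)
    show C0: "0 \<le> C" using C1 const_pos by (simp add: C_def)
    fix q h assume q: "q \<in> Q" and h: "0 \<le> h" "h \<le> (1::real)"
    have "exp (- kap * h) * v (F h q) - v q + h * mneg q = - (integral {0..h} (integrand v q) - integral {0..h} (\<lambda>_. mneg q))"
      using dynamic_programming[OF q h(1)] h by simp
    also have "integral {0..h} (integrand v q) - integral {0..h} (\<lambda>_. mneg q) = integral {0..h} (\<lambda>t. integrand v q t - mneg q)"
      by (intro integral_diff[symmetric] integrable_integrand[OF good_v q] integrable_const_ivl) simp
    finally have "\<bar>exp (- kap * h) * v (F h q) - v q + h * mneg q\<bar> =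
        norm (integral {0..h} (\<lambda>t. integrand v q t - mneg q))" by simp
    also have "\<dots> \<le> integral {0..h} (\<lambda>_. C * h)"
    proof (rule integral_norm_bound_integral)
      show "(\<lambda>t. integrand v q t - mneg q) integrable_on {0..h}"
        by (intro integrable_diff integrable_integrand[OF good_v q] integrable_const_ivl) simp
      show "(\<lambda>_. C * h) integrable_on {0..h}" by (rule integrable_const_ivl)
      fix t assume t: "t \<in> {0..h}"
      define m' where "m' = min 0 (Gv (F t q))"
      have m': "\<bar>m'\<bar> \<le> cap"
        using min_G_bounds[OF good_v F_in_Q[OF q], of t] t const_pos by (simp add: m'_def abs_le_iff)
      have "\<bar>m' - mneg q\<bar> \<le> C1 * t"
        using C1(2)[OF q, of t] t h by (simp add: mneg_def m'_def)
      moreover have "\<bar>(1 - exp (- (kap * t))) * m'\<bar> \<le> (kap * t) * cap"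
        unfolding abs_mult using exp_minus_bounds[of "kap * t"] t const_pos m'
        by (intro mult_mono) auto
      moreover have "C1 * t + kap * t * cap \<le> C * h"
        using mult_left_mono[of t h C] C0 t by (simp add: C_def algebra_simps)
      moreover have "integrand v q t - mneg q = (m' - mneg q) - (1 - exp (- (kap * t))) * m'"
        by (simp add: m'_def algebra_simps)
      ultimately show "norm (integrand v q t - mneg q) \<le> C * h"
        unfolding real_norm_def by linarith
    qed
    also have "\<dots> = C * h\<^sup>2" using h by (simp add: power2_eq_square)
    finally show "\<bar>exp (- kap * h) * v (F h q) - v q + h * mneg q\<bar> \<le> C * h\<^sup>2" .
  qed
qed

end

section \<open>The paths of the process\<close>

lemma borel_measurable_exp_primitive [measurable]:
  "f \<in> borel_measurable M \<Longrightarrow> (\<lambda>x. exp_primitive a (f x)) \<in> borel_measurable M"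
  by (rule measurable_compose[of f M borel "exp_primitive a" borel])
    (simp_all add: borel_measurable_continuous_onI continuous_on_exp_primitive[OF continuous_on_id])

lemma borel_measurable_components:
  fixes h :: "'b \<Rightarrow> real \<times> real"
  assumes "h \<in> borel_measurable K"
  shows "(\<lambda>x. fst (h x)) \<in> borel_measurable K" "(\<lambda>x. snd (h x)) \<in> borel_measurable K"
  by (rule measurable_compose[OF assms borel_measurable_continuous_onI],
      intro continuous_on_fst continuous_on_snd continuous_on_id)+

locale disorder_process = disorder_value lam \<mu> c m v + prob_space M
  for lam \<mu> c m v and M :: "'a measure" +
  fixes N :: "real \<Rightarrow> 'a \<Rightarrow> nat" and \<sigma> :: "nat \<Rightarrow> 'a \<Rightarrow> real" and p0 :: "real \<times> real"
  assumes poisson: "poisson_process M \<mu> N" and jumps: "jump_times M N \<sigma>" and p0: "p0 \<in> Q"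
begin

section \<open>Jump counts, and the path between and across jumps\<close>

definition path :: "real \<Rightarrow> 'a \<Rightarrow> real \<times> real" where
  "path t w = Phi lam \<mu> m (\<lambda>n. \<sigma> n w) p0 t"

abbreviation at_jump :: "(nat \<Rightarrow> real) \<Rightarrow> nat \<Rightarrow> real \<times> real" where
  "at_jump s n \<equiv> Phi_at_jump lam \<mu> m s p0 n"

lemma \<sigma>_0: "w \<in> space M \<Longrightarrow> \<sigma> 0 w = 0"
  and \<sigma>_mono: "w \<in> space M \<Longrightarrow> strict_mono (\<lambda>n. \<sigma> n w)"
  and \<sigma>_at_top: "w \<in> space M \<Longrightarrow> filterlim (\<lambda>n. \<sigma> n w) at_top sequentially"
  and N_eq_card: "w \<in> space M \<Longrightarrow> 0 \<le> t \<Longrightarrow> N t w = card {n. 1 \<le> n \<and> \<sigma> n w \<le> t}"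
  using jumps unfolding jump_times_def by blast+

lemma \<sigma>_less_iff: "w \<in> space M \<Longrightarrow> \<sigma> k w < \<sigma> n w \<longleftrightarrow> k < n"
  using strict_mono_less[OF \<sigma>_mono] by blast

lemma \<sigma>_le_iff: "w \<in> space M \<Longrightarrow> \<sigma> k w \<le> \<sigma> n w \<longleftrightarrow> k \<le> n"
  using strict_mono_less_eq[OF \<sigma>_mono] by blast

text \<open>Turns the cardinality into an order relation: the jump times up to t form an initial
  segment, finite since they diverge, and \<open>N t\<close> is its largest index.\<close>

lemma count_iff:
  assumes w: "w \<in> space M" and t: "0 \<le> t"
  shows "n \<le> N t w \<longleftrightarrow> \<sigma> n w \<le> t"
proof -
  obtain n0 where n0: "t < \<sigma> n0 w"
    using \<sigma>_at_top[OF w] unfolding filterlim_at_top_dense eventually_sequentially by blast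
  have bound: "k < n0" if "\<sigma> k w \<le> t" for k
    using that n0 \<sigma>_less_iff[OF w, of k n0] by simp
  define k where "k = (GREATEST k. \<sigma> k w \<le> t)"
  have k: "\<sigma> k w \<le> t"
    unfolding k_def by (rule GreatestI_nat[where b = n0 and k = 0]) (use \<sigma>_0[OF w] t bound less_imp_le in auto)
  have max: "j \<le> k" if "\<sigma> j w \<le> t" for j
    unfolding k_def by (rule Greatest_le_nat[where b = n0]) (use that bound less_imp_le in auto)
  have iff: "\<sigma> j w \<le> t \<longleftrightarrow> j \<le> k" for j
    using max k \<sigma>_le_iff[OF w, of j k] by (meson order_trans)
  have "{n. 1 \<le> n \<and> \<sigma> n w \<le> t} = {1..k}"
    by (auto simp: iff)
  then have "N t w = k"
    using N_eq_card[OF w t] by simp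
  then show ?thesis by (simp add: iff)
qed

lemma N_eq_iff:
  assumes w: "w \<in> space M" and t: "0 \<le> t"
  shows "N t w = n \<longleftrightarrow> \<sigma> n w \<le> t \<and> t < \<sigma> (Suc n) w"
  using count_iff[OF assms, of n] count_iff[OF assms, of "Suc n"] by linarith

lemma N_interval:
  assumes "w \<in> space M" "0 \<le> t"
  shows "\<sigma> (N t w) w \<le> t" "t < \<sigma> (Suc (N t w)) w"
  using N_eq_iff[OF assms] by blast+

lemma N_mono:
  assumes "w \<in> space M" "0 \<le> s" "s \<le> t"
  shows "N s w \<le> N t w"
  using count_iff[of w t "N s w"] N_interval(1)[of w s] assms by simp

lemma N_0: "w \<in> space M \<Longrightarrow> N 0 w = 0"
  using poisson by (simp add: poisson_process_def)

lemma path_eq: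
  assumes "w \<in> space M" "0 \<le> t" "N t w = n"
  shows "path t w = F (t - \<sigma> n w) (at_jump (\<lambda>n. \<sigma> n w) n)"
  unfolding path_def
  by (rule Phi_between_jumps[OF \<sigma>_mono[OF assms(1)]])
    (use N_eq_iff[OF assms(1,2), of n] assms(3) in simp_all)

lemma at_jump_in_Q:
  assumes "w \<in> space M"
  shows "at_jump (\<lambda>n. \<sigma> n w) n \<in> Q"
proof (induction n)
  case (Suc n)
  have "0 \<le> \<sigma> (Suc n) w - \<sigma> n w" using \<sigma>_le_iff[OF assms, of n "Suc n"] by simp
  then show ?case using Suc by (simp add: S_in_Q F_in_Q)
qed (simp add: p0)

lemma path_in_Q:
  assumes "w \<in> space M" "0 \<le> t"
  shows "path t w \<in> Q"
  unfolding path_eq[OF assms refl]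
  using N_interval(1)[OF assms] by (intro F_in_Q at_jump_in_Q assms) simp

lemma path_0:
  assumes "w \<in> space M"
  shows "path 0 w = p0"
  using path_eq[OF assms order_refl N_0[OF assms]] \<sigma>_0[OF assms] by simp

lemma path_no_jump:
  assumes w: "w \<in> space M" and t: "0 \<le> t" "0 \<le> h" and N: "N (t + h) w = N t w"
  shows "path (t + h) w = F h (path t w)"
proof -
  have "0 \<le> t + h" using t by simp
  then have "path (t + h) w = F ((t - \<sigma> (N t w) w) + h) (at_jump (\<lambda>n. \<sigma> n w) (N t w))"
    using path_eq[OF w _ N] by (simp add: algebra_simps)
  then show ?thesis
    unfolding F_add path_eq[OF w t(1) refl] .
qed

lemma path_one_jump:
  assumes w: "w \<in> space M" and t: "0 \<le> t" "0 \<le> h" and N: "N (t + h) w = Suc (N t w)"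
  obtains u where "0 \<le> u" "u \<le> h" "path (t + h) w = F (h - u) (S (F u (path t w)))"
proof
  define n where "n = N t w"
  define u where "u = \<sigma> (Suc n) w - t"
  have th: "0 \<le> t + h" using t by simp
  show "0 \<le> u" using N_interval(2)[OF w t(1)] by (simp add: u_def n_def)
  show "u \<le> h" using N_interval(1)[OF w th] N by (simp add: u_def n_def)
  have "S (F u (path t w)) = S (F ((t - \<sigma> n w) + u) (at_jump (\<lambda>n. \<sigma> n w) n))"
    unfolding F_add n_def path_eq[OF w t(1) refl] ..
  also have "\<dots> = at_jump (\<lambda>n. \<sigma> n w) (Suc n)"
    by (simp add: u_def)
  finally show "path (t + h) w = F (h - u) (S (F u (path t w)))"
    using path_eq[OF w th N] by (simp add: u_def n_def algebra_simps)
qed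

text \<open>The flow expands \<open>size_fun\<close> at rate at most lam + 1 and a jump at most
  doubles it. The induction is on the number of jumps and removes the last one.\<close>

lemma path_growth:
  assumes w: "w \<in> space M" and t: "0 \<le> t" "t \<le> t'"
  shows "size_fun (path t' w) \<le> exp ((lam + 1) * (t' - t)) * 2 ^ (N t' w - N t w) * size_fun (path t w)"
  using t(2)
proof (induction "N t' w - N t w" arbitrary: t')
  case 0
  then have "N (t + (t' - t)) w = N t w"
    using N_mono[OF w t(1) 0(2)] by simp
  then have "path t' w = F (t' - t) (path t w)"
    using path_no_jump[OF w t(1), of "t' - t"] 0(2) by simp
  then show ?case
    using size_fun_F[OF path_in_Q[OF w t(1)], of "t' - t"] 0 by simp
next
  case (Suc k)
  define n where "n = N t w + k"
  have t': "0 \<le> t'" using t Suc by simp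
  have n: "N t' w = Suc n" using Suc(2) by (simp add: n_def)
  \<comment> \<open>A time from which exactly one jump remains up to t'; the maximum covers the case
    that no jump precedes it after t.\<close>
  define r where "r = max t (\<sigma> n w)"
  have sn: "\<sigma> n w < \<sigma> (Suc n) w" using \<sigma>_less_iff[OF w] by simp
  have tn: "t < \<sigma> (Suc n) w"
    using count_iff[OF w t(1), of "Suc n"] by (simp add: n_def not_le[symmetric])
  have st': "\<sigma> (Suc n) w \<le> t'" using count_iff[OF w t', of "Suc n"] n by simp
  have r: "0 \<le> r" "t \<le> r" "r \<le> t'" "N r w = n"
    using t(1) sn tn st' Suc(3) N_eq_iff[OF w, of r n] by (auto simp: r_def)
  have IH: "size_fun (path r w) \<le> exp ((lam + 1) * (r - t)) * 2 ^ k * size_fun (path t w)"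
    using Suc(1)[of r] r by (simp add: n_def)
  have "N (r + (t' - r)) w = Suc (N r w)" using r n by simp
  then obtain u where u: "0 \<le> u" "u \<le> t' - r" "path (r + (t' - r)) w = F (t' - r - u) (S (F u (path r w)))"
    using path_one_jump[OF w r(1), of "t' - r"] r by auto
  have rQ: "path r w \<in> Q" by (rule path_in_Q[OF w r(1)])
  have "size_fun (path t' w) = size_fun (F (t' - r - u) (S (F u (path r w))))" using u(3) by simp
  also have "\<dots> \<le> exp ((lam + 1) * (t' - r - u)) * size_fun (S (F u (path r w)))"
    using u by (intro size_fun_F S_in_Q F_in_Q rQ) auto
  also have "\<dots> \<le> exp ((lam + 1) * (t' - r - u)) * (2 * size_fun (F u (path r w)))"
    using u by (intro mult_left_mono size_fun_S F_in_Q rQ) auto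
  also have "\<dots> \<le> exp ((lam + 1) * (t' - r - u)) * (2 * (exp ((lam + 1) * u) * size_fun (path r w)))"
    using u by (intro mult_left_mono size_fun_F rQ) auto
  also have "\<dots> = (exp ((lam + 1) * (t' - r - u)) * exp ((lam + 1) * u)) * (2 * size_fun (path r w))"
    by simp
  also have "exp ((lam + 1) * (t' - r - u)) * exp ((lam + 1) * u) = exp ((lam + 1) * (t' - r))"
    by (simp flip: exp_add distrib_left)
  also have "exp ((lam + 1) * (t' - r)) * (2 * size_fun (path r w)) \<le>
      exp ((lam + 1) * (t' - r)) * (2 * (exp ((lam + 1) * (r - t)) * 2 ^ k * size_fun (path t w)))"
    by (intro mult_left_mono IH) auto
  also have "\<dots> = (exp ((lam + 1) * (t' - r)) * exp ((lam + 1) * (r - t))) * 2 ^ Suc k * size_fun (path t w)"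
    by simp
  also have "exp ((lam + 1) * (t' - r)) * exp ((lam + 1) * (r - t)) = exp ((lam + 1) * (t' - t))"
    by (simp flip: exp_add distrib_left)
  finally show ?case using Suc(2) by simp
qed

section \<open>Measurability of the path with respect to its past, and jointly in time\<close>

lemma N_measurable [measurable]: "0 \<le> t \<Longrightarrow> N t \<in> measurable M (count_space UNIV)"
  using poisson by (simp add: poisson_process_def)

definition hist :: "real \<Rightarrow> 'a measure" where
  "hist t = sigma (space M) (natural_generator M N (ennreal t))"

lemma natural_generator_sets: "natural_generator M N t \<subseteq> sets M"
  unfolding natural_generator_def using N_measurable by (auto intro: measurable_sets)

lemma natural_generator_Pow: "natural_generator M N t \<subseteq> Pow (space M)"
  unfolding natural_generator_def by auto

lemma space_hist [simp]: "space (hist t) = space M"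
  unfolding hist_def using natural_generator_Pow by (rule space_measure_of)

lemma sets_hist: "sets (hist t) = sigma_sets (space M) (natural_generator M N (ennreal t))"
  unfolding hist_def using natural_generator_Pow by (rule sets_measure_of)

lemma sets_hist_subset: "sets (hist t) \<subseteq> sets M"
  unfolding sets_hist using natural_generator_sets by (rule sets.sigma_sets_subset)

lemma N_hist:
  assumes "0 \<le> s" "s \<le> t"
  shows "N s \<in> measurable (hist t) (count_space UNIV)"
proof (rule measurableI)
  fix A :: "nat set"
  have "N s -` A \<inter> space M \<in> natural_generator M N (ennreal t)"
    unfolding natural_generator_def using assms by (auto intro: ennreal_leI)
  then show "N s -` A \<inter> space (hist t) \<in> sets (hist t)"
    by (simp add: sets_hist)
qed simp

lemma N_ge_sets_hist:
  assumes "0 \<le> s" "s \<le> t"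
  shows "{w \<in> space M. n \<le> N s w} \<in> sets (hist t)"
proof -
  have "N s -` {n..} \<inter> space (hist t) \<in> sets (hist t)"
    by (rule measurable_sets[OF N_hist[OF assms]]) simp
  also have "N s -` {n..} \<inter> space (hist t) = {w \<in> space M. n \<le> N s w}" by auto
  finally show ?thesis .
qed

text \<open>A jump time is not determined by the history up to t, but its minimum with t is, and the
  path at t depends on the jump times up to t only.\<close>

lemma \<sigma>_min_hist:
  assumes t: "0 \<le> t"
  shows "(\<lambda>w. min (\<sigma> n w) t) \<in> borel_measurable (hist t)"
  unfolding borel_measurable_iff_le
proof (intro allI)
  fix a :: real
  consider "t \<le> a" | "0 \<le> a" "a < t" | "a < 0" "a < t" using t by linarith
  then show "{w \<in> space (hist t). min (\<sigma> n w) t \<le> a} \<in> sets (hist t)"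
  proof cases
    case 1
    then have "{w \<in> space (hist t). min (\<sigma> n w) t \<le> a} = space (hist t)" by auto
    then show ?thesis by (simp only: sets.top)
  next
    case 2
    then have "{w \<in> space (hist t). min (\<sigma> n w) t \<le> a} = {w \<in> space M. n \<le> N a w}"
      using count_iff by auto
    then show ?thesis using N_ge_sets_hist[of a t n] 2 by simp
  next
    case 3
    have "0 \<le> \<sigma> n w" if "w \<in> space M" for w
      using \<sigma>_le_iff[OF that, of 0 n] \<sigma>_0[OF that] by simp
    then have "{w \<in> space (hist t). min (\<sigma> n w) t \<le> a} = {}"
      using 3 by force
    then show ?thesis by (simp only: sets.empty_sets)
  qed
qed

lemma \<sigma>_measurable [measurable]: "\<sigma> n \<in> borel_measurable M"
  unfolding borel_measurable_iff_le
proof (intro allI)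
  fix a :: real
  show "{w \<in> space M. \<sigma> n w \<le> a} \<in> sets M"
  proof (cases "0 \<le> a")
    case True
    then have "{w \<in> space M. \<sigma> n w \<le> a} = {w \<in> space M. n \<le> N a w}"
      using count_iff by auto
    then show ?thesis using N_ge_sets_hist[of a a n] True sets_hist_subset by auto
  next
    case False
    have "0 \<le> \<sigma> n w" if "w \<in> space M" for w
      using \<sigma>_le_iff[OF that, of 0 n] \<sigma>_0[OF that] by simp
    then have "{w \<in> space M. \<sigma> n w \<le> a} = {}"
      using False by force
    then show ?thesis by (simp only: sets.empty_sets)
  qed
qed

lemma F_measurable [measurable]:
  assumes [measurable]: "f \<in> borel_measurable K" "h \<in> borel_measurable K"
  shows "(\<lambda>x. F (f x) (h x)) \<in> borel_measurable K"
proof -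
  note [measurable] = borel_measurable_components[OF assms(2)]
  show ?thesis unfolding F_eq by (intro borel_measurable_Pair) measurable
qed

lemma S_measurable [measurable]:
  assumes [measurable]: "h \<in> borel_measurable K"
  shows "(\<lambda>x. S (h x)) \<in> borel_measurable K"
proof -
  note [measurable] = borel_measurable_components[OF assms]
  show ?thesis unfolding S_eq by (intro borel_measurable_Pair) measurable
qed

lemma at_jump_measurable:
  assumes [measurable]: "\<And>n. (\<lambda>x. s n x) \<in> borel_measurable K"
  shows "(\<lambda>x. at_jump (\<lambda>n. s n x) n) \<in> borel_measurable K"
proof (induction n)
  case (Suc n)
  note [measurable] = Suc
  show ?case unfolding Phi_at_jump.simps by measurable
qed simp

lemma at_jump_cong:
  assumes "\<And>k. k \<le> n \<Longrightarrow> s k = s' k"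
  shows "at_jump s n = at_jump s' n"
  using assms by (induction n) auto

lemma path_hist:
  assumes t: "0 \<le> t"
  shows "path t \<in> borel_measurable (hist t)"
proof -
  define s where "s n w = min (\<sigma> n w) t" for n w
  have s [measurable]: "(\<lambda>w. s n w) \<in> borel_measurable (hist t)" for n
    unfolding s_def by (rule \<sigma>_min_hist[OF t])
  have "(\<lambda>w. F (t - s (N t w) w) (at_jump (\<lambda>n. s n w) (N t w))) \<in> borel_measurable (hist t)"
  proof (rule measurable_compose_countable[OF _ N_hist[OF t order_refl]])
    show "(\<lambda>w. F (t - s n w) (at_jump (\<lambda>n. s n w) n)) \<in> borel_measurable (hist t)" for n
      using at_jump_measurable[of s "hist t" n, OF s] by measurable
  qed
  moreover have "F (t - s (N t w) w) (at_jump (\<lambda>n. s n w) (N t w)) = path t w" if "w \<in> space (hist t)" for w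
  proof -
    have w: "w \<in> space M" using that by simp
    have "s k w = \<sigma> k w" if "k \<le> N t w" for k
      using count_iff[OF w t] that by (simp add: s_def)
    then show ?thesis
      using path_eq[OF w t refl] at_jump_cong[of "N t w" "\<lambda>n. s n w" "\<lambda>n. \<sigma> n w"] by simp
  qed
  ultimately show ?thesis by (subst measurable_cong[symmetric]) auto
qed

text \<open>The truncation at 0 keeps the time in the range where \<open>N\<close> is described by
  the jump times.\<close>

lemma N_joint_measurable: "(\<lambda>x. N (max 0 (fst x)) (snd x)) \<in> measurable (borel \<Otimes>\<^sub>M M) (count_space UNIV)"
  unfolding measurable_count_space_eq2_countable
proof (intro conjI ballI)
  fix n
  have "(\<lambda>x. N (max 0 (fst x)) (snd x)) -` {n} \<inter> space (borel \<Otimes>\<^sub>M M) =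
      {x \<in> space (borel \<Otimes>\<^sub>M M). \<sigma> n (snd x) \<le> max 0 (fst x) \<and> max 0 (fst x) < \<sigma> (Suc n) (snd x)}"
  proof -
    have "N (max 0 t) w = n \<longleftrightarrow> \<sigma> n w \<le> max 0 t \<and> max 0 t < \<sigma> (Suc n) w" if "w \<in> space M" for t w
      by (rule N_eq_iff[OF that]) simp
    then show ?thesis
      by (intro set_eqI) (simp add: space_pair_measure mem_Times_iff conj_commute cong: conj_cong)
  qed
  also have "\<dots> \<in> sets (borel \<Otimes>\<^sub>M M)" by measurable
  finally show "(\<lambda>x. N (max 0 (fst x)) (snd x)) -` {n} \<inter> space (borel \<Otimes>\<^sub>M M) \<in> sets (borel \<Otimes>\<^sub>M M)" .
qed auto

lemma path_joint_measurable: "(\<lambda>x. path (max 0 (fst x)) (snd x)) \<in> borel_measurable (borel \<Otimes>\<^sub>M M)"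
proof -
  have "(\<lambda>x. F (max 0 (fst x) - \<sigma> (N (max 0 (fst x)) (snd x)) (snd x))
      (at_jump (\<lambda>n. \<sigma> n (snd x)) (N (max 0 (fst x)) (snd x)))) \<in> borel_measurable (borel \<Otimes>\<^sub>M M)"
  proof (rule measurable_compose_countable[OF _ N_joint_measurable])
    show "(\<lambda>x. F (max 0 (fst x) - \<sigma> n (snd x)) (at_jump (\<lambda>n. \<sigma> n (snd x)) n)) \<in> borel_measurable (borel \<Otimes>\<^sub>M M)" for n
      using at_jump_measurable[of "\<lambda>n x. \<sigma> n (snd x)" "borel \<Otimes>\<^sub>M M" n] by measurable
  qed
  then show ?thesis
    by (rule measurable_cong[THEN iffD1, rotated]) (simp add: space_pair_measure path_eq[OF _ _ refl] mem_Times_iff)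
qed

end

section \<open>Independence of the increments\<close>

text \<open>The definition of the Poisson process speaks of increments along strictly increasing
  sequences. A finite set of past times is listed as such a sequence and continued so that the step
  from t to t + h is the next increment.\<close>

lemma ex_strict_mono_grid:
  fixes J :: "real set"
  assumes J: "finite J" "0 \<in> J" "t \<in> J" "J \<subseteq> {0..t}" and h: "0 < h"
  obtains ts :: "nat \<Rightarrow> real" and n where
    "strict_mono ts" "ts 0 = 0" "ts n = t" "ts (Suc n) = t + h" "J = ts ` {..n}"
proof -
  define L where "L = sorted_list_of_set J"
  have L: "set L = J" "sorted_wrt (<) L"
    using J by (auto simp: L_def strict_sorted_list_of_set)
  then have ne: "L \<noteq> []" using J by auto
  define n where "n = length L - 1"
  have n: "length L = Suc n" using ne by (simp add: n_def)
  have less: "L ! i < L ! j" if "i < j" "j \<le> n" for i j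
    using sorted_wrt_nth_less[OF L(2), of i j] that n by simp
  have in_J: "L ! i \<in> J" if "i \<le> n" for i
    using L(1) n that nth_mem[of i L] by simp
  have 0: "L ! 0 = 0"
  proof -
    obtain i where i: "i \<le> n" "L ! i = 0" using L(1) J(2) n by (metis in_set_conv_nth less_Suc_eq_le)
    moreover have "0 \<le> L ! 0" using in_J[of 0] J(4) by auto
    ultimately show ?thesis using less[of 0 i] by (cases "i = 0") auto
  qed
  have t: "L ! n = t"
  proof -
    obtain i where i: "i \<le> n" "L ! i = t" using L(1) J(3) n by (metis in_set_conv_nth less_Suc_eq_le)
    moreover have "L ! n \<le> t" using in_J[of n] J(4) by auto
    ultimately show ?thesis using less[of i n] by (cases "i = n") auto
  qed
  define ts where "ts i = (if i \<le> n then L ! i else t + h * real (i - n))" for i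
  show ?thesis
  proof (rule that[of ts n])
    show "strict_mono ts"
      unfolding strict_mono_Suc_iff
    proof
      fix i
      consider "Suc i \<le> n" | "i = n" | "n < i" by linarith
      then show "ts i < ts (Suc i)"
      proof cases
        case 3
        then show ?thesis using h by (simp add: ts_def)
      qed (use less t h in \<open>auto simp: ts_def\<close>)
    qed
    show "ts 0 = 0" "ts n = t" "ts (Suc n) = t + h" using 0 t by (auto simp: ts_def)
    have "J = (\<lambda>i. L ! i) ` {..n}"
      using L(1) n by (auto simp: set_conv_nth image_def less_Suc_eq_le)
    also have "\<dots> = ts ` {..n}" by (intro image_cong) (auto simp: ts_def)
    finally show "J = ts ` {..n}" .
  qed
qed

context disorder_process
begin

text \<open>A cylinder is given by a reference outcome rather than by prescribed counts, so that two
  cylinders with a common point intersect in the cylinder through that point.\<close>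

definition cyl :: "real set \<Rightarrow> 'a \<Rightarrow> 'a set" where
  "cyl J w0 = {w \<in> space M. \<forall>s\<in>J. N s w = N s w0}"

definition inc :: "real \<Rightarrow> real \<Rightarrow> 'a \<Rightarrow> nat" where
  "inc t h w = N (t + h) w - N t w"

definition inc_event :: "real \<Rightarrow> real \<Rightarrow> nat set \<Rightarrow> 'a set" where
  "inc_event t h A = {w \<in> space M. inc t h w \<in> A}"

lemma inc_measurable [measurable]: "0 \<le> t \<Longrightarrow> 0 \<le> h \<Longrightarrow> inc t h \<in> measurable M (count_space UNIV)"
  unfolding inc_def by measurable

lemma inc_event_sets [measurable]: "0 \<le> t \<Longrightarrow> 0 \<le> h \<Longrightarrow> inc_event t h A \<in> sets M"
  unfolding inc_event_def by measurable

text \<open>Starting from N 0 = 0, counts and increments determine each other; monotonicity of the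
  counts is what lets the truncated subtraction of natural numbers be inverted.\<close>

lemma cyl_eq_increments:
  assumes ts: "strict_mono ts" "ts 0 = 0" "J = ts ` {..n}" and w0: "w0 \<in> space M"
  shows "cyl J w0 = {w \<in> space M. \<forall>i<n. N (ts (Suc i)) w - N (ts i) w = N (ts (Suc i)) w0 - N (ts i) w0}"
proof -
  have nn: "0 \<le> ts i" for i
    using ts(2) strict_mono_less_eq[OF ts(1), of 0 i] by simp
  have mono: "N (ts i) w \<le> N (ts (Suc i)) w" if "w \<in> space M" for i w
    using strict_mono_less_eq[OF ts(1), of i "Suc i"] by (intro N_mono that nn) simp
  have "(\<forall>i\<le>n. N (ts i) w = N (ts i) w0) \<longleftrightarrow>
      (\<forall>i<n. N (ts (Suc i)) w - N (ts i) w = N (ts (Suc i)) w0 - N (ts i) w0)" if w: "w \<in> space M" for w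
  proof
    assume *: "\<forall>i<n. N (ts (Suc i)) w - N (ts i) w = N (ts (Suc i)) w0 - N (ts i) w0"
    have "i \<le> n \<Longrightarrow> N (ts i) w = N (ts i) w0" for i
    proof (induction i)
      case 0
      then show ?case using ts(2) N_0 w w0 by simp
    next
      case (Suc i)
      have "N (ts (Suc i)) w - N (ts i) w = N (ts (Suc i)) w0 - N (ts i) w0"
        by (rule *[rule_format]) (use Suc.prems in simp)
      moreover have "N (ts i) w = N (ts i) w0" using Suc by simp
      ultimately
      show ?case using mono[OF w, of i] mono[OF w0, of i] by linarith
    qed
    then show "\<forall>i\<le>n. N (ts i) w = N (ts i) w0" by blast
  qed auto
  then show ?thesis
    unfolding cyl_def ts(3) by (auto simp: atMost_def)
qed

text \<open>Prescribe the first n increments and let the last one lie in B. The product formula with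
  B = A gives the intersection, and with B = UNIV the cylinder alone.\<close>

lemma cyl_indep:
  assumes J: "finite J" "0 \<in> J" "t \<in> J" "J \<subseteq> {0..t}" and h: "0 < h" and w0: "w0 \<in> space M"
  shows "prob (cyl J w0 \<inter> inc_event t h A) = prob (cyl J w0) * prob (inc_event t h A)"
proof -
  obtain ts n where ts: "strict_mono ts" "ts 0 = 0" "ts n = t" "ts (Suc n) = t + h" "J = ts ` {..n}"
    using ex_strict_mono_grid[OF J h] by metis
  define X where "X i w = N (ts (Suc i)) w - N (ts i) w" for i w
  have ind: "indep_vars (\<lambda>_. count_space UNIV) X {..<Suc n}"
    using poisson ts(1,2) unfolding poisson_process_def X_def[abs_def] by fastforce
  define P where "P B = prob (\<Inter>i\<in>{..<Suc n}. X i -` (if i < n then {X i w0} else B) \<inter> space M)" for B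
  have P: "P B = (\<Prod>i<n. prob (X i -` {X i w0} \<inter> space M)) * prob (X n -` B \<inter> space M)" for B
  proof -
    have "P B = (\<Prod>i\<in>{..<Suc n}. prob (X i -` (if i < n then {X i w0} else B) \<inter> space M))"
      unfolding P_def by (rule indep_varsD[OF ind]) auto
    then show ?thesis by simp
  qed
  have set_eq: "(\<Inter>i\<in>{..<Suc n}. X i -` (if i < n then {X i w0} else B) \<inter> space M) =
      cyl J w0 \<inter> (X n -` B \<inter> space M)" for B
    unfolding cyl_eq_increments[OF ts(1,2,5) w0] by (auto simp: X_def less_Suc_eq split: if_splits)
  have Xn: "X n -` B \<inter> space M = inc_event t h B" for B
    by (auto simp: inc_event_def inc_def X_def ts(3,4))
  have U: "inc_event t h UNIV = space M" by (auto simp: inc_event_def)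
  have "cyl J w0 \<inter> space M = cyl J w0" by (auto simp: cyl_def)
  then have "prob (cyl J w0) = (\<Prod>i<n. prob (X i -` {X i w0} \<inter> space M))"
    using P[of UNIV] unfolding P_def set_eq Xn U by (simp add: prob_space)
  then show ?thesis
    using P[of A] unfolding P_def set_eq Xn by simp
qed

text \<open>An intersection-stable generator of the augmented past. Null sets can be included
  because they are independent of every event.\<close>

definition cyls :: "real \<Rightarrow> 'a set set" where
  "cyls t = {cyl J w0 | J w0. finite J \<and> 0 \<in> J \<and> t \<in> J \<and> J \<subseteq> {0..t} \<and> w0 \<in> space M} \<union> null_sets M"

definition hist' :: "real \<Rightarrow> 'a measure" where
  "hist' t = sigma (space M) (natural_generator M N (ennreal t) \<union> null_sets M)"

lemma cyl_sets:
  assumes "finite J" "J \<subseteq> {0..t}"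
  shows "cyl J w0 \<in> sets M"
proof -
  have "{w \<in> space M. N s w = N s w0} \<in> sets M" if "s \<in> J" for s
  proof -
    have [measurable]: "N s \<in> measurable M (count_space UNIV)"
      using that assms by (intro N_measurable) auto
    show ?thesis by measurable
  qed
  then show ?thesis
    unfolding cyl_def by (rule sets.sets_Collect_finite_All[OF _ assms(1)])
qed

lemma cyls_sets: "cyls t \<subseteq> sets M"
  unfolding cyls_def using cyl_sets by auto

lemma Int_stable_cyls: "Int_stable (cyls t)"
proof (rule Int_stableI)
  fix a b assume ab: "a \<in> cyls t" "b \<in> cyls t"
  then have sets: "a \<in> sets M" "b \<in> sets M" using cyls_sets by auto
  show "a \<inter> b \<in> cyls t"
  proof (cases "a \<in> null_sets M \<or> b \<in> null_sets M \<or> a \<inter> b = {}")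
    case True
    then have "a \<inter> b \<in> null_sets M"
      using sets by (auto intro: null_set_Int1 null_set_Int2)
    then show ?thesis by (simp add: cyls_def)
  next
    case False
    then obtain J w0 J' w1 where
      a: "a = cyl J w0" "finite J" "0 \<in> J" "t \<in> J" "J \<subseteq> {0..t}" and
      b: "b = cyl J' w1" "finite J'" "0 \<in> J'" "t \<in> J'" "J' \<subseteq> {0..t}"
      using ab unfolding cyls_def by blast
    obtain w2 where w2: "w2 \<in> a" "w2 \<in> b" using False by auto
    then have "a \<inter> b = cyl (J \<union> J') w2"
      unfolding a(1) b(1) cyl_def by auto
    moreover have "w2 \<in> space M" using w2 by (simp add: a(1) cyl_def)
    ultimately show ?thesis unfolding cyls_def using a b by blast
  qed
qed

lemma natural_generator_cyls:
  assumes t: "0 \<le> t"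
  shows "natural_generator M N (ennreal t) \<subseteq> sigma_sets (space M) (cyls t)"
proof
  fix B assume "B \<in> natural_generator M N (ennreal t)"
  then obtain s A where B: "B = N s -` A \<inter> space M" and s: "0 \<le> s" "s \<le> t"
    using t by (auto simp: natural_generator_def)
  \<comment> \<open>An event about \<open>N s\<close> is a union of cylinders over 0, s and t; only
    countably many are distinct, because the counts are natural numbers.\<close>
  define Y where "Y = (\<lambda>w. cyl {0, s, t} w) ` B"
  have "Y \<subseteq> range (\<lambda>(a, b, c). {w \<in> space M. N 0 w = a \<and> N s w = b \<and> N t w = c})"
    unfolding Y_def cyl_def by (auto simp: image_iff)
  then have "countable Y" by (rule countable_subset) (intro countable_image countableI_type)
  moreover have "Y \<subseteq> sigma_sets (space M) (cyls t)"
  proof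
    fix y assume "y \<in> Y"
    then obtain w where "y = cyl {0, s, t} w" "w \<in> space M" by (auto simp: Y_def B)
    then have "y \<in> cyls t" unfolding cyls_def using s t by fastforce
    then show "y \<in> sigma_sets (space M) (cyls t)" by (rule sigma_sets.Basic)
  qed
  ultimately have "\<Union>Y \<in> sigma_sets (space M) (cyls t)"
    by (intro sigma_sets_UNION) auto
  also have "\<Union>Y = B"
    unfolding Y_def cyl_def B by auto
  finally show "B \<in> sigma_sets (space M) (cyls t)" .
qed

lemma hist'_generator_Pow: "natural_generator M N t \<union> null_sets M \<subseteq> Pow (space M)"
  by (auto simp: null_sets_def dest: sets.sets_into_space natural_generator_Pow[THEN subsetD])

lemma space_hist' [simp]: "space (hist' t) = space M"
  unfolding hist'_def using hist'_generator_Pow by (rule space_measure_of)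

lemma sets_hist': "sets (hist' t) = sigma_sets (space M) (natural_generator M N (ennreal t) \<union> null_sets M)"
  unfolding hist'_def using hist'_generator_Pow by (rule sets_measure_of)

lemma sets_hist'_subset: "sets (hist' t) \<subseteq> sets M"
  unfolding sets_hist' using natural_generator_sets by (intro sets.sigma_sets_subset) (auto simp: null_sets_def)

lemma sets_hist_hist': "sets (hist t) \<subseteq> sets (hist' t)"
  unfolding sets_hist' sets_hist by (rule sigma_sets_mono') simp

lemma measurable_hist_hist': "f \<in> measurable (hist t) K \<Longrightarrow> f \<in> measurable (hist' t) K"
  using sets_hist_hist' by (auto simp: measurable_def)

lemma measurable_hist'_M: "f \<in> measurable (hist' t) K \<Longrightarrow> f \<in> measurable M K"
  using sets_hist'_subset by (auto simp: measurable_def)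

lemma hist'_indep_set:
  assumes t: "0 \<le> t" and h: "0 < h"
  shows "indep_set (sets (hist' t)) (sigma_sets (space M) {inc_event t h A})"
proof -
  have "indep_set (cyls t) {inc_event t h A}"
  proof (rule indep_setI)
    show "cyls t \<subseteq> events" by (rule cyls_sets)
    show "{inc_event t h A} \<subseteq> events" using t h by simp
    fix a b assume a: "a \<in> cyls t" and b: "b \<in> {inc_event t h A}"
    have bM: "b \<in> sets M" using b t h by simp
    show "prob (a \<inter> b) = prob a * prob b"
    proof (cases "a \<in> null_sets M")
      case True
      then have "a \<inter> b \<in> null_sets M" using bM by (intro null_set_Int2)
      then show ?thesis using True by (simp add: measure_eq_0_null_sets)
    next
      case False
      then obtain J w0 where "a = cyl J w0" "finite J" "0 \<in> J" "t \<in> J" "J \<subseteq> {0..t}" "w0 \<in> space M"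
        using a unfolding cyls_def by blast
      then show ?thesis using b cyl_indep h by simp
    qed
  qed
  then have *: "indep_set (sigma_sets (space M) (cyls t)) (sigma_sets (space M) {inc_event t h A})"
    by (rule indep_set_sigma_sets[OF _ Int_stable_cyls]) (simp add: Int_stable_def)
  have "sets (hist' t) \<subseteq> sigma_sets (space M) (cyls t)"
    unfolding sets_hist'
  proof (rule sigma_sets_mono)
    show "natural_generator M N (ennreal t) \<union> null_sets M \<subseteq> sigma_sets (space M) (cyls t)"
      using natural_generator_cyls[OF t] by (auto simp: cyls_def)
  qed
  then show ?thesis
    using * unfolding indep_sets2_eq by blast
qed

lemma expectation_indep:
  assumes t: "0 \<le> t" and h: "0 < h" and X: "X \<in> borel_measurable (hist' t)"
    and bd: "\<And>w. w \<in> space M \<Longrightarrow> \<bar>X w\<bar> \<le> B"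
  shows "(\<integral>w. X w * indicator (inc_event t h A) w \<partial>M) = (\<integral>w. X w \<partial>M) * prob (inc_event t h A)"
proof -
  let ?E = "inc_event t h A"
  have E: "?E \<in> sets M" using t h by simp
  have XM [measurable]: "X \<in> borel_measurable M" by (rule measurable_hist'_M[OF X])
  have "indep_var borel X borel (indicator ?E :: 'a \<Rightarrow> real)"
    unfolding indep_var_eq
  proof (intro conjI)
    show "indep_set (sigma_sets (space M) {X -` A \<inter> space M |A. A \<in> sets borel})
        (sigma_sets (space M) {(indicator ?E :: 'a \<Rightarrow> real) -` A \<inter> space M |A. A \<in> sets borel})"
    proof -
      have 1: "sigma_sets (space M) {X -` A \<inter> space M |A. A \<in> sets borel} \<subseteq> sets (hist' t)"
        using sets.sigma_sets_subset[of "{X -` A \<inter> space M |A. A \<in> sets borel}" "hist' t"] measurable_sets[OF X] by auto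
      have "(indicator ?E :: 'a \<Rightarrow> real) -` C \<inter> space M \<in> sigma_sets (space M) {?E}" for C
      proof -
        have "?E \<subseteq> space M" using E sets.sets_into_space by blast
        then have "(indicator ?E :: 'a \<Rightarrow> real) -` C \<inter> space M =
            (if 0 \<in> C then if 1 \<in> C then space M else space M - ?E else if 1 \<in> C then ?E else {})"
          by (auto simp: indicator_def of_bool_def split: if_splits)
        then show ?thesis
          by (auto intro: sigma_sets.Empty sigma_sets.Basic sigma_sets.Compl sigma_sets_top)
      qed
      then have 2: "sigma_sets (space M) {(indicator ?E :: 'a \<Rightarrow> real) -` A \<inter> space M |A. A \<in> sets borel}
          \<subseteq> sigma_sets (space M) {?E}"
        by (intro sigma_sets_mono) auto
      show ?thesis
        using hist'_indep_set[OF t h, of A] 1 2 unfolding indep_sets2_eq by blast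
    qed
  qed (use E in auto)
  then have "(\<integral>w. X w * indicator ?E w \<partial>M) = (\<integral>w. X w \<partial>M) * (\<integral>w. indicator ?E w \<partial>M)"
  proof (rule indep_var_lebesgue_integral)
    show "integrable M X" by (rule integrable_const_bound[of _ B]) (use bd in auto)
    show "integrable M (indicator ?E :: 'a \<Rightarrow> real)" using E by (simp add: emeasure_eq_measure)
  qed
  then show ?thesis using E by simp
qed

section \<open>Poisson probabilities and the expected change of the value over a short step\<close>

lemma distr_inc:
  assumes t: "0 \<le> t" and h: "0 < h"
  shows "distr M (count_space UNIV) (inc t h) = measure_pmf (poisson_pmf (\<mu> * h))"
proof -
  have "\<forall>s t. 0 \<le> s \<and> s < t \<longrightarrow>
        distr M (count_space UNIV) (\<lambda>w. N t w - N s w) = measure_pmf (poisson_pmf (\<mu> * (t - s)))"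
    using poisson by (simp add: poisson_process_def)
  then have "distr M (count_space UNIV) (\<lambda>w. N (t + h) w - N t w) = measure_pmf (poisson_pmf (\<mu> * (t + h - t)))"
    using t h by (metis less_add_same_cancel1)
  then show ?thesis by (simp add: inc_def[abs_def])
qed

lemma prob_inc:
  assumes t: "0 \<le> t" and h: "0 < h"
  shows "prob (inc_event t h {j}) = (\<mu> * h) ^ j / fact j * exp (- (\<mu> * h))"
proof -
  have "prob (inc_event t h {j}) = measure (distr M (count_space UNIV) (inc t h)) {j}"
    using t h by (subst measure_distr) (auto simp: inc_event_def intro!: arg_cong[where f = prob])
  also have "\<dots> = pmf (poisson_pmf (\<mu> * h)) j"
    unfolding distr_inc[OF assms] by (simp add: measure_pmf_single)
  also have "\<dots> = (\<mu> * h) ^ j / fact j * exp (- (\<mu> * h))"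
    using mu_gt_1 h by (intro pmf_poisson) simp
  finally show ?thesis .
qed

lemma prob_inc_pos:
  assumes t: "0 \<le> t" and h: "0 < h"
  shows "prob (inc_event t h {1..}) \<le> \<mu> * h" "prob (inc_event t h {2..}) \<le> (\<mu> * h)\<^sup>2"
proof -
  define r where "r = \<mu> * h"
  have r: "0 < r" using mu_gt_1 h by (simp add: r_def)
  have "inc_event t h {1..} = space M - inc_event t h {0}" by (auto simp: inc_event_def)
  then have p1: "prob (inc_event t h {1..}) = 1 - exp (- r)"
    using prob_compl[of "inc_event t h {0}"] prob_inc[OF assms, of 0] t h by (simp add: r_def)
  then show "prob (inc_event t h {1..}) \<le> \<mu> * h"
    using exp_minus_bounds[of r] r by (simp add: r_def)
  have "inc_event t h {1..} = inc_event t h {1} \<union> inc_event t h {2..}" "inc_event t h {1} \<inter> inc_event t h {2..} = {}"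
    by (auto simp: inc_event_def)
  then have "prob (inc_event t h {1..}) = prob (inc_event t h {1}) + prob (inc_event t h {2..})"
    using t h by (simp add: finite_measure_Union)
  then have "prob (inc_event t h {2..}) = (1 - exp (- r)) - r * exp (- r)"
    using p1 prob_inc[OF assms, of 1] by (simp add: r_def)
  also have "\<dots> \<le> r - r * exp (- r)"
    using exp_minus_bounds[of r] r by simp
  also have "\<dots> = r * (1 - exp (- r))" by (simp add: algebra_simps)
  also have "\<dots> \<le> r * r"
    using exp_minus_bounds[of r] r by (intro mult_left_mono) auto
  finally show "prob (inc_event t h {2..}) \<le> (\<mu> * h)\<^sup>2" by (simp add: r_def power2_eq_square)
qed

text \<open>The functions applied to the path are known to be continuous on the quadrant only, so
  measurability passes through the restricted Borel space.\<close>

lemma measurable_on_Q: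
  assumes f: "continuous_on Q f" and X: "X \<in> borel_measurable K" "\<And>x. x \<in> space K \<Longrightarrow> X x \<in> Q"
  shows "(\<lambda>x. f (X x)) \<in> borel_measurable K"
proof (rule measurable_compose[of X K "restrict_space borel Q"])
  show "X \<in> measurable K (restrict_space borel Q)"
    using X by (intro measurable_restrict_space2) auto
  show "f \<in> borel_measurable (restrict_space borel Q)"
    by (rule borel_measurable_continuous_on_restrict[OF f])
qed

lemma continuous_v: "continuous_on Q v"
  by (rule good_continuous[OF good_v])

lemma continuous_v_S: "continuous_on Q (\<lambda>q. v (S q))"
  by (intro continuous_on_compose2[OF continuous_v] continuous_on_S continuous_on_id) (auto intro: S_in_Q)

lemma continuous_v_F: "0 \<le> h \<Longrightarrow> continuous_on Q (\<lambda>q. v (F h q))"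
  by (intro continuous_on_compose2[OF continuous_v] continuous_on_F continuous_on_id continuous_on_const) (auto intro: F_in_Q)

lemma continuous_mneg: "continuous_on Q mneg"
  unfolding mneg_def by (intro continuous_intros continuous_on_Gv) auto

lemma continuous_ell: "continuous_on Q ell"
  unfolding ell_def by (intro continuous_intros continuous_mneg continuous_v_S)

lemma function_of_path:
  assumes "continuous_on Q f" "0 \<le> t"
  shows "(\<lambda>w. f (path t w)) \<in> borel_measurable (hist' t)" "(\<lambda>w. f (path t w)) \<in> borel_measurable M"
proof -
  have "path t \<in> borel_measurable (hist' t)"
    by (rule measurable_hist_hist'[OF path_hist[OF assms(2)]])
  then show *: "(\<lambda>w. f (path t w)) \<in> borel_measurable (hist' t)"
    by (rule measurable_on_Q[OF assms(1)]) (use path_in_Q assms(2) in simp)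
  show "(\<lambda>w. f (path t w)) \<in> borel_measurable M" by (rule measurable_hist'_M[OF *])
qed

lemma integrable_bounded:
  fixes X :: "'a \<Rightarrow> real"
  assumes "X \<in> borel_measurable M" "\<And>w. w \<in> space M \<Longrightarrow> \<bar>X w\<bar> \<le> B"
  shows "integrable M X"
  by (rule integrable_const_bound[of _ B]) (use assms in auto)

lemma expectation_abs_le:
  fixes X :: "'a \<Rightarrow> real"
  assumes X: "X \<in> borel_measurable M" and Y: "integrable M Y" and le: "\<And>w. w \<in> space M \<Longrightarrow> \<bar>X w\<bar> \<le> Y w"
  shows "integrable M X" "\<bar>expectation X\<bar> \<le> expectation Y"
proof -
  show int: "integrable M X"
    by (rule Bochner_Integration.integrable_bound[OF Y X]) (use order_trans[OF le abs_ge_self] in \<open>auto intro!: AE_I2\<close>)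
  have "\<bar>expectation X\<bar> \<le> (\<integral>w. \<bar>X w\<bar> \<partial>M)"
    by (rule integral_abs_bound)
  also have "\<dots> \<le> expectation Y"
    using int Y le by (intro integral_mono) auto
  finally show "\<bar>expectation X\<bar> \<le> expectation Y" .
qed

text \<open>The value process is a martingale up to the compensator \<open>ell\<close> and an error of second order
  in the step; only the number of jumps in the step matters, not their times.\<close>

lemma one_step:
  obtains C where "0 \<le> C" "\<And>t h A. 0 \<le> t \<Longrightarrow> 0 < h \<Longrightarrow> h \<le> 1 \<Longrightarrow> A \<in> sets (hist' t) \<Longrightarrow>
    \<bar>\<integral>w. indicator A w * (exp (- lam * h) * v (path (t + h) w) - v (path t w) + h * ell (path t w)) \<partial>M\<bar> \<le> C * h\<^sup>2"
proof -
  obtain C1 where C1: "0 \<le> C1" "\<And>q u h. q \<in> Q \<Longrightarrow> 0 \<le> u \<Longrightarrow> u \<le> h \<Longrightarrow> h \<le> 1 \<Longrightarrow>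
    \<bar>v (F (h - u) (S (F u q))) - v (S q)\<bar> \<le> C1 * h"
    using one_jump_modulus by blast
  obtain C3 where C3: "0 \<le> C3" "\<And>q h. q \<in> Q \<Longrightarrow> 0 \<le> h \<Longrightarrow> h \<le> 1 \<Longrightarrow>
    \<bar>exp (- kap * h) * v (F h q) - v q + h * mneg q\<bar> \<le> C3 * h\<^sup>2"
    using dynamic_programming_approx by blast
  define C2 where "C2 = C1 * \<mu> + bnd * \<mu>\<^sup>2"
  have C2: "0 \<le> C2" using C1(1) mu_gt_1 const_pos by (simp add: C2_def)
  define C where "C = C2 + C3 + \<mu> * kap * bnd"
  show ?thesis
  proof (rule that[of C])
    show "0 \<le> C" using C2 C3(1) mu_gt_1 const_pos by (simp add: C_def)
    fix t h :: real and A assume t: "0 \<le> t" and h: "0 < h" "h \<le> 1" and A: "A \<in> sets (hist' t)"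
    have th: "0 \<le> t + h" using t h by simp
    have AM [measurable]: "A \<in> sets M" using A sets_hist'_subset by blast
    note [measurable] = A
    let ?E = "\<lambda>B. indicator (inc_event t h B) :: 'a \<Rightarrow> real"
    have E_meas [measurable]: "inc_event t h B \<in> sets M" for B using t h by simp
    define f1 where "f1 w = v (F h (path t w))" for w
    define f2 where "f2 w = v (S (path t w))" for w
    have pQ: "path t w \<in> Q" "path (t + h) w \<in> Q" if "w \<in> space M" for w
      using path_in_Q[OF that] t th by auto
    have f12: "f1 \<in> borel_measurable (hist' t)" "f2 \<in> borel_measurable (hist' t)"
      unfolding f1_def[abs_def] f2_def[abs_def]
      using function_of_path(1)[OF continuous_v_F[of h] t] function_of_path(1)[OF continuous_v_S t] h by auto
    note [measurable] = f12 f12[THEN measurable_hist'_M] function_of_path(2)[OF continuous_v th]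
      function_of_path(2)[OF continuous_v t] function_of_path(2)[OF continuous_mneg t]
      function_of_path(2)[OF continuous_ell t]
    have bd: "\<bar>f1 w\<bar> \<le> bnd" "\<bar>f2 w\<bar> \<le> bnd" "\<bar>v (path (t + h) w)\<bar> \<le> bnd" "\<bar>v (path t w)\<bar> \<le> bnd" if "w \<in> space M" for w
      unfolding f1_def f2_def using pQ[OF that] h by (auto intro!: v_bound F_in_Q S_in_Q)
    have ind: "\<bar>indicator A w * x\<bar> \<le> y" if "\<bar>x\<bar> \<le> y" for x y :: real and w
      using that by (auto simp: indicator_def)
    have iA: "integrable M (\<lambda>w. indicator A w * f1 w)" "integrable M (\<lambda>w. indicator A w * f2 w)"
        "integrable M (\<lambda>w. indicator A w * v (path (t + h) w))" "integrable M (\<lambda>w. indicator A w * v (path t w))"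
      by (rule integrable_bounded[where B = bnd]; use bd ind in simp)+
    have im: "integrable M (\<lambda>w. indicator A w * mneg (path t w))"
    proof (rule integrable_bounded[where B = cap])
      show "\<bar>indicator A w * mneg (path t w)\<bar> \<le> cap" if "w \<in> space M" for w
        by (rule ind) (use min_G_bounds[OF good_v pQ(1)[OF that]] const_pos in \<open>simp add: mneg_def abs_le_iff\<close>)
    qed measurable
    \<comment> \<open>The error made by using the pure flow when there is no jump, the jump at the
      start when there is one, and 0 when there are more. It is of order h on the event of a jump
      and bounded on the event of two, hence of order \<open>h\<^sup>2\<close> in
      expectation.\<close>
    define e where "e w = indicator A w * (v (path (t + h) w) - (f1 w * ?E {0} w + f2 w * ?E {1} w))" for w
    have e_meas: "e \<in> borel_measurable M" unfolding e_def[abs_def] by measurable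
    have e_le: "\<bar>e w\<bar> \<le> C1 * h * ?E {1..} w + bnd * ?E {2..} w" if w: "w \<in> space M" for w
      unfolding e_def
    proof (rule ind)
      have N: "N t w \<le> N (t + h) w" using h by (intro N_mono w t) simp
      consider "inc t h w = 0" | "inc t h w = 1" | "2 \<le> inc t h w" by linarith
      then show "\<bar>v (path (t + h) w) - (f1 w * ?E {0} w + f2 w * ?E {1} w)\<bar> \<le> C1 * h * ?E {1..} w + bnd * ?E {2..} w"
      proof cases
        case 1
        then have "N (t + h) w = N t w" using N by (simp add: inc_def)
        then have "v (path (t + h) w) = f1 w"
          using path_no_jump[OF w t, of h] h by (simp add: f1_def)
        then show ?thesis using 1 w C1(1) h const_pos by (simp add: inc_event_def)
      next
        case 2
        then have "N (t + h) w = Suc (N t w)" using N by (simp add: inc_def)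
        then obtain u where u: "0 \<le> u" "u \<le> h" "path (t + h) w = F (h - u) (S (F u (path t w)))"
          using path_one_jump[OF w t, of h] h by auto
        then have "\<bar>v (path (t + h) w) - f2 w\<bar> \<le> C1 * h"
          using C1(2)[OF pQ(1)[OF w] u(1,2) h(2)] by (simp add: f2_def)
        then show ?thesis using 2 w by (simp add: inc_event_def)
      next
        case 3
        then have "0 \<le> C1 * h" "?E {0} w = 0" "?E {1} w = 0" "?E {1..} w = 1" "?E {2..} w = 1"
          using w C1(1) h by (auto simp: inc_event_def)
        then show ?thesis using bd(3)[OF w] by simp
      qed
    qed
    have "\<bar>expectation e\<bar> \<le> expectation (\<lambda>w. C1 * h * ?E {1..} w + bnd * ?E {2..} w)"
      by (rule expectation_abs_le(2)[OF e_meas _ e_le]) (auto simp: emeasure_eq_measure)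
    also have "\<dots> = C1 * h * prob (inc_event t h {1..}) + bnd * prob (inc_event t h {2..})"
      by (subst Bochner_Integration.integral_add) (auto simp: emeasure_eq_measure)
    also have "\<dots> \<le> C1 * h * (\<mu> * h) + bnd * (\<mu> * h)\<^sup>2"
      using prob_inc_pos[OF t h(1)] C1(1) h const_pos by (intro add_mono mult_left_mono) auto
    also have "\<dots> = C2 * h\<^sup>2" by (simp add: C2_def power2_eq_square algebra_simps)
    finally have e: "\<bar>expectation e\<bar> \<le> C2 * h\<^sup>2" .
    have i12: "integrable M (\<lambda>w. indicator A w * f1 w * ?E {0} w)" "integrable M (\<lambda>w. indicator A w * f2 w * ?E {1} w)"
      by (intro integrable_real_mult_indicator iA E_meas)+
    have "expectation e = expectation (\<lambda>w. indicator A w * v (path (t + h) w)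
        - indicator A w * f1 w * ?E {0} w - indicator A w * f2 w * ?E {1} w)"
      unfolding e_def by (simp add: algebra_simps)
    also have "\<dots> = expectation (\<lambda>w. indicator A w * v (path (t + h) w))
        - expectation (\<lambda>w. indicator A w * f1 w * ?E {0} w) - expectation (\<lambda>w. indicator A w * f2 w * ?E {1} w)"
      using iA i12 by (simp only: Bochner_Integration.integral_diff Bochner_Integration.integrable_diff)
    also have "expectation (\<lambda>w. indicator A w * f1 w * ?E {0} w) = expectation (\<lambda>w. indicator A w * f1 w) * prob (inc_event t h {0})"
      by (rule expectation_indep[OF t h(1), where B = bnd]) (use bd ind in auto)
    also have "expectation (\<lambda>w. indicator A w * f2 w * ?E {1} w) = expectation (\<lambda>w. indicator A w * f2 w) * prob (inc_event t h {1})"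
      by (rule expectation_indep[OF t h(1), where B = bnd]) (use bd ind in auto)
    finally have e_eq: "expectation e = expectation (\<lambda>w. indicator A w * v (path (t + h) w))
        - expectation (\<lambda>w. indicator A w * f1 w) * exp (- (\<mu> * h)) - expectation (\<lambda>w. indicator A w * f2 w) * (\<mu> * h * exp (- (\<mu> * h)))"
      using prob_inc[OF t h(1), of 0] prob_inc[OF t h(1), of 1] by simp
    \<comment> \<open>The error of the jump-free part, of second order by
      \<open>dynamic_programming_approx\<close>.\<close>
    define d where "d w = indicator A w * (exp (- kap * h) * f1 w - v (path t w) + h * mneg (path t w))" for w
    have d_meas: "d \<in> borel_measurable M" unfolding d_def[abs_def] by measurable
    have "\<bar>expectation d\<bar> \<le> expectation (\<lambda>_. C3 * h\<^sup>2)"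
      by (rule expectation_abs_le(2)[OF d_meas])
        (use C3(2)[OF pQ(1)] h in \<open>auto simp: d_def f1_def intro!: ind\<close>)
    then have d: "\<bar>expectation d\<bar> \<le> C3 * h\<^sup>2" by (simp add: prob_space)
    have d_eq: "expectation d = exp (- kap * h) * expectation (\<lambda>w. indicator A w * f1 w)
        - expectation (\<lambda>w. indicator A w * v (path t w)) + h * expectation (\<lambda>w. indicator A w * mneg (path t w))"
    proof -
      have "expectation d = expectation (\<lambda>w. exp (- kap * h) * (indicator A w * f1 w)
          - indicator A w * v (path t w) + h * (indicator A w * mneg (path t w)))"
        unfolding d_def by (simp add: algebra_simps)
      then show ?thesis using iA im by simp
    qed
    have fin_eq: "(\<integral>w. indicator A w * (exp (- lam * h) * v (path (t + h) w) - v (path t w) + h * ell (path t w)) \<partial>M)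
        = exp (- lam * h) * expectation (\<lambda>w. indicator A w * v (path (t + h) w))
        - expectation (\<lambda>w. indicator A w * v (path t w)) + h * expectation (\<lambda>w. indicator A w * mneg (path t w))
        - h * \<mu> * expectation (\<lambda>w. indicator A w * f2 w)"
    proof -
      have "(\<integral>w. indicator A w * (exp (- lam * h) * v (path (t + h) w) - v (path t w) + h * ell (path t w)) \<partial>M)
        = (\<integral>w. exp (- lam * h) * (indicator A w * v (path (t + h) w)) - indicator A w * v (path t w)
          + h * (indicator A w * mneg (path t w)) - h * \<mu> * (indicator A w * f2 w) \<partial>M)"
        unfolding ell_def f2_def by (simp add: algebra_simps)
      then show ?thesis using iA im by simp
    qed
    define a where "a = expectation (\<lambda>w. indicator A w * v (path (t + h) w))"
    define b where "b = expectation (\<lambda>w. indicator A w * f2 w)"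
    define y where "y = expectation (\<lambda>w. indicator A w * f1 w)"
    define ek where "ek = exp (- kap * h)"
    have ek: "exp (- lam * h) * exp (- (\<mu> * h)) = ek"
      by (simp add: ek_def kap_def algebra_simps flip: exp_add)
    have "\<bar>b\<bar> \<le> expectation (\<lambda>_. bnd)"
      unfolding b_def by (rule expectation_abs_le(2)) (use bd ind in auto)
    then have b: "\<bar>b\<bar> \<le> bnd" by (simp add: prob_space)
    have ek1: "0 \<le> 1 - ek" "1 - ek \<le> kap * h"
      using exp_minus_bounds[of "kap * h"] const_pos h by (auto simp: ek_def)
    have "exp (- lam * h) * expectation e = exp (- lam * h) * a - y * (exp (- lam * h) * exp (- (\<mu> * h)))
        - b * (\<mu> * h * (exp (- lam * h) * exp (- (\<mu> * h))))"
      unfolding e_eq a_def b_def y_def by (simp add: algebra_simps)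
    then have "exp (- lam * h) * a = exp (- lam * h) * expectation e + y * ek + b * (\<mu> * h * ek)"
      unfolding ek by simp
    \<comment> \<open>Discounting combines with the probability of no jump to
      \<open>exp (- kap * h)\<close>. The one-jump term nearly cancels against the jump part of
      \<open>ell\<close>; what remains carries the factor 1 - ek, again of order h.\<close>
    then have "(\<integral>w. indicator A w * (exp (- lam * h) * v (path (t + h) w) - v (path t w) + h * ell (path t w)) \<partial>M)
        = exp (- lam * h) * expectation e + expectation d - \<mu> * h * (1 - ek) * b"
      unfolding fin_eq d_eq a_def[symmetric] b_def[symmetric] y_def[symmetric] ek_def[symmetric]
      by (simp add: algebra_simps)
    moreover have "\<bar>exp (- lam * h) * expectation e\<bar> \<le> 1 * (C2 * h\<^sup>2)"
      unfolding abs_mult using e lam_pos h by (intro mult_mono) auto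
    moreover have "\<bar>\<mu> * h * (1 - ek) * b\<bar> \<le> \<mu> * h * (kap * h) * bnd"
      unfolding abs_mult using b ek1 mu_gt_1 h const_pos by (intro mult_mono) auto
    moreover have "\<mu> * h * (kap * h) * bnd = \<mu> * kap * bnd * h\<^sup>2" by (simp add: power2_eq_square)
    moreover have "C * h\<^sup>2 = C2 * h\<^sup>2 + C3 * h\<^sup>2 + \<mu> * kap * bnd * h\<^sup>2" by (simp add: C_def algebra_simps)
    ultimately show "\<bar>\<integral>w. indicator A w * (exp (- lam * h) * v (path (t + h) w) - v (path t w) + h * ell (path t w)) \<partial>M\<bar> \<le> C * h\<^sup>2"
      using d by linarith
  qed
qed

end

section \<open>The lower bound\<close>

lemma ereal_integral_eq_lebesgue:
  assumes "integrable M f"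
  shows "ereal_integral M (\<lambda>x. ereal (f x)) = ereal (integral\<^sup>L M f)"
proof -
  have fin: "(\<integral>\<^sup>+x. ennreal (f x) \<partial>M) \<noteq> \<infinity>" "(\<integral>\<^sup>+x. ennreal (- f x) \<partial>M) \<noteq> \<infinity>"
    using assms by (auto simp: real_integrable_def)
  then obtain a b where "0 \<le> a" "0 \<le> b" "(\<integral>\<^sup>+x. ennreal (f x) \<partial>M) = ennreal a" "(\<integral>\<^sup>+x. ennreal (- f x) \<partial>M) = ennreal b"
    by (metis ennreal_cases infinity_ennreal_def)
  then show ?thesis
    unfolding ereal_integral_def real_lebesgue_integral_def[OF assms] by simp
qed

lemma ereal_integral_mono:
  assumes "\<And>x. x \<in> space M \<Longrightarrow> f x \<le> f' x"
  shows "ereal_integral M f \<le> ereal_integral M f'"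
  unfolding ereal_integral_def
proof (rule ereal_minus_mono)
  show "enn2ereal (\<integral>\<^sup>+x. e2ennreal (f x) \<partial>M) \<le> enn2ereal (\<integral>\<^sup>+x. e2ennreal (f' x) \<partial>M)"
    unfolding less_eq_ennreal.rep_eq[symmetric] by (intro nn_integral_mono e2ennreal_mono assms)
  show "enn2ereal (\<integral>\<^sup>+x. e2ennreal (- f' x) \<partial>M) \<le> enn2ereal (\<integral>\<^sup>+x. e2ennreal (- f x) \<partial>M)"
    unfolding less_eq_ennreal.rep_eq[symmetric] by (intro nn_integral_mono e2ennreal_mono) (simp add: assms)
qed

lemma ereal_integral_cong:
  "(\<And>x. x \<in> space M \<Longrightarrow> f x = f' x) \<Longrightarrow> ereal_integral M f = ereal_integral M f'"
  by (intro antisym ereal_integral_mono) auto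

lemma exp_tail_has_integral:
  assumes "0 < (a::real)"
  shows "has_bochner_integral lborel (\<lambda>t. indicator {T..} t * exp (- a * t)) (exp (- a * T) / a)"
proof (rule has_bochner_integral_nn_integral)
  have "((\<lambda>t. if t \<in> {T..} then exp (- a * t) else 0) has_integral exp (- a * T) / a) UNIV"
    unfolding has_integral_restrict_UNIV by (rule has_integral_exp_minus_to_infinity[OF assms])
  then have "((\<lambda>t. indicator {T..} t * exp (- a * t)) has_integral exp (- a * T) / a) UNIV"
    by (rule has_integral_eq[rotated]) (auto simp: indicator_def)
  then show "(\<integral>\<^sup>+t. ennreal (indicator {T..} t * exp (- a * t)) \<partial>lborel) = ennreal (exp (- a * T) / a)"
    by (intro nn_integral_has_integral_lborel) auto
qed (use assms in auto)

text \<open>Writes a Riemann sum as an integral over time, so that it can be compared with the cost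
  pointwise in t along a single path.\<close>

definition step :: "real \<Rightarrow> nat \<Rightarrow> (nat \<Rightarrow> real) \<Rightarrow> real \<Rightarrow> real" where
  "step h n a t = (\<Sum>k<n. a k * indicator {real k * h..<real (Suc k) * h} t)"

lemma step_eq:
  assumes h: "0 < h" and k: "real k * h \<le> t" "t < real (Suc k) * h"
  shows "step h n a t = (if k < n then a k else 0)"
proof -
  have "indicator {real j * h..<real (Suc j) * h} t = (if j = k then 1 else 0 :: real)" for j
  proof (cases "j = k")
    case False
    then consider "Suc j \<le> k" | "Suc k \<le> j" by linarith
    then have "t \<notin> {real j * h..<real (Suc j) * h}"
    proof cases
      case 1
      then have "real (Suc j) * h \<le> real k * h" using h by (intro mult_right_mono) auto
      then show ?thesis using k by auto
    next
      case 2
      then have "real (Suc k) * h \<le> real j * h" using h by (intro mult_right_mono) auto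
      then show ?thesis using k by auto
    qed
    then show ?thesis using False by simp
  qed (use k in simp)
  then have "step h n a t = (\<Sum>k'<n. if k' = k then a k' else 0)"
    unfolding step_def by (intro sum.cong) auto
  then show ?thesis by simp
qed

lemma step_neg: "0 < h \<Longrightarrow> t < 0 \<Longrightarrow> step h n a t = 0"
  unfolding step_def
proof (intro sum.neutral ballI)
  fix k assume "0 < h" "t < 0"
  moreover from this have "0 \<le> real k * h" by simp
  ultimately have "t \<notin> {real k * h..<real (Suc k) * h}" unfolding atLeastLessThan_iff by linarith
  then have "indicator {real k * h..<real (Suc k) * h} t = (0 :: real)" by (rule indicator_simps(2))
  then show "a k * indicator {real k * h..<real (Suc k) * h} t = 0" by (metis mult_zero_right)
qed

lemma grid_cases:
  assumes h: "0 < h" and t: "0 \<le> t"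
  obtains k where "real k * h \<le> t" "t < real (Suc k) * h"
proof -
  define k where "k = nat \<lfloor>t / h\<rfloor>"
  have "0 \<le> t / h" using assms by simp
  then have "real k \<le> t / h" "t / h < real k + 1"
    by (auto simp: k_def)
  then show ?thesis
    using h by (intro that[of k]) (auto simp: field_simps)
qed

lemma step_integral:
  assumes "0 < h"
  shows "has_bochner_integral lborel (step h n a) (\<Sum>k<n. a k * h)"
proof -
  have "has_bochner_integral lborel (\<lambda>t. a k * indicator {real k * h..<real (Suc k) * h} t) (a k * h)" for k
  proof -
    have "has_bochner_integral lborel (indicator {real k * h..<real (Suc k) * h} :: real \<Rightarrow> real)
        (measure lborel {real k * h..<real (Suc k) * h})"
      by (intro has_bochner_integral_real_indicator emeasure_bounded_finite bounded_Ico) auto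
    moreover have "measure lborel {real k * h..<real (Suc k) * h} = h"
      using assms by (simp add: measure_def algebra_simps)
    ultimately show ?thesis by (intro has_bochner_integral_mult_right) auto
  qed
  then show ?thesis
    unfolding step_def[abs_def] by (intro has_bochner_integral_sum)
qed

context disorder_process
begin

section \<open>Stopping times, and the value process on the grid\<close>

lemma generator_mono: "s \<le> t \<Longrightarrow> natural_generator M N s \<subseteq> natural_generator M N t"
  unfolding natural_generator_def by (auto intro: order_trans)

lemma sets_augmented:
  assumes u: "u = \<infinity> \<or> t < u"
  shows "sets (augmented_filtration M N t) \<subseteq> sigma_sets (space M) (natural_generator M N u \<union> null_sets M)"
proof -
  define X where "X = (\<Inter>u\<in>insert \<infinity> {t<..}. sigma_sets (space M) (natural_generator M N u \<union> null_sets M))"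
  have X: "X \<subseteq> sigma_sets (space M) (natural_generator M N u \<union> null_sets M)"
    unfolding X_def using u by (intro INF_lower) auto
  also have "\<dots> \<subseteq> Pow (space M)"
    using sigma_sets_into_sp[OF hist'_generator_Pow] by blast
  finally have "sets (augmented_filtration M N t) = sigma_sets (space M) X"
    unfolding augmented_filtration_def X_def[symmetric] by (rule sets_measure_of)
  then show ?thesis using sigma_sets_mono[OF X] by simp
qed

lemma in_augmented:
  assumes "\<And>u. u = \<infinity> \<or> t < u \<Longrightarrow> B \<in> sigma_sets (space M) (natural_generator M N u \<union> null_sets M)"
  shows "B \<in> sets (augmented_filtration M N t)"
proof -
  define X where "X = (\<Inter>u\<in>insert \<infinity> {t<..}. sigma_sets (space M) (natural_generator M N u \<union> null_sets M))"
  have "X \<subseteq> sigma_sets (space M) (natural_generator M N \<infinity> \<union> null_sets M)"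
    unfolding X_def by (intro INF_lower) auto
  also have "\<dots> \<subseteq> Pow (space M)"
    using sigma_sets_into_sp[OF hist'_generator_Pow] by blast
  finally have "sets (augmented_filtration M N t) = sigma_sets (space M) X"
    unfolding augmented_filtration_def X_def[symmetric] by (rule sets_measure_of)
  moreover have "B \<in> X" unfolding X_def using assms by auto
  ultimately show ?thesis by (simp add: sigma_sets.Basic)
qed

lemma space_augmented [simp]: "space (augmented_filtration M N t) = space M"
  unfolding augmented_filtration_def by (rule space_measure_of_conv)

lemma augmented_sets_M: "sets (augmented_filtration M N t) \<subseteq> sets M"
proof -
  have "sigma_sets (space M) (natural_generator M N \<infinity> \<union> null_sets M) \<subseteq> sets M"
    using natural_generator_sets by (intro sets.sigma_sets_subset) (auto simp: null_sets_def)
  then show ?thesis using sets_augmented[of \<infinity> t] by blast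
qed

lemma stopping_time_sets:
  assumes "stopping_time (augmented_filtration M N) \<tau>"
  shows "{w \<in> space M. \<tau> w \<le> t} \<in> sets (augmented_filtration M N t)"
  using stopping_timeD[OF assms, of t] unfolding pred_def by simp

lemma stopping_time_measurable:
  assumes "stopping_time (augmented_filtration M N) \<tau>"
  shows "\<tau> \<in> borel_measurable M"
  by (rule borel_measurableI_le) (use stopping_time_sets[OF assms] augmented_sets_M in blast)

text \<open>The complement is a countable union of events of being stopped by times strictly before
  s, and at such times the right-continuous enlargement looks no further than s. At s = 0 there is
  no earlier time, but the event is the whole space.\<close>

lemma not_yet_stopped:
  assumes \<tau>: "stopping_time (augmented_filtration M N) \<tau>" and s: "0 \<le> s"
  shows "{w \<in> space M. ennreal s \<le> \<tau> w} \<in> sets (hist' s)"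
proof (cases "s = 0")
  case True
  then have "{w \<in> space M. ennreal s \<le> \<tau> w} = space (hist' s)" by auto
  then show ?thesis by (simp only: sets.top)
next
  case False
  then have s: "0 < s" using s by simp
  define q where "q j = s * (1 - 1 / real (Suc j))" for j
  have q: "0 \<le> q j" "q j < s" for j
    using s by (auto simp: q_def field_simps)
  have "{w \<in> space M. \<tau> w \<le> ennreal (q j)} \<in> sets (hist' s)" for j
  proof -
    have "ennreal (q j) < ennreal s" using q[of j] by (simp add: ennreal_lessI s)
    then show ?thesis
      using stopping_time_sets[OF \<tau>, of "ennreal (q j)"] sets_augmented[of "ennreal s" "ennreal (q j)"]
      unfolding sets_hist' by blast
  qed
  then have "(\<Union>j. {w \<in> space M. \<tau> w \<le> ennreal (q j)}) \<in> sets (hist' s)"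
    by (intro sets.countable_UN) auto
  also have "(\<Union>j. {w \<in> space M. \<tau> w \<le> ennreal (q j)}) = {w \<in> space M. \<tau> w < ennreal s}"
  proof (intro set_eqI iffI)
    fix w assume "w \<in> (\<Union>j. {w \<in> space M. \<tau> w \<le> ennreal (q j)})"
    then obtain j where "w \<in> space M" "\<tau> w \<le> ennreal (q j)" by auto
    moreover have "ennreal (q j) < ennreal s" using q[of j] by (simp add: ennreal_lessI s)
    ultimately show "w \<in> {w \<in> space M. \<tau> w < ennreal s}" by (auto intro: le_less_trans)
  next
    fix w assume w: "w \<in> {w \<in> space M. \<tau> w < ennreal s}"
    then obtain x where x: "0 \<le> x" "\<tau> w = ennreal x"
      by (cases "\<tau> w") auto
    then have "x < s" using w by (simp add: ennreal_less_iff)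
    then have "0 < 1 - x / s" using s by simp
    then obtain j where "1 / real (Suc j) < 1 - x / s"
      using reals_Archimedean[of "1 - x / s"] by (auto simp: inverse_eq_divide)
    then have "x / s * s \<le> (1 - 1 / real (Suc j)) * s" using s by (intro mult_right_mono) auto
    then have "x \<le> q j" using s by (simp add: q_def mult.commute)
    then show "w \<in> (\<Union>j. {w \<in> space M. \<tau> w \<le> ennreal (q j)})"
      using w x by (auto intro!: exI[of _ j] ennreal_leI)
  qed
  finally have "space (hist' s) - {w \<in> space M. \<tau> w < ennreal s} \<in> sets (hist' s)"
    by (rule sets.compl_sets)
  also have "space (hist' s) - {w \<in> space M. \<tau> w < ennreal s} = {w \<in> space M. ennreal s \<le> \<tau> w}"
    by auto
  finally show ?thesis .
qed

text \<open>\<open>Z\<close> is the discounted value at grid time k h and \<open>W\<close> the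
  discounted rate that compensates its change.\<close>

definition Z :: "real \<Rightarrow> nat \<Rightarrow> 'a \<Rightarrow> real" where
  "Z h k w = exp (- lam * (real k * h)) * v (path (real k * h) w)"

definition W :: "real \<Rightarrow> nat \<Rightarrow> 'a \<Rightarrow> real" where
  "W h k w = exp (- lam * (real k * h)) * ell (path (real k * h) w)"

lemma Z_nonpos: "w \<in> space M \<Longrightarrow> 0 \<le> h \<Longrightarrow> Z h k w \<le> 0"
  using v_le[OF path_in_Q] by (simp add: Z_def mult_le_0_iff)

lemma Z_ge:
  assumes "w \<in> space M" "0 \<le> h"
  shows "- bnd * exp (- lam * (real k * h)) \<le> Z h k w"
  using v_ge[OF path_in_Q[OF assms(1)], of "real k * h"] assms(2)
    mult_left_mono[of "- bnd" "v (path (real k * h) w)" "exp (- lam * (real k * h))"]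
  by (simp add: Z_def mult.commute)

lemma Z_0: "w \<in> space M \<Longrightarrow> Z h 0 w = v p0"
  by (simp add: Z_def path_0)

lemma exp_lam_le_1: "0 \<le> x \<Longrightarrow> exp (- lam * x) \<le> 1"
  using lam_pos by simp

lemma Z_abs: "w \<in> space M \<Longrightarrow> 0 \<le> h \<Longrightarrow> \<bar>Z h k w\<bar> \<le> bnd"
  using v_bound[OF path_in_Q, of w "real k * h"] exp_lam_le_1[of "real k * h"]
    mult_mono[of "exp (- lam * (real k * h))" 1 "\<bar>v (path (real k * h) w)\<bar>" bnd]
  by (simp add: Z_def abs_mult)

lemma W_abs: "w \<in> space M \<Longrightarrow> 0 \<le> h \<Longrightarrow> \<bar>W h k w\<bar> \<le> ellbd"
  using ell_bound[OF path_in_Q, of w "real k * h"] exp_lam_le_1[of "real k * h"]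
    mult_mono[of "exp (- lam * (real k * h))" 1 "\<bar>ell (path (real k * h) w)\<bar>" ellbd]
  by (simp add: W_def abs_mult)

lemma Z_measurable: "0 \<le> h \<Longrightarrow> Z h k \<in> borel_measurable M"
  and W_measurable: "0 \<le> h \<Longrightarrow> W h k \<in> borel_measurable M"
  unfolding Z_def[abs_def] W_def[abs_def]
  using function_of_path(2)[OF continuous_v, of "real k * h"] function_of_path(2)[OF continuous_ell, of "real k * h"]
  by (auto intro: borel_measurable_times borel_measurable_const)

lemma indicator_integrable:
  fixes X :: "'a \<Rightarrow> real"
  assumes [measurable]: "X \<in> borel_measurable M" "A \<in> sets M" and bd: "\<And>w. w \<in> space M \<Longrightarrow> \<bar>X w\<bar> \<le> B"
  shows "integrable M (\<lambda>w. indicator A w * X w)"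
proof (rule integrable_bounded)
  show "\<bar>indicator A w * X w\<bar> \<le> B" if "w \<in> space M" for w
    using bd[OF that] by (auto simp: indicator_def)
qed measurable

lemma integrable_Z_increment:
  assumes h: "0 \<le> h" and A: "A \<in> sets M"
  shows "integrable M (\<lambda>w. indicator A w * (Z h (Suc k) w - Z h k w))"
proof (rule indicator_integrable[OF _ A])
  show "(\<lambda>w. Z h (Suc k) w - Z h k w) \<in> borel_measurable M"
    by (intro borel_measurable_diff Z_measurable h)
  show "\<bar>Z h (Suc k) w - Z h k w\<bar> \<le> bnd + bnd" if "w \<in> space M" for w
    using Z_abs[OF that h, of k] Z_abs[OF that h, of "Suc k"] by linarith
qed

lemma integrable_W:
  assumes h: "0 \<le> h" and A: "A \<in> sets M"
  shows "integrable M (\<lambda>w. indicator A w * W h k w)"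
  by (rule indicator_integrable[OF W_measurable[OF h] A W_abs[OF _ h]])

lemma expectation_sums:
  fixes x y :: "nat \<Rightarrow> 'a \<Rightarrow> real"
  assumes "\<And>k. integrable M (x k)" "\<And>k. integrable M (y k)"
  shows "expectation (\<lambda>w. (\<Sum>k<n. x k w) * h - (\<Sum>k<n. y k w) * h - d1 - d2) =
    (\<Sum>k<n. expectation (x k)) * h - (\<Sum>k<n. expectation (y k)) * h - d1 - d2"
  using assms by (simp add: prob_space)

lemma grid_sum:
  obtains C where "0 \<le> C" "\<And>h n A. 0 < h \<Longrightarrow> h \<le> 1 \<Longrightarrow> (\<And>k. A k \<in> sets (hist' (real k * h))) \<Longrightarrow>
    \<bar>(\<Sum>k<n. expectation (\<lambda>w. indicator (A k) w * (Z h (Suc k) w - Z h k w)))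
      + (\<Sum>k<n. expectation (\<lambda>w. indicator (A k) w * W h k w)) * h\<bar> \<le> real n * (C * h\<^sup>2)"
proof -
  obtain C where C: "0 \<le> C" "\<And>t h A. 0 \<le> t \<Longrightarrow> 0 < h \<Longrightarrow> h \<le> 1 \<Longrightarrow> A \<in> sets (hist' t) \<Longrightarrow>
    \<bar>\<integral>w. indicator A w * (exp (- lam * h) * v (path (t + h) w) - v (path t w) + h * ell (path t w)) \<partial>M\<bar> \<le> C * h\<^sup>2"
    using one_step by blast
  show ?thesis
  proof (rule that[OF C(1)])
    fix h :: real and n A assume h: "0 < h" "h \<le> 1" and A: "\<And>k. A k \<in> sets (hist' (real k * h))"
    have AM: "A k \<in> sets M" for k using A[of k] sets_hist'_subset by blast
    have h0: "0 \<le> h" using h by simp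
    have iZ: "integrable M (\<lambda>w. indicator (A k) w * (Z h (Suc k) w - Z h k w))" for k
      by (rule integrable_Z_increment[OF h0 AM])
    have iW: "integrable M (\<lambda>w. indicator (A k) w * W h k w)" for k
      by (rule integrable_W[OF h0 AM])
    have "\<bar>expectation (\<lambda>w. indicator (A k) w * (Z h (Suc k) w - Z h k w))
        + expectation (\<lambda>w. indicator (A k) w * W h k w) * h\<bar> \<le> C * h\<^sup>2" for k
    proof -
      define t where "t = real k * h"
      have t: "0 \<le> t" using h by (simp add: t_def)
      have tS: "real (Suc k) * h = t + h" by (simp add: t_def algebra_simps)
      have "expectation (\<lambda>w. indicator (A k) w * (Z h (Suc k) w - Z h k w))
          + expectation (\<lambda>w. indicator (A k) w * W h k w) * h
          = expectation (\<lambda>w. indicator (A k) w * (Z h (Suc k) w - Z h k w) + indicator (A k) w * W h k w * h)"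
        using iZ iW by simp
      also have "\<dots> = expectation (\<lambda>w. exp (- lam * t) *
          (indicator (A k) w * (exp (- lam * h) * v (path (t + h) w) - v (path t w) + h * ell (path t w))))"
      proof -
        have "exp (- lam * (t + h)) = exp (- lam * t) * exp (- lam * h)"
          by (simp add: algebra_simps flip: exp_add)
        then show ?thesis
          unfolding Z_def W_def tS t_def[symmetric]
          by (intro Bochner_Integration.integral_cong) (simp_all add: algebra_simps)
      qed
      also have "\<dots> = exp (- lam * t) * expectation (\<lambda>w.
          indicator (A k) w * (exp (- lam * h) * v (path (t + h) w) - v (path t w) + h * ell (path t w)))"
        by simp
      finally have "\<bar>expectation (\<lambda>w. indicator (A k) w * (Z h (Suc k) w - Z h k w))
          + expectation (\<lambda>w. indicator (A k) w * W h k w) * h\<bar>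
          = exp (- lam * t) * \<bar>expectation (\<lambda>w.
          indicator (A k) w * (exp (- lam * h) * v (path (t + h) w) - v (path t w) + h * ell (path t w)))\<bar>"
        by (simp add: abs_mult)
      also have "\<dots> \<le> 1 * (C * h\<^sup>2)"
        using C(2)[OF t h A[of k, folded t_def]] exp_lam_le_1[OF t] by (intro mult_mono) auto
      finally show ?thesis by simp
    qed
    then have "\<bar>\<Sum>k<n. expectation (\<lambda>w. indicator (A k) w * (Z h (Suc k) w - Z h k w))
        + expectation (\<lambda>w. indicator (A k) w * W h k w) * h\<bar> \<le> (\<Sum>k<n. C * h\<^sup>2)"
      by (intro order_trans[OF sum_abs] sum_mono)
    then show "\<bar>(\<Sum>k<n. expectation (\<lambda>w. indicator (A k) w * (Z h (Suc k) w - Z h k w)))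
      + (\<Sum>k<n. expectation (\<lambda>w. indicator (A k) w * W h k w)) * h\<bar> \<le> real n * (C * h\<^sup>2)"
      by (simp add: sum.distrib sum_distrib_right)
  qed
qed

lemma telescoping_bound:
  assumes w: "w \<in> space M" and h: "0 \<le> h" and decr: "\<And>k. A (Suc k) \<subseteq> A k"
  shows "(\<Sum>k<n. indicator (A k) w * (Z h (Suc k) w - Z h k w)) \<le> - v p0"
proof -
  have "(\<Sum>k<n. indicator (A k) w * (Z h (Suc k) w - Z h k w)) \<le> - v p0 + indicator (A n) w * Z h n w"
  proof (induction n)
    case 0
    then show ?case using Z_0[OF w] v_le[OF p0] by (auto simp: indicator_def)
  next
    case (Suc n)
    have "indicator (A n) w * Z h (Suc n) w \<le> indicator (A (Suc n)) w * Z h (Suc n) w"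
      using decr[of n] Z_nonpos[OF w h, of "Suc n"] by (auto simp: indicator_def)
    then show ?case using Suc by (simp add: right_diff_distrib)
  qed
  also have "\<dots> \<le> - v p0" using Z_nonpos[OF w h, of n] by (auto simp: indicator_def)
  finally show ?thesis .
qed

lemma exp_lam_diff:
  assumes "0 \<le> s" "s \<le> t" "t \<le> s + h"
  shows "\<bar>exp (- lam * t) - exp (- lam * s)\<bar> \<le> lam * h"
proof -
  have "exp (- lam * s) - exp (- lam * t) = exp (- lam * s) * (1 - exp (- (lam * (t - s))))"
    by (simp add: algebra_simps flip: exp_add)
  also have "\<dots> \<le> 1 * (lam * (t - s))"
    using exp_minus_bounds[of "lam * (t - s)"] lam_pos assms by (intro mult_mono exp_lam_le_1) auto
  also have "\<dots> \<le> lam * h" using lam_pos assms by simp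
  finally show ?thesis using lam_pos assms by simp
qed

lemma no_jump_between:
  assumes "w \<in> space M" "0 \<le> s" "s \<le> t" "t \<le> s + h" "inc s h w = 0"
  shows "path t w = F (t - s) (path s w)"
proof -
  have "N s w \<le> N t w" "N t w \<le> N (s + h) w"
    using assms by (auto intro!: N_mono)
  then have "N (s + (t - s)) w = N s w"
    using assms(5) by (simp add: inc_def)
  then show ?thesis
    using path_no_jump[OF assms(1,2), of "t - s"] assms(3) by simp
qed

text \<open>Without a jump the flow modulus and the slow change of the discount suffice; with a
  jump, which is rare, both terms are bounded crudely.\<close>

lemma ell_on_interval:
  obtains C where "0 \<le> C" "\<And>w s t h. w \<in> space M \<Longrightarrow> 0 \<le> s \<Longrightarrow> h \<le> 1 \<Longrightarrow> s \<le> t \<Longrightarrow> t \<le> s + h \<Longrightarrow>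
    \<bar>exp (- lam * t) * ell (path t w) - exp (- lam * s) * ell (path s w)\<bar>
      \<le> C * h + 2 * ellbd * indicator (inc_event s h {1..}) w"
proof -
  obtain C where C: "0 \<le> C" "\<And>q u. q \<in> Q \<Longrightarrow> 0 \<le> u \<Longrightarrow> u \<le> 1 \<Longrightarrow> \<bar>ell (F u q) - ell q\<bar> \<le> C * u"
    using ell_flow_modulus by blast
  show ?thesis
  proof (rule that[of "C + lam * ellbd"])
    show "0 \<le> C + lam * ellbd" using C(1) lam_pos ellbd_pos by simp
    fix w s t h assume w: "w \<in> space M" and s: "0 \<le> s" and h: "h \<le> (1::real)" and t: "s \<le> t" "t \<le> s + h"
    have t0: "0 \<le> t" using s t by simp
    have e: "exp (- lam * t) \<le> 1" "exp (- lam * s) \<le> 1"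
      using exp_lam_le_1[OF t0] exp_lam_le_1[OF s] by auto
    have b: "\<bar>ell (path t w)\<bar> \<le> ellbd" "\<bar>ell (path s w)\<bar> \<le> ellbd"
      using ell_bound path_in_Q[OF w] s t0 by auto
    show "\<bar>exp (- lam * t) * ell (path t w) - exp (- lam * s) * ell (path s w)\<bar>
      \<le> (C + lam * ellbd) * h + 2 * ellbd * indicator (inc_event s h {1..}) w"
    proof (cases "inc s h w = 0")
      case True
      have "\<bar>ell (path t w) - ell (path s w)\<bar> \<le> C * (t - s)"
        unfolding no_jump_between[OF w s t True] using t h by (intro C(2) path_in_Q w s) auto
      also have "\<dots> \<le> C * h" using C(1) t by (intro mult_left_mono) auto
      finally have "\<bar>exp (- lam * t) * (ell (path t w) - ell (path s w))\<bar> \<le> 1 * (C * h)"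
        unfolding abs_mult using e by (intro mult_mono) auto
      moreover have "\<bar>(exp (- lam * t) - exp (- lam * s)) * ell (path s w)\<bar> \<le> lam * h * ellbd"
        unfolding abs_mult using exp_lam_diff[OF s t] b ellbd_pos lam_pos t by (intro mult_mono) auto
      moreover have "exp (- lam * t) * ell (path t w) - exp (- lam * s) * ell (path s w) =
          exp (- lam * t) * (ell (path t w) - ell (path s w)) + (exp (- lam * t) - exp (- lam * s)) * ell (path s w)"
        by (simp add: algebra_simps)
      moreover have "0 \<le> 2 * ellbd * indicator (inc_event s h {1..}) w" using ellbd_pos by simp
      moreover have "(C + lam * ellbd) * h = 1 * (C * h) + lam * h * ellbd" by (simp add: algebra_simps)
      ultimately show ?thesis by linarith
    next
      case False
      then have "indicator (inc_event s h {1..}) w = (1::real)" using w by (simp add: inc_event_def)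
      moreover have "\<bar>exp (- lam * t) * ell (path t w)\<bar> \<le> 1 * ellbd" "\<bar>exp (- lam * s) * ell (path s w)\<bar> \<le> 1 * ellbd"
        unfolding abs_mult using e b ellbd_pos by (intro mult_mono; simp)+
      moreover have "0 \<le> (C + lam * ellbd) * h" using C(1) lam_pos ellbd_pos t by simp
      ultimately show ?thesis by simp
    qed
  qed
qed

lemma joint_measurable:
  assumes f: "continuous_on Q f" and \<tau> [measurable]: "\<tau> \<in> borel_measurable M"
  shows "(\<lambda>(w, t). indicator {t. 0 \<le> t \<and> ennreal t \<le> \<tau> w} t * (exp (- lam * t) * f (path t w)))
    \<in> borel_measurable (M \<Otimes>\<^sub>M lborel)"
proof -
  have "(\<lambda>x. (\<lambda>y. path (max 0 (fst y)) (snd y)) (snd x, fst x)) \<in> borel_measurable (M \<Otimes>\<^sub>M lborel)"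
    by (rule measurable_compose[OF _ path_joint_measurable]) measurable
  then have [measurable]: "(\<lambda>x. f (path (max 0 (snd x)) (fst x))) \<in> borel_measurable (M \<Otimes>\<^sub>M lborel)"
    by (intro measurable_on_Q[OF f]) (auto simp: space_pair_measure intro: path_in_Q)
  have "(\<lambda>x. if 0 \<le> snd x \<and> ennreal (snd x) \<le> \<tau> (fst x) then exp (- lam * snd x) * f (path (max 0 (snd x)) (fst x)) else 0)
      \<in> borel_measurable (M \<Otimes>\<^sub>M lborel)"
    by measurable
  also have "(\<lambda>x. if 0 \<le> snd x \<and> ennreal (snd x) \<le> \<tau> (fst x) then exp (- lam * snd x) * f (path (max 0 (snd x)) (fst x)) else 0)
      = (\<lambda>(w, t). indicator {t. 0 \<le> t \<and> ennreal t \<le> \<tau> w} t * (exp (- lam * t) * f (path t w)))"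
    by (auto simp: fun_eq_iff indicator_def)
  finally show ?thesis .
qed

lemma cost_eq: "stopping_cost lam \<mu> c m M \<sigma> p0 \<tau> = ereal_integral M (\<lambda>w. ereal_integral lborel (\<lambda>t.
    ereal (indicator {t. 0 \<le> t \<and> ennreal t \<le> \<tau> w} t * (exp (- lam * t) * g (path t w)))))"
  unfolding stopping_cost_def path_def ..

text \<open>Replacing the cost by \<open>ell\<close> lowers it and makes it integrable. The integral
  of \<open>ell\<close> up to \<tau> is then bounded below by a Riemann sum over the cells begun
  before or at \<tau>, and \<open>grid_sum\<close> with \<open>telescoping_bound\<close> compares
  that sum with \<open>v p0\<close>.\<close>

lemma cost_lower_bound:
  assumes \<tau>: "stopping_time (augmented_filtration M N) \<tau>"
  shows "ereal (v p0) \<le> stopping_cost lam \<mu> c m M \<sigma> p0 \<tau>"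
proof -
  have \<tau>M [measurable]: "\<tau> \<in> borel_measurable M" by (rule stopping_time_measurable[OF \<tau>])
  define f where "f w t = indicator {t. 0 \<le> t \<and> ennreal t \<le> \<tau> w} t * (exp (- lam * t) * ell (path t w))" for w t
  define L where "L w = (\<integral>t. f w t \<partial>lborel)" for w
  have f_joint: "(\<lambda>(w, t). f w t) \<in> borel_measurable (M \<Otimes>\<^sub>M lborel)"
    unfolding f_def by (rule joint_measurable[OF continuous_ell \<tau>M])
  have f_meas: "f w \<in> borel_measurable lborel" if "w \<in> space M" for w
    using measurable_Pair2[OF f_joint that] by simp
  have tail: "has_bochner_integral lborel (\<lambda>t. ellbd * (indicator {T..} t * exp (- lam * t))) (ellbd * (exp (- lam * T) / lam))" for T
    by (intro has_bochner_integral_mult_right exp_tail_has_integral lam_pos)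
  have f_abs: "\<bar>f w t\<bar> \<le> ellbd * (indicator {0..} t * exp (- lam * t))" if "w \<in> space M" for w t
  proof (cases "0 \<le> t \<and> ennreal t \<le> \<tau> w")
    case True
    have "exp (- lam * t) * \<bar>ell (path t w)\<bar> \<le> exp (- lam * t) * ellbd"
      using True by (intro mult_left_mono ell_bound path_in_Q that) auto
    then show ?thesis using True by (simp add: f_def abs_mult mult.commute)
  qed (use ellbd_pos in \<open>auto simp: f_def\<close>)
  have f_int: "integrable lborel (f w)" if "w \<in> space M" for w
  proof (rule Bochner_Integration.integrable_bound[OF _ f_meas[OF that]])
    show "integrable lborel (\<lambda>t. ellbd * (indicator {0..} t * exp (- lam * t)))"
      using tail[of 0] by (auto simp: has_bochner_integral_iff)
    show "AE t in lborel. norm (f w t) \<le> norm (ellbd * (indicator {0..} t * exp (- lam * t)))"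
      using order_trans[OF f_abs[OF that] abs_ge_self] by (auto intro!: AE_I2)
  qed
  have L_meas: "L \<in> borel_measurable M"
    unfolding L_def[abs_def] by (rule lborel.borel_measurable_lebesgue_integral[OF f_joint])
  have L_int: "integrable M L"
  proof (rule integrable_bounded[OF L_meas])
    fix w assume w: "w \<in> space M"
    have "\<bar>L w\<bar> \<le> (\<integral>t. \<bar>f w t\<bar> \<partial>lborel)" unfolding L_def by (rule integral_abs_bound)
    also have "\<dots> \<le> (\<integral>t. ellbd * (indicator {0..} t * exp (- lam * t)) \<partial>lborel)"
      using f_int[OF w] tail[of 0] f_abs[OF w] by (intro integral_mono) (auto simp: has_bochner_integral_iff)
    also have "\<dots> = ellbd * (exp (- lam * 0) / lam)" using tail[of 0] by (simp add: has_bochner_integral_iff)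
    finally show "\<bar>L w\<bar> \<le> ellbd * (exp (- lam * 0) / lam)" .
  qed
  have "ereal (expectation L) = ereal_integral M (\<lambda>w. ereal (L w))"
    by (rule ereal_integral_eq_lebesgue[OF L_int, symmetric])
  also have "\<dots> = ereal_integral M (\<lambda>w. ereal_integral lborel (\<lambda>t. ereal (f w t)))"
    by (intro ereal_integral_cong) (simp add: ereal_integral_eq_lebesgue[OF f_int] L_def)
  also have "\<dots> \<le> stopping_cost lam \<mu> c m M \<sigma> p0 \<tau>"
    unfolding cost_eq f_def
    by (intro ereal_integral_mono) (auto intro!: mult_left_mono ell_le_g)
  finally have cost: "ereal (expectation L) \<le> stopping_cost lam \<mu> c m M \<sigma> p0 \<tau>" .
  obtain C1 where C1: "0 \<le> C1" "\<And>h n A. 0 < h \<Longrightarrow> h \<le> 1 \<Longrightarrow> (\<And>k. A k \<in> sets (hist' (real k * h))) \<Longrightarrow>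
    \<bar>(\<Sum>k<n. expectation (\<lambda>w. indicator (A k) w * (Z h (Suc k) w - Z h k w)))
      + (\<Sum>k<n. expectation (\<lambda>w. indicator (A k) w * W h k w)) * h\<bar> \<le> real n * (C1 * h\<^sup>2)"
    by (rule grid_sum) blast
  obtain C2 where C2: "0 \<le> C2" "\<And>w s t h. w \<in> space M \<Longrightarrow> 0 \<le> s \<Longrightarrow> h \<le> 1 \<Longrightarrow> s \<le> t \<Longrightarrow> t \<le> s + h \<Longrightarrow>
    \<bar>exp (- lam * t) * ell (path t w) - exp (- lam * s) * ell (path s w)\<bar>
      \<le> C2 * h + 2 * ellbd * indicator (inc_event s h {1..}) w"
    by (rule ell_on_interval) blast
  have main: "v p0 - (real n * (C1 * h\<^sup>2) + real n * ((C2 + 2 * ellbd * \<mu>) * h\<^sup>2) + ellbd * h + ellbd * (exp (- lam * (real n * h)) / lam)) \<le> expectation L"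
    if h: "0 < h" "h \<le> 1" for h and n :: nat
  proof -
    define T where "T = real n * h"
    define A where "A k = {w \<in> space M. ennreal (real k * h) \<le> \<tau> w}" for k
    have A: "A k \<in> sets (hist' (real k * h))" for k
      unfolding A_def using h by (intro not_yet_stopped[OF \<tau>]) simp
    have AM: "A k \<in> sets M" for k using A[of k] sets_hist'_subset by blast
    have decr: "A (Suc k) \<subseteq> A k" for k
    proof -
      have "ennreal (real k * h) \<le> ennreal (real (Suc k) * h)"
        using h by (intro ennreal_leI mult_right_mono) auto
      then show ?thesis by (auto simp: A_def intro: order_trans)
    qed
    define J where "J k = inc_event (real k * h) h {1..}" for k
    have J: "J k \<in> sets M" for k unfolding J_def using h by (intro inc_event_sets) auto
    define b where "b w k = C2 * h + 2 * ellbd * indicator (J k) w" for w k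
    have path: "(\<Sum>k<n. indicator (A k) w * W h k w) * h - (\<Sum>k<n. b w k) * h - ellbd * h - ellbd * (exp (- lam * T) / lam) \<le> L w"
      if w: "w \<in> space M" for w
    proof -
      \<comment> \<open>Covers the part of the last cell after \<tau>, where the sum still counts
        but the cost has stopped. For \<tau> = \<infinity> the conversion gives 0 and D is a
        spurious interval; this is harmless, since D only lowers r.\<close>
      define D where "D = {enn2real (\<tau> w)<..enn2real (\<tau> w) + h}"
      define r where "r t = step h n (\<lambda>k. indicator (A k) w * W h k w) t - step h n (b w) t - ellbd * indicator D t
          - ellbd * (indicator {T..} t * exp (- lam * t))" for t
      have "has_bochner_integral lborel (indicator D :: real \<Rightarrow> real) (measure lborel D)"
        unfolding D_def by (intro has_bochner_integral_real_indicator emeasure_bounded_finite bounded_Ioc) auto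
      then have "has_bochner_integral lborel (indicator D :: real \<Rightarrow> real) h"
        using h by (simp add: D_def measure_def)
      then have "has_bochner_integral lborel r ((\<Sum>k<n. indicator (A k) w * W h k w * h) - (\<Sum>k<n. b w k * h) - ellbd * h - ellbd * (exp (- lam * T) / lam))"
        unfolding r_def[abs_def]
        by (intro has_bochner_integral_diff has_bochner_integral_mult_right step_integral h exp_tail_has_integral lam_pos)
      then have r: "integrable lborel r" "(\<integral>t. r t \<partial>lborel) = (\<Sum>k<n. indicator (A k) w * W h k w) * h - (\<Sum>k<n. b w k) * h - ellbd * h - ellbd * (exp (- lam * T) / lam)"
        by (simp_all only: has_bochner_integral_iff sum_distrib_right)
      have b0: "0 \<le> b w k" for k using C2(1) h ellbd_pos by (simp add: b_def)
      have "r t \<le> f w t" for t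
      proof (cases "0 \<le> t")
        case False
        have "0 \<le> ellbd * indicator D t" "0 \<le> ellbd * (indicator {T..} t * exp (- lam * t))" using ellbd_pos by auto
        then show ?thesis using False step_neg[OF h(1), of t] by (simp add: r_def f_def)
      next
        case True
        obtain k where k: "real k * h \<le> t" "t < real (Suc k) * h" using grid_cases[OF h(1) True] by blast
        have k0: "0 \<le> real k * h" using h by simp
        have "real (Suc k) * h = real k * h + h" by (simp add: algebra_simps)
        then have kt: "t \<le> real k * h + h" using k by simp
        have nnD: "0 \<le> ellbd * indicator D t" and nnT: "0 \<le> ellbd * (indicator {T..} t * exp (- lam * t))" using ellbd_pos by auto
        have r_eq: "r t = (if k < n then indicator (A k) w * W h k w - b w k else 0) - ellbd * indicator D t
            - ellbd * (indicator {T..} t * exp (- lam * t))"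
          unfolding r_def step_eq[OF h(1) k] by simp
        show ?thesis
        proof (cases "k < n")
          case False
          then have "real n * h \<le> real k * h" using h by (intro mult_right_mono) auto
          then have "T \<le> t" using k by (simp add: T_def)
          then show ?thesis
            using False nnD f_abs[OF w, of t] True by (simp add: r_eq)
        next
          case kn: True
          show ?thesis
          proof (cases "ennreal t \<le> \<tau> w")
            case stop: True
            then have "w \<in> A k"
              using k(1) w by (auto simp: A_def intro: order_trans[OF ennreal_leI])
            moreover have "W h k w - b w k \<le> f w t"
              using C2(2)[OF w k0 h(2) k(1) kt] True stop by (simp add: f_def W_def b_def J_def abs_le_iff)
            ultimately show ?thesis using kn nnD nnT by (simp add: r_eq)
          next
            case False
            then have f0: "f w t = 0" by (simp add: f_def)
            show ?thesis
            proof (cases "w \<in> A k")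
              case True
              obtain x where x: "0 \<le> x" "\<tau> w = ennreal x" using False by (cases "\<tau> w") auto
              have "real k * h \<le> x" using True x k0 by (simp add: A_def ennreal_le_iff)
              moreover have "x < t" using False x by (simp add: ennreal_le_iff not_le ennreal_leI leI)
                 (meson False ennreal_leI not_le x(2))?
              ultimately have "t \<in> D" using x kt by (simp add: D_def)
              then have "r t = W h k w - b w k - ellbd - ellbd * (indicator {T..} t * exp (- lam * t))"
                using kn True by (simp add: r_eq)
              then show ?thesis
                using nnT b0[of k] W_abs[OF w, of h k] h unfolding f0 by linarith
            qed (use kn nnD nnT b0[of k] in \<open>simp add: r_eq f0\<close>)
          qed
        qed
      qed
      then have "(\<integral>t. r t \<partial>lborel) \<le> L w"
        unfolding L_def by (intro integral_mono r f_int w)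
      then show ?thesis unfolding r(2) .
    qed
    have h0: "0 \<le> h" using h by simp
    have iW: "integrable M (\<lambda>w. indicator (A k) w * W h k w)" for k
      by (rule integrable_W[OF h0 AM])
    have ib: "integrable M (\<lambda>w. b w k)" for k
      unfolding b_def using J[of k] by (auto simp: emeasure_eq_measure)
    have Eb: "expectation (\<lambda>w. b w k) \<le> (C2 + 2 * ellbd * \<mu>) * h" for k
    proof -
      have "expectation (\<lambda>w. b w k) = C2 * h + 2 * ellbd * prob (J k)"
        unfolding b_def using J[of k] by (subst Bochner_Integration.integral_add) (auto simp: emeasure_eq_measure prob_space)
      also have "\<dots> \<le> C2 * h + 2 * ellbd * (\<mu> * h)"
        unfolding J_def using prob_inc_pos(1)[of "real k * h" h] h ellbd_pos C2(1) by (intro add_mono mult_left_mono) auto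
      finally show ?thesis by (simp add: algebra_simps)
    qed
    have "expectation (\<lambda>w. (\<Sum>k<n. indicator (A k) w * W h k w) * h - (\<Sum>k<n. b w k) * h - ellbd * h - ellbd * (exp (- lam * T) / lam))
        \<le> expectation L"
      using path iW ib L_int
      by (intro integral_mono Bochner_Integration.integrable_diff Bochner_Integration.integrable_mult_left Bochner_Integration.integrable_sum) auto
    also have "expectation (\<lambda>w. (\<Sum>k<n. indicator (A k) w * W h k w) * h - (\<Sum>k<n. b w k) * h - ellbd * h - ellbd * (exp (- lam * T) / lam))
        = (\<Sum>k<n. expectation (\<lambda>w. indicator (A k) w * W h k w)) * h - (\<Sum>k<n. expectation (\<lambda>w. b w k)) * h - ellbd * h - ellbd * (exp (- lam * T) / lam)"
      by (rule expectation_sums[OF iW ib])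
    finally have 1: "(\<Sum>k<n. expectation (\<lambda>w. indicator (A k) w * W h k w)) * h - (\<Sum>k<n. expectation (\<lambda>w. b w k)) * h - ellbd * h - ellbd * (exp (- lam * T) / lam) \<le> expectation L" .
    have "(\<Sum>k<n. expectation (\<lambda>w. b w k)) * h \<le> (\<Sum>k<n. (C2 + 2 * ellbd * \<mu>) * h) * h"
      using h by (intro mult_right_mono sum_mono Eb) auto
    then have 2: "(\<Sum>k<n. expectation (\<lambda>w. b w k)) * h \<le> real n * ((C2 + 2 * ellbd * \<mu>) * h\<^sup>2)"
      by (simp add: power2_eq_square)
    have iZ: "integrable M (\<lambda>w. indicator (A k) w * (Z h (Suc k) w - Z h k w))" for k
      by (rule integrable_Z_increment[OF h0 AM])
    have "(\<Sum>k<n. expectation (\<lambda>w. indicator (A k) w * (Z h (Suc k) w - Z h k w)))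
        = expectation (\<lambda>w. \<Sum>k<n. indicator (A k) w * (Z h (Suc k) w - Z h k w))"
      by (rule Bochner_Integration.integral_sum[OF iZ, symmetric])
    also have "\<dots> \<le> expectation (\<lambda>_. - v p0)"
      using iZ by (intro integral_mono Bochner_Integration.integrable_sum telescoping_bound h0 decr) auto
    finally have 3: "(\<Sum>k<n. expectation (\<lambda>w. indicator (A k) w * (Z h (Suc k) w - Z h k w))) \<le> - v p0"
      by (simp add: prob_space)
    have 4: "- (real n * (C1 * h\<^sup>2)) \<le> (\<Sum>k<n. expectation (\<lambda>w. indicator (A k) w * (Z h (Suc k) w - Z h k w)))
      + (\<Sum>k<n. expectation (\<lambda>w. indicator (A k) w * W h k w)) * h"
      using C1(2)[OF h A, of n] by (simp add: abs_le_iff)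
    show ?thesis using 1 2 3 4 unfolding T_def by linarith
  qed
  have "v p0 \<le> expectation L"
  proof (rule LIMSEQ_le_const2)
    \<comment> \<open>With x = j + 1, mesh \<open>1 / x\<^sup>2\<close> and x ^ 3 steps, the horizon
      is x and tends to infinity, while the number of steps times the squared mesh is 1 / x and
      tends to 0.\<close>
    let ?e = "\<lambda>j. real ((Suc j) ^ 3) * (C1 * (1 / (real (Suc j))\<^sup>2)\<^sup>2) + real ((Suc j) ^ 3) * ((C2 + 2 * ellbd * \<mu>) * (1 / (real (Suc j))\<^sup>2)\<^sup>2)
        + ellbd * (1 / (real (Suc j))\<^sup>2) + ellbd * (exp (- lam * (real ((Suc j) ^ 3) * (1 / (real (Suc j))\<^sup>2))) / lam)"
    show "\<exists>N0. \<forall>j\<ge>N0. v p0 - ?e j \<le> expectation L"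
      by (intro exI[of _ 0] allI impI main) (auto simp: power_le_one_iff)
    have "?e = (\<lambda>j. C1 * (1 / real (Suc j)) + (C2 + 2 * ellbd * \<mu>) * (1 / real (Suc j)) + ellbd * (1 / real (Suc j))\<^sup>2
        + ellbd * (exp (- lam * real (Suc j)) / lam))"
    proof
      fix j
      define x where "x = real (Suc j)"
      have "x \<noteq> 0" by (simp add: x_def)
      then have "x ^ 3 * (a * (1 / x\<^sup>2)\<^sup>2) = a * (1 / x)" "1 / x\<^sup>2 = (1 / x)\<^sup>2" "x ^ 3 * (1 / x\<^sup>2) = x" for a
        by (auto simp: field_simps power2_eq_square power3_eq_cube)
      then show "?e j = C1 * (1 / real (Suc j)) + (C2 + 2 * ellbd * \<mu>) * (1 / real (Suc j)) + ellbd * (1 / real (Suc j))\<^sup>2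
        + ellbd * (exp (- lam * real (Suc j)) / lam)"
        unfolding of_nat_power x_def[symmetric] by simp
    qed
    moreover have "(\<lambda>j. 1 / real (Suc j)) \<longlonglongrightarrow> 0"
      using LIMSEQ_inverse_real_of_nat by (simp add: inverse_eq_divide)
    moreover have "(\<lambda>j. exp (- lam * real (Suc j))) \<longlonglongrightarrow> 0"
    proof -
      have "(\<lambda>j. exp (- lam) ^ j) \<longlonglongrightarrow> 0"
        using lam_pos by (intro LIMSEQ_power_zero) auto
      then have "(\<lambda>j. exp (- lam * real j)) \<longlonglongrightarrow> 0"
        by (simp add: exp_of_nat_mult[symmetric] mult.commute)
      then show ?thesis by (rule LIMSEQ_Suc)
    qed
    ultimately have "?e \<longlonglongrightarrow> C1 * 0 + (C2 + 2 * ellbd * \<mu>) * 0 + ellbd * 0\<^sup>2 + ellbd * (0 / lam)"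
      by (simp only:) (intro tendsto_intros, use lam_pos in auto)
    then have "?e \<longlonglongrightarrow> 0" by simp
    then show "(\<lambda>j. v p0 - ?e j) \<longlonglongrightarrow> v p0"
      using tendsto_diff[OF tendsto_const[of "v p0"], of ?e 0] by simp
  qed
  then show ?thesis using cost by (meson ereal_less_eq(3) order_trans)
qed

end

section \<open>The upper bound\<close>

context disorder_process
begin

text \<open>The probability generating function of the Poisson law at 2. The power of 2 is the
  growth factor of the path in \<open>path_growth\<close>.\<close>

lemma expectation_two_power:
  assumes t: "0 \<le> t" and h: "0 < h"
  shows "has_bochner_integral M (\<lambda>w. 2 ^ inc t h w) (exp (\<mu> * h))"
proof (rule has_bochner_integral_nn_integral)
  define r where "r = \<mu> * h"
  have r: "0 < r" using mu_gt_1 h by (simp add: r_def)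
  have "(\<integral>\<^sup>+w. ennreal (2 ^ inc t h w) \<partial>M) = (\<integral>\<^sup>+j. ennreal (2 ^ j) \<partial>distr M (count_space UNIV) (inc t h))"
    using t h by (subst nn_integral_distr) auto
  also have "\<dots> = (\<integral>\<^sup>+j. ennreal (pmf (poisson_pmf r) j) * ennreal (2 ^ j) \<partial>count_space UNIV)"
    unfolding distr_inc[OF assms] r_def by (rule nn_integral_measure_pmf)
  also have "\<dots> = (\<Sum>j. ennreal (exp (- r) * ((2 * r) ^ j / fact j)))"
    unfolding nn_integral_count_space_nat
    using r by (intro suminf_cong) (simp add: ennreal_mult[symmetric] power_mult_distrib mult_ac)
  also have "\<dots> = ennreal (exp (- r) * exp (2 * r))"
  proof (rule suminf_ennreal_eq)
    show "(\<lambda>j. exp (- r) * ((2 * r) ^ j / fact j)) sums (exp (- r) * exp (2 * r))"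
      using exp_converges[of "2 * r"] by (intro sums_mult) (simp add: divide_inverse_commute scaleR_conv_of_real)
  qed (use r in simp)
  also have "exp (- r) * exp (2 * r) = exp (\<mu> * h)"
    by (simp add: r_def flip: exp_add)
  finally show "(\<integral>\<^sup>+w. ennreal (2 ^ inc t h w) \<partial>M) = ennreal (exp (\<mu> * h))" .
  have [measurable]: "inc t h \<in> measurable M (count_space UNIV)" using t h by simp
  show "(\<lambda>w. 2 ^ inc t h w :: real) \<in> borel_measurable M" by measurable
qed auto

text \<open>Without a jump the power is 1, so with r = \<mu> * h the expectation is exp r - exp (-
  r), which is of first order in h.\<close>

lemma expectation_two_power_jump:
  assumes t: "0 \<le> t" and h: "0 < h" "h \<le> 1"
  shows "integrable M (\<lambda>w. 2 ^ inc t h w * indicator (inc_event t h {1..}) w :: real)"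
    "expectation (\<lambda>w. 2 ^ inc t h w * indicator (inc_event t h {1..}) w) \<le> \<mu> * (exp \<mu> + 1) * h"
proof -
  define r where "r = \<mu> * h"
  have r: "0 < r" "r \<le> \<mu>" using mu_gt_1 h by (auto simp: r_def)
  note tp = expectation_two_power[OF t h(1)]
  have i0: "inc_event t h {0} \<in> sets M" using t h by simp
  have eq: "2 ^ inc t h w * indicator (inc_event t h {1..}) w = 2 ^ inc t h w - (indicator (inc_event t h {0}) w :: real)"
    if "w \<in> space M" for w
    using that by (cases "inc t h w = 0") (auto simp: inc_event_def)
  have "has_bochner_integral M (\<lambda>w. 2 ^ inc t h w - (indicator (inc_event t h {0}) w :: real)) (exp r - exp (- r))"
    using has_bochner_integral_diff[OF tp has_bochner_integral_real_indicator[OF i0]] prob_inc[OF t h(1), of 0]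
    by (simp add: r_def emeasure_eq_measure)
  then have hb: "has_bochner_integral M (\<lambda>w. 2 ^ inc t h w * indicator (inc_event t h {1..}) w) (exp r - exp (- r))"
    by (subst has_bochner_integral_cong[OF refl eq refl])
  then show "integrable M (\<lambda>w. 2 ^ inc t h w * indicator (inc_event t h {1..}) w :: real)"
    by (simp add: has_bochner_integral_iff)
  have "exp r - exp (- r) = exp r * (1 - exp (- r)) + (1 - exp (- r))"
    by (simp add: algebra_simps flip: exp_add)
  also have "\<dots> \<le> exp \<mu> * r + r"
    using exp_minus_bounds[of r] r by (intro add_mono mult_mono) auto
  also have "\<dots> = \<mu> * (exp \<mu> + 1) * h" by (simp add: r_def algebra_simps)
  finally show "expectation (\<lambda>w. 2 ^ inc t h w * indicator (inc_event t h {1..}) w) \<le> \<mu> * (exp \<mu> + 1) * h"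
    using hb by (simp add: has_bochner_integral_iff)
qed

text \<open>Where \<open>Gv\<close> is negative the coordinates sum to less than \<open>cap\<close>,
  so the unbounded cost can become large within the cell only through jumps; their effect is bounded
  by a power of 2. Only an upper estimate is required.\<close>

lemma g_on_interval:
  obtains C where "0 \<le> C" "\<And>w s t h. w \<in> space M \<Longrightarrow> 0 \<le> s \<Longrightarrow> h \<le> 1 \<Longrightarrow> s \<le> t \<Longrightarrow> t \<le> s + h \<Longrightarrow>
    Gv (path s w) < 0 \<Longrightarrow> exp (- lam * t) * g (path t w) \<le> exp (- lam * s) * ell (path s w) + C * h
      + C * (2 ^ inc s h w * indicator (inc_event s h {1..}) w)"
proof -
  obtain C1 where C1: "0 \<le> C1" "\<And>q u. q \<in> Q \<Longrightarrow> fst q \<le> cap \<Longrightarrow> snd q \<le> cap \<Longrightarrow> 0 \<le> u \<Longrightarrow> u \<le> 1 \<Longrightarrow>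
    \<bar>fst (F u q) - fst q\<bar> + \<bar>snd (F u q) - snd q\<bar> \<le> C1 * u"
    using flow_displacement[of cap] const_pos by (metis less_imp_le)
  define c0 where "c0 = (b0 + b1) / (lam + 1)"
  have c0: "0 \<le> c0" using const_pos lam_pos by (simp add: c0_def)
  define C2 where "C2 = exp (lam + 1) * (cap + c0) + ellbd"
  have C2: "0 \<le> C2" using const_pos c0 ellbd_pos by (simp add: C2_def)
  define C3 where "C3 = C1 + lam * ellbd"
  have C3: "0 \<le> C3" using C1(1) lam_pos ellbd_pos by (simp add: C3_def)
  show ?thesis
  proof (rule that[of "C2 + C3"])
    show "0 \<le> C2 + C3" using C2 C3 by simp
    fix w s t h assume w: "w \<in> space M" and s: "0 \<le> s" and h: "h \<le> (1::real)" and t: "s \<le> t" "t \<le> s + h"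
      and G: "Gv (path s w) < 0"
    have t0: "0 \<le> t" and h0: "0 \<le> h" using s t by auto
    have sQ: "path s w \<in> Q" and tQ: "path t w \<in> Q" using path_in_Q[OF w] s t0 by auto
    have near: "fst (path s w) + snd (path s w) < cap"
      using G_ge(3)[OF good_v sQ] G by linarith
    have e: "exp (- lam * t) \<le> 1" "exp (- lam * s) \<le> 1"
      using exp_lam_le_1[OF t0] exp_lam_le_1[OF s] by auto
    have b: "\<bar>ell (path s w)\<bar> \<le> ellbd" by (rule ell_bound[OF sQ])
    define j where "j = 2 ^ inc s h w * (indicator (inc_event s h {1..}) w :: real)"
    have j0: "0 \<le> j" by (simp add: j_def)
    show "exp (- lam * t) * g (path t w) \<le> exp (- lam * s) * ell (path s w) + (C2 + C3) * h
      + (C2 + C3) * (2 ^ inc s h w * indicator (inc_event s h {1..}) w)"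
      unfolding j_def[symmetric]
    proof (cases "inc s h w = 0")
      case True
      have "\<bar>fst (F (t - s) (path s w)) - fst (path s w)\<bar> + \<bar>snd (F (t - s) (path s w)) - snd (path s w)\<bar> \<le> C1 * (t - s)"
        using near sQ t h by (intro C1(2)) (auto simp: Q_iff)
      also have "\<dots> \<le> C1 * h" using C1(1) t by (intro mult_left_mono) auto
      finally have "\<bar>g (path t w) - ell (path s w)\<bar> \<le> C1 * h"
        unfolding no_jump_between[OF w s t True] ell_eq_g[OF G] g_eq by linarith
      then have "\<bar>exp (- lam * t) * (g (path t w) - ell (path s w))\<bar> \<le> 1 * (C1 * h)"
        unfolding abs_mult using e by (intro mult_mono) auto
      moreover have "\<bar>(exp (- lam * t) - exp (- lam * s)) * ell (path s w)\<bar> \<le> lam * h * ellbd"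
        unfolding abs_mult using exp_lam_diff[OF s t] b ellbd_pos lam_pos t by (intro mult_mono) auto
      moreover have "exp (- lam * t) * g (path t w) - exp (- lam * s) * ell (path s w) =
          exp (- lam * t) * (g (path t w) - ell (path s w)) + (exp (- lam * t) - exp (- lam * s)) * ell (path s w)"
        by (simp add: algebra_simps)
      moreover have "1 * (C1 * h) + lam * h * ellbd = C3 * h" by (simp add: C3_def algebra_simps)
      moreover have "0 \<le> C2 * h" "0 \<le> (C2 + C3) * j" using C2 C3 h0 j0 by auto
      ultimately show "exp (- lam * t) * g (path t w) \<le> exp (- lam * s) * ell (path s w) + (C2 + C3) * h + (C2 + C3) * j"
        unfolding distrib_right by linarith
    next
      case False
      then have j: "j = 2 ^ inc s h w" using w by (simp add: inc_event_def j_def)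
      then have j1: "1 \<le> j" by simp
      have "N t w \<le> N (s + h) w" using t t0 by (intro N_mono w) auto
      then have p: "(2::real) ^ (N t w - N s w) \<le> j" unfolding j inc_def by (intro power_increasing) auto
      have "exp (- lam * t) * g (path t w) \<le> exp (- lam * t) * size_fun (path t w)"
        by (intro mult_left_mono g_le_size_fun) auto
      also have "\<dots> \<le> 1 * size_fun (path t w)"
        using e size_fun_nonneg[OF tQ] by (intro mult_right_mono) auto
      also have "1 * size_fun (path t w) \<le> exp ((lam + 1) * (t - s)) * 2 ^ (N t w - N s w) * size_fun (path s w)"
        using path_growth[OF w s t(1)] by simp
      also have "\<dots> \<le> exp (lam + 1) * j * (cap + c0)"
      proof (intro mult_mono p)
        show "exp ((lam + 1) * (t - s)) \<le> exp (lam + 1)" using lam_pos t h mult_left_mono[of "t - s" 1 "lam + 1"] by simp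
        show "size_fun (path s w) \<le> cap + c0" using near by (simp add: size_fun_def c0_def)
      qed (use j0 size_fun_nonneg[OF sQ] in auto)
      finally have 1: "exp (- lam * t) * g (path t w) \<le> exp (lam + 1) * j * (cap + c0)" .
      have "\<bar>exp (- lam * s) * ell (path s w)\<bar> \<le> 1 * ellbd"
        unfolding abs_mult using e b by (intro mult_mono) auto
      moreover have "ellbd * 1 \<le> ellbd * j" using ellbd_pos j1 by (intro mult_left_mono) auto
      moreover have "exp (lam + 1) * j * (cap + c0) + ellbd * j = C2 * j" by (simp add: C2_def algebra_simps)
      moreover have "0 \<le> C3 * j" "0 \<le> (C2 + C3) * h" using C2 C3 h0 j0 by auto
      ultimately show "exp (- lam * t) * g (path t w) \<le> exp (- lam * s) * ell (path s w) + (C2 + C3) * h + (C2 + C3) * j"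
        using 1 unfolding distrib_right[of _ _ j] by linarith
    qed
  qed
qed

section \<open>The first grid time in the stopping region is nearly optimal\<close>

lemma sets_hist'_mono:
  assumes "s \<le> t"
  shows "sets (hist' s) \<subseteq> sets (hist' t)"
  unfolding sets_hist' using generator_mono[OF ennreal_leI[OF assms]] by (intro sigma_sets_mono') auto

text \<open>The alternative k = n makes the least index exist and the rule bounded, so that its cost
  is integrable although the running cost is unbounded.\<close>

definition first_hit :: "real \<Rightarrow> nat \<Rightarrow> 'a \<Rightarrow> nat" where
  "first_hit h n w = (LEAST k. k = n \<or> 0 \<le> Gv (path (real k * h) w))"

lemma first_hit_le: "first_hit h n w \<le> n"
  unfolding first_hit_def by (rule Least_le) simp

lemma first_hit_stop: "first_hit h n w = n \<or> 0 \<le> Gv (path (real (first_hit h n w) * h) w)"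
  unfolding first_hit_def by (rule LeastI[of _ n]) simp

lemma before_first_hit: "k < first_hit h n w \<Longrightarrow> Gv (path (real k * h) w) < 0"
  unfolding first_hit_def by (drule not_less_Least) simp

definition running :: "real \<Rightarrow> nat \<Rightarrow> nat \<Rightarrow> 'a set" where
  "running h n k = {w \<in> space M. k < first_hit h n w}"

lemma running_sets:
  assumes h: "0 \<le> h"
  shows "running h n k \<in> sets (hist' (real k * h))"
proof (cases "k < n")
  case False
  then have "running h n k = {}" using first_hit_le[of h n] by (auto simp: running_def not_less dest: order_trans leD)
  then show ?thesis by simp
next
  case True
  have "k < first_hit h n w \<longleftrightarrow> (\<forall>j\<in>{..k}. Gv (path (real j * h) w) < 0)" for w
  proof
    assume *: "\<forall>j\<in>{..k}. Gv (path (real j * h) w) < 0"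
    show "k < first_hit h n w"
    proof (rule ccontr)
      assume "\<not> k < first_hit h n w"
      then have le: "first_hit h n w \<le> k" by simp
      then have "Gv (path (real (first_hit h n w) * h) w) < 0" using * by blast
      then show False using le first_hit_stop[of h n w] True by linarith
    qed
  qed (use before_first_hit[of _ h n w] in auto)
  then have "running h n k = {w \<in> space (hist' (real k * h)). \<forall>j\<in>{..k}. Gv (path (real j * h) w) < 0}"
    by (simp add: running_def)
  also have "\<dots> \<in> sets (hist' (real k * h))"
  proof (rule sets.sets_Collect_finite_All)
    fix j assume j: "j \<in> {..k}"
    then have jk: "real j * h \<le> real k * h" using h by (intro mult_right_mono) auto
    have "0 \<le> real j * h" using h by simp
    moreover have "continuous_on Q Gv" by (rule continuous_on_Gv[OF continuous_on_id]) simp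
    ultimately have "(\<lambda>w. Gv (path (real j * h) w)) \<in> borel_measurable (hist' (real j * h))"
      by (intro function_of_path(1))
    then have "{w \<in> space (hist' (real j * h)). Gv (path (real j * h) w) < 0} \<in> sets (hist' (real j * h))"
      by (rule borel_measurable_less) simp
    then show "{w \<in> space (hist' (real k * h)). Gv (path (real j * h) w) < 0} \<in> sets (hist' (real k * h))"
      using sets_hist'_mono[OF jk] by auto
  qed simp
  finally show ?thesis .
qed

lemma first_hit_stopping_time:
  assumes h: "0 \<le> h"
  shows "stopping_time (augmented_filtration M N) (\<lambda>w. ennreal (real (first_hit h n w) * h))"
proof (rule stopping_timeI)
  fix t :: ennreal
  define I where "I = {i. i \<le> n \<and> ennreal (real i * h) \<le> t}"
  have "{w \<in> space M. first_hit h n w = i} \<in> sets (augmented_filtration M N t)" if i: "i \<in> I" for i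
  proof (rule in_augmented)
    fix u assume u: "u = \<infinity> \<or> t < u"
    have iu: "ennreal (real i * h) \<le> u" using i u by (auto simp: I_def)
    have "{w \<in> space M. first_hit h n w = i} = (if i = 0 then space M else running h n (i - 1)) - running h n i"
      by (cases i) (auto simp: running_def)
    also have "\<dots> \<in> sets (hist' (real i * h))"
    proof (intro sets.Diff running_sets h)
      have "real (i - 1) * h \<le> real i * h" using h by (intro mult_right_mono) auto
      then show "(if i = 0 then space M else running h n (i - 1)) \<in> sets (hist' (real i * h))"
        using running_sets[OF h, of n "i - 1"] sets_hist'_mono[of "real (i - 1) * h" "real i * h"]
          sets.top[of "hist' (real i * h)"] by auto
    qed
    also have "sets (hist' (real i * h)) \<subseteq> sigma_sets (space M) (natural_generator M N u \<union> null_sets M)"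
      unfolding sets_hist' using generator_mono[OF iu] by (intro sigma_sets_mono') auto
    finally show "{w \<in> space M. first_hit h n w = i} \<in> sigma_sets (space M) (natural_generator M N u \<union> null_sets M)" .
  qed
  then have "(\<Union>i\<in>I. {w \<in> space M. first_hit h n w = i}) \<in> sets (augmented_filtration M N t)"
    by (intro sets.finite_UN) (auto simp: I_def)
  also have "(\<Union>i\<in>I. {w \<in> space M. first_hit h n w = i}) = {w \<in> space M. ennreal (real (first_hit h n w) * h) \<le> t}"
    using first_hit_le[of h n] by (auto simp: I_def)
  finally show "Measurable.pred (augmented_filtration M N t) (\<lambda>w. ennreal (real (first_hit h n w) * h) \<le> t)"
    by (simp add: pred_def)
qed

text \<open>The sum telescopes to \<open>Z\<close> at the first hit minus \<open>v p0\<close>. There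
  \<open>Z\<close> is zero if \<Gamma> has been reached; otherwise the cap n was reached, and the
  discount makes it small.\<close>

lemma running_telescopes:
  assumes w: "w \<in> space M" and h: "0 \<le> h"
  shows "- bnd * exp (- lam * (real n * h)) - v p0 \<le>
    (\<Sum>k<n. indicator (running h n k) w * (Z h (Suc k) w - Z h k w))"
proof -
  let ?k = "first_hit h n w"
  have "(\<Sum>k<n. indicator (running h n k) w * (Z h (Suc k) w - Z h k w)) =
      (\<Sum>k<?k. Z h (Suc k) w - Z h k w)"
  proof (rule sum.mono_neutral_cong_right)
    show "{..<?k} \<subseteq> {..<n}" using first_hit_le[of h n w] by auto
  qed (use w in \<open>auto simp: running_def\<close>)
  also have "\<dots> = Z h ?k w - v p0"
    using sum_lessThan_telescope[of "\<lambda>k. Z h k w" ?k] by (simp add: Z_0[OF w])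
  finally have eq: "(\<Sum>k<n. indicator (running h n k) w * (Z h (Suc k) w - Z h k w)) = Z h ?k w - v p0" .
  have "- bnd * exp (- lam * (real n * h)) \<le> Z h ?k w"
  proof (cases "?k = n")
    case True
    then show ?thesis using Z_ge[OF w h, of n] by simp
  next
    case False
    then have "0 \<le> Gv (path (real ?k * h) w)" using first_hit_stop[of h n w] by simp
    then have "v (path (real ?k * h) w) = 0"
      using v_eq_0_iff[OF path_in_Q[OF w]] h by simp
    then show ?thesis using const_pos by (simp add: Z_def)
  qed
  then show ?thesis unfolding eq by simp
qed

text \<open>Before the hit \<open>ell\<close> coincides with the cost at the grid times, so
  \<open>grid_sum\<close> is used without loss; the errors come from the variation within cells and
  from the finite horizon.\<close>

lemma cost_upper_bound:
  obtains C where "0 \<le> C" "\<And>h n. 0 < h \<Longrightarrow> h \<le> 1 \<Longrightarrow> 0 < n \<Longrightarrow>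
    stopping_cost lam \<mu> c m M \<sigma> p0 (\<lambda>w. ennreal (real (first_hit h n w) * h))
      \<le> ereal (v p0 + real n * (C * h\<^sup>2) + bnd * exp (- lam * (real n * h)))"
proof -
  obtain C1 where C1: "0 \<le> C1" "\<And>h n A. 0 < h \<Longrightarrow> h \<le> 1 \<Longrightarrow> (\<And>k. A k \<in> sets (hist' (real k * h))) \<Longrightarrow>
    \<bar>(\<Sum>k<n. expectation (\<lambda>w. indicator (A k) w * (Z h (Suc k) w - Z h k w)))
      + (\<Sum>k<n. expectation (\<lambda>w. indicator (A k) w * W h k w)) * h\<bar> \<le> real n * (C1 * h\<^sup>2)"
    by (rule grid_sum) blast
  obtain C2 where C2: "0 \<le> C2" "\<And>w s t h. w \<in> space M \<Longrightarrow> 0 \<le> s \<Longrightarrow> h \<le> 1 \<Longrightarrow> s \<le> t \<Longrightarrow> t \<le> s + h \<Longrightarrow>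
    Gv (path s w) < 0 \<Longrightarrow> exp (- lam * t) * g (path t w) \<le> exp (- lam * s) * ell (path s w) + C2 * h
      + C2 * (2 ^ inc s h w * indicator (inc_event s h {1..}) w)"
    by (rule g_on_interval) blast
  define C where "C = C1 + C2 + C2 * (\<mu> * (exp \<mu> + 1))"
  show ?thesis
  proof (rule that[of C])
    show "0 \<le> C" using C1(1) C2(1) mu_gt_1 by (simp add: C_def add_pos_pos)
    fix h :: real and n :: nat assume h: "0 < h" "h \<le> 1" and n: "0 < n"
    have h0: "0 \<le> h" using h by simp
    define \<tau> where "\<tau> w = ennreal (real (first_hit h n w) * h)" for w
    have \<tau>M: "\<tau> \<in> borel_measurable M"
      unfolding \<tau>_def[abs_def] by (rule stopping_time_measurable[OF first_hit_stopping_time[OF h0]])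
    have in_\<tau>: "0 \<le> t \<and> ennreal t \<le> \<tau> w \<longleftrightarrow> 0 \<le> t \<and> t \<le> real (first_hit h n w) * h" for t w
      using h0 by (auto simp: \<tau>_def ennreal_le_iff)
    define A where "A k = running h n k" for k
    have A: "A k \<in> sets (hist' (real k * h))" for k unfolding A_def by (rule running_sets[OF h0])
    have AM: "A k \<in> sets M" for k using A[of k] sets_hist'_subset by blast
    define f where "f w t = indicator {t. 0 \<le> t \<and> ennreal t \<le> \<tau> w} t * (exp (- lam * t) * g (path t w))" for w t
    define L where "L w = (\<integral>t. f w t \<partial>lborel)" for w
    have f_joint: "(\<lambda>(w, t). f w t) \<in> borel_measurable (M \<Otimes>\<^sub>M lborel)"
      unfolding f_def by (rule joint_measurable[OF continuous_on_g[OF continuous_on_id] \<tau>M])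
    have f_meas: "f w \<in> borel_measurable lborel" if "w \<in> space M" for w
      using measurable_Pair2[OF f_joint that] by simp
    define T where "T = real n * h"
    have T: "0 < T" using h n by (simp add: T_def)
    \<comment> \<open>An integrable majorant of the cost up to T, through the growth of
      \<open>size_fun\<close> and the expectation of 2 to the number of jumps.\<close>
    define B where "B w = thr + exp ((lam + 1) * T) * 2 ^ inc 0 T w * size_fun p0" for w
    have f_abs: "\<bar>f w t\<bar> \<le> B w * indicator {0..T} t" if w: "w \<in> space M" for w t
    proof (cases "0 \<le> t \<and> ennreal t \<le> \<tau> w")
      case True
      then have t: "0 \<le> t" "t \<le> real (first_hit h n w) * h" using in_\<tau> by blast+
      have "real (first_hit h n w) * h \<le> T"
        unfolding T_def using first_hit_le[of h n w] h0 by (intro mult_right_mono) auto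
      then have tT: "t \<le> T" using t by simp
      have "size_fun (path t w) \<le> exp ((lam + 1) * (t - 0)) * 2 ^ (N t w - N 0 w) * size_fun (path 0 w)"
        by (rule path_growth[OF w order_refl t(1)])
      also have "\<dots> \<le> exp ((lam + 1) * T) * 2 ^ inc 0 T w * size_fun p0"
      proof (intro mult_mono)
        show "exp ((lam + 1) * (t - 0)) \<le> exp ((lam + 1) * T)" using lam_pos tT by (simp add: mult_left_mono)
        have "N t w \<le> N T w" by (rule N_mono[OF w t(1) tT])
        then show "(2::real) ^ (N t w - N 0 w) \<le> 2 ^ inc 0 T w"
          unfolding inc_def by (intro power_increasing) auto
      qed (use path_0[OF w] size_fun_nonneg[OF p0] in auto)
      finally have "\<bar>g (path t w)\<bar> \<le> B w"
        using g_le_size_fun[of "path t w"] g_ge[OF path_in_Q[OF w t(1)]] size_fun_nonneg[OF p0] const_pos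
          size_fun_nonneg[OF path_in_Q[OF w t(1)]]
        by (simp add: B_def abs_le_iff)
      then have "exp (- lam * t) * \<bar>g (path t w)\<bar> \<le> 1 * B w"
        using exp_lam_le_1[OF t(1)] by (intro mult_mono) auto
      then show ?thesis using True t tT by (simp add: f_def abs_mult)
    next
      case False
      have "0 \<le> B w" using const_pos size_fun_nonneg[OF p0] by (simp add: B_def)
      then show ?thesis using False by (simp add: f_def)
    qed
    have box: "has_bochner_integral lborel (\<lambda>t. B w * indicator {0..T} t) (B w * T)" for w
    proof -
      have "has_bochner_integral lborel (indicator {0..T} :: real \<Rightarrow> real) (measure lborel {0..T})"
        by (intro has_bochner_integral_real_indicator emeasure_bounded_finite) auto
      then show ?thesis using T by (intro has_bochner_integral_mult_right) auto
    qed
    have f_int: "integrable lborel (f w)" if "w \<in> space M" for w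
    proof (rule Bochner_Integration.integrable_bound[OF _ f_meas[OF that]])
      show "integrable lborel (\<lambda>t. B w * indicator {0..T} t)"
        using box[of w] by (simp only: has_bochner_integral_iff)
      show "AE t in lborel. norm (f w t) \<le> norm (B w * indicator {0..T} t)"
        using order_trans[OF f_abs[OF that] abs_ge_self] by (auto intro!: AE_I2)
    qed
    have L_meas: "L \<in> borel_measurable M"
      unfolding L_def[abs_def] by (rule lborel.borel_measurable_lebesgue_integral[OF f_joint])
    have B_int: "integrable M (\<lambda>w. B w * T)"
      using expectation_two_power[OF order_refl T] unfolding B_def
      by (auto simp: has_bochner_integral_iff)
    have L_abs: "\<bar>L w\<bar> \<le> B w * T" if w: "w \<in> space M" for w
    proof -
      have "\<bar>L w\<bar> \<le> (\<integral>t. \<bar>f w t\<bar> \<partial>lborel)" unfolding L_def by (rule integral_abs_bound)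
      also have "\<dots> \<le> (\<integral>t. B w * indicator {0..T} t \<partial>lborel)"
        using f_int[OF w] f_abs[OF w] box[of w, unfolded has_bochner_integral_iff] by (intro integral_mono) auto
      also have "\<dots> = B w * T" using box[of w] by (simp only: has_bochner_integral_iff)
      finally show ?thesis .
    qed
    have L_int: "integrable M L" by (rule expectation_abs_le(1)[OF L_meas B_int L_abs])
    have cost: "stopping_cost lam \<mu> c m M \<sigma> p0 \<tau> = ereal (expectation L)"
    proof -
      have "stopping_cost lam \<mu> c m M \<sigma> p0 \<tau> = ereal_integral M (\<lambda>w. ereal_integral lborel (\<lambda>t. ereal (f w t)))"
        unfolding cost_eq f_def ..
      also have "\<dots> = ereal_integral M (\<lambda>w. ereal (L w))"
        by (intro ereal_integral_cong) (simp add: ereal_integral_eq_lebesgue[OF f_int] L_def)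
      finally show ?thesis by (simp only: ereal_integral_eq_lebesgue[OF L_int])
    qed
    define J where "J k w = 2 ^ inc (real k * h) h w * (indicator (inc_event (real k * h) h {1..}) w :: real)" for k w
    define b where "b k w = - (C2 * h + C2 * J k w)" for k w
    have J0: "0 \<le> J k w" for k w by (simp add: J_def)
    have b0: "b k w \<le> 0" for k w
      using mult_nonneg_nonneg[OF C2(1) h0] mult_nonneg_nonneg[OF C2(1) J0[of k w]] by (simp add: b_def)
    have kh: "0 \<le> real k * h" for k using h0 by simp
    \<comment> \<open>The two subtracted zeros bring the expression into the shape of
      \<open>expectation_sums\<close>, where the lower bound has genuine constants.\<close>
    have path: "L w \<le> (\<Sum>k<n. indicator (A k) w * W h k w) * h - (\<Sum>k<n. b k w) * h - 0 - 0"
      if w: "w \<in> space M" for w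
    proof -
      define r where "r t = step h n (\<lambda>k. indicator (A k) w * W h k w) t - step h n (\<lambda>k. b k w) t" for t
      have "has_bochner_integral lborel r ((\<Sum>k<n. indicator (A k) w * W h k w * h) - (\<Sum>k<n. b k w * h))"
        unfolding r_def[abs_def] by (intro has_bochner_integral_diff step_integral h)
      then have r: "integrable lborel r" "(\<integral>t. r t \<partial>lborel) = (\<Sum>k<n. indicator (A k) w * W h k w) * h - (\<Sum>k<n. b k w) * h"
        by (simp_all only: has_bochner_integral_iff sum_distrib_right)
      \<comment> \<open>The cost integral includes its end point, whereas the cell starting there is
        no longer running; this single time is negligible.\<close>
      have "f w t \<le> r t" if ne: "t \<noteq> real (first_hit h n w) * h" for t
      proof (cases "0 \<le> t")
        case False
        then show ?thesis using step_neg[OF h(1), of t] by (simp add: r_def f_def)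
      next
        case True
        obtain k where k: "real k * h \<le> t" "t < real (Suc k) * h" using grid_cases[OF h(1) True] by blast
        have "real (Suc k) * h = real k * h + h" by (simp add: algebra_simps)
        then have kt: "t \<le> real k * h + h" using k by simp
        have r_eq: "r t = (if k < n then indicator (A k) w * W h k w - b k w else 0)"
          unfolding r_def step_eq[OF h(1) k] by simp
        show ?thesis
        proof (cases "t < real (first_hit h n w) * h")
          case lt: True
          then have "real k * h < real (first_hit h n w) * h" using k by simp
          then have kf: "k < first_hit h n w" using h by simp
          then have kn: "k < n" using first_hit_le[of h n w] by simp
          have "w \<in> A k" using kf w by (simp add: A_def running_def)
          moreover have "f w t \<le> W h k w - b k w"
            using C2(2)[OF w kh h(2) k(1) kt before_first_hit[OF kf]] True lt in_\<tau>[of t w]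
            by (simp add: f_def W_def b_def J_def)
          ultimately show ?thesis using kn by (simp add: r_eq)
        next
          case False
          then have gt: "real (first_hit h n w) * h < t" using ne by simp
          then have f0: "f w t = 0" using in_\<tau>[of t w] by (auto simp: f_def)
          have "real (first_hit h n w) * h < real (Suc k) * h" using gt k by simp
          then have "first_hit h n w < Suc k" using h by (simp only: mult_less_cancel_right_pos of_nat_less_iff)
          then have "w \<notin> A k" by (simp add: A_def running_def)
          then show ?thesis using b0[of k w] by (simp add: r_eq f0)
        qed
      qed
      then have "AE t in lborel. f w t \<le> r t"
        using AE_lborel_singleton[of "real (first_hit h n w) * h"] by (auto elim: eventually_mono)
      then have "L w \<le> (\<integral>t. r t \<partial>lborel)"
        unfolding L_def by (intro integral_mono_AE r f_int w)
      then show ?thesis unfolding r(2) by simp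
    qed
    have iW: "integrable M (\<lambda>w. indicator (A k) w * W h k w)" for k
      by (rule integrable_W[OF h0 AM])
    have iJ: "integrable M (J k)" "expectation (J k) \<le> \<mu> * (exp \<mu> + 1) * h" for k
      unfolding J_def[abs_def] by (rule expectation_two_power_jump[OF kh h])+
    have ib: "integrable M (b k)" for k
      unfolding b_def[abs_def] using iJ(1)[of k] by simp
    have Eb: "- ((C2 + C2 * (\<mu> * (exp \<mu> + 1))) * h) \<le> expectation (b k)" for k
    proof -
      have "expectation (b k) = - (C2 * h + C2 * expectation (J k))"
        unfolding b_def[abs_def] using iJ(1)[of k] by (simp add: prob_space)
      moreover have "C2 * expectation (J k) \<le> C2 * (\<mu> * (exp \<mu> + 1) * h)"
        by (intro mult_left_mono iJ(2) C2(1))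
      ultimately show ?thesis by (simp add: algebra_simps)
    qed
    have iR: "integrable M (\<lambda>w. (\<Sum>k<n. indicator (A k) w * W h k w) * h - (\<Sum>k<n. b k w) * h - 0 - 0)"
      by (intro Bochner_Integration.integrable_diff Bochner_Integration.integrable_mult_left Bochner_Integration.integrable_sum iW ib) auto
    have "expectation L \<le> expectation (\<lambda>w. (\<Sum>k<n. indicator (A k) w * W h k w) * h - (\<Sum>k<n. b k w) * h - 0 - 0)"
      by (rule integral_mono[OF L_int iR path])
    also have "\<dots> = (\<Sum>k<n. expectation (\<lambda>w. indicator (A k) w * W h k w)) * h - (\<Sum>k<n. expectation (b k)) * h - 0 - 0"
      by (rule expectation_sums[OF iW ib])
    finally have 1: "expectation L \<le> (\<Sum>k<n. expectation (\<lambda>w. indicator (A k) w * W h k w)) * h - (\<Sum>k<n. expectation (b k)) * h"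
      by simp
    have "(\<Sum>k<n. - ((C2 + C2 * (\<mu> * (exp \<mu> + 1))) * h)) * h \<le> (\<Sum>k<n. expectation (b k)) * h"
      by (intro mult_right_mono sum_mono Eb h0)
    then have 2: "- (real n * ((C2 + C2 * (\<mu> * (exp \<mu> + 1))) * h\<^sup>2)) \<le> (\<Sum>k<n. expectation (b k)) * h"
      by (simp add: power2_eq_square algebra_simps)
    have iZ: "integrable M (\<lambda>w. indicator (A k) w * (Z h (Suc k) w - Z h k w))" for k
      by (rule integrable_Z_increment[OF h0 AM])
    have "expectation (\<lambda>_. - bnd * exp (- lam * (real n * h)) - v p0) \<le>
        expectation (\<lambda>w. \<Sum>k<n. indicator (A k) w * (Z h (Suc k) w - Z h k w))"
      using running_telescopes[OF _ h0, of _ n] unfolding A_def[symmetric]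
      by (intro integral_mono Bochner_Integration.integrable_sum iZ) auto
    also have "\<dots> = (\<Sum>k<n. expectation (\<lambda>w. indicator (A k) w * (Z h (Suc k) w - Z h k w)))"
      by (rule Bochner_Integration.integral_sum[OF iZ])
    finally have 3: "- bnd * exp (- lam * (real n * h)) - v p0 \<le>
        (\<Sum>k<n. expectation (\<lambda>w. indicator (A k) w * (Z h (Suc k) w - Z h k w)))"
      by (simp add: prob_space)
    have 4: "(\<Sum>k<n. expectation (\<lambda>w. indicator (A k) w * (Z h (Suc k) w - Z h k w)))
      + (\<Sum>k<n. expectation (\<lambda>w. indicator (A k) w * W h k w)) * h \<le> real n * (C1 * h\<^sup>2)"
      using C1(2)[OF h A, of n] by (simp add: abs_le_iff)
    have "real n * (C * h\<^sup>2) = real n * (C1 * h\<^sup>2) + real n * ((C2 + C2 * (\<mu> * (exp \<mu> + 1))) * h\<^sup>2)"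
      by (simp add: C_def algebra_simps)
    then have "expectation L \<le> v p0 + real n * (C * h\<^sup>2) + bnd * exp (- lam * (real n * h))"
      using 1 2 3 4 by linarith
    then show "stopping_cost lam \<mu> c m M \<sigma> p0 (\<lambda>w. ennreal (real (first_hit h n w) * h))
      \<le> ereal (v p0 + real n * (C * h\<^sup>2) + bnd * exp (- lam * (real n * h)))"
      unfolding \<tau>_def[abs_def, symmetric] cost by simp
  qed
qed

theorem value_function_eq: "value_function lam \<mu> c m M N \<sigma> p0 = v p0"
proof -
  let ?V = "INF \<tau>\<in>{\<tau>. stopping_time (augmented_filtration M N) \<tau>}. stopping_cost lam \<mu> c m M \<sigma> p0 \<tau>"
  have ge: "ereal (v p0) \<le> ?V"
    by (intro INF_greatest cost_lower_bound) simp
  obtain C where C: "0 \<le> C" "\<And>h n. 0 < h \<Longrightarrow> h \<le> 1 \<Longrightarrow> 0 < n \<Longrightarrow>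
    stopping_cost lam \<mu> c m M \<sigma> p0 (\<lambda>w. ennreal (real (first_hit h n w) * h))
      \<le> ereal (v p0 + real n * (C * h\<^sup>2) + bnd * exp (- lam * (real n * h)))"
    by (rule cost_upper_bound) blast
  define x where "x j = real (Suc j)" for j
  define e where "e j = C * (1 / x j) + bnd * exp (- lam * x j)" for j
  have "?V \<le> ereal (v p0 + e j)" for j
  proof -
    \<comment> \<open>The mesh and the step number x ^ 3 of the lower bound again: the horizon grows
      while the accumulated error vanishes. The grid rules approach the infimum without having to
      attain it.\<close>
    define h where "h = 1 / (x j)\<^sup>2"
    have x: "0 < x j" "1 \<le> x j" by (auto simp: x_def)
    have h: "0 < h" "h \<le> 1" using x by (auto simp: h_def power2_eq_square mult_ge1_I)
    have "?V \<le> stopping_cost lam \<mu> c m M \<sigma> p0 (\<lambda>w. ennreal (real (first_hit h (Suc j ^ 3) w) * h))"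
      using h by (intro INF_lower) (simp add: first_hit_stopping_time)
    also have "\<dots> \<le> ereal (v p0 + real (Suc j ^ 3) * (C * h\<^sup>2) + bnd * exp (- lam * (real (Suc j ^ 3) * h)))"
      using h by (intro C(2)) auto
    also have "real (Suc j ^ 3) * (C * h\<^sup>2) = C * (1 / x j)"
      using x unfolding of_nat_power x_def[symmetric] h_def by (simp add: field_simps power2_eq_square power3_eq_cube)
    also have "real (Suc j ^ 3) * h = x j"
      using x unfolding of_nat_power x_def[symmetric] h_def by (simp add: field_simps power2_eq_square power3_eq_cube)
    finally show ?thesis by (simp add: e_def algebra_simps)
  qed
  note le = this
  have lim: "(\<lambda>j. ereal (v p0 + e j)) \<longlonglongrightarrow> ereal (v p0)"
  proof -
    have "(\<lambda>j. 1 / x j) \<longlonglongrightarrow> 0"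
      unfolding x_def using LIMSEQ_inverse_real_of_nat by (simp add: inverse_eq_divide)
    moreover have "(\<lambda>j. exp (- lam * x j)) \<longlonglongrightarrow> 0"
    proof -
      have "(\<lambda>j. exp (- lam) ^ j) \<longlonglongrightarrow> 0"
        using lam_pos by (intro LIMSEQ_power_zero) auto
      then have "(\<lambda>j. exp (- lam * real j)) \<longlonglongrightarrow> 0"
        by (simp add: exp_of_nat_mult[symmetric] mult.commute)
      then show ?thesis unfolding x_def by (rule LIMSEQ_Suc)
    qed
    ultimately have "(\<lambda>j. v p0 + e j) \<longlonglongrightarrow> v p0 + (C * 0 + bnd * 0)"
      unfolding e_def by (intro tendsto_intros)
    then show ?thesis by simp
  qed
  have "?V \<le> ereal (v p0)"
    by (rule LIMSEQ_le_const[OF lim]) (use le in blast)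
  then have "?V = ereal (v p0)" using ge by (rule antisym)
  then show ?thesis unfolding value_function_def by simp
qed

end

theorem corollary11p20:
  fixes lam \<mu> c m \<xi> :: real
    and M :: "'a measure" and N :: "real \<Rightarrow> 'a \<Rightarrow> nat" and \<sigma> :: "nat \<Rightarrow> 'a \<Rightarrow> real"
    and v :: "real \<times> real \<Rightarrow> real" and \<Gamma> :: "(real \<times> real) set" and \<gamma> :: "real \<Rightarrow> real"
  assumes "lam > 0" and "\<mu> > 1" and "c > 0" and "m \<in> {-1<..<1}"
    and "prob_space M" and "poisson_process M \<mu> N" and "jump_times M N \<sigma>"
    and "lam \<ge> max 0 (1 - (1 + m) * (c / 2))"
  defines "v \<equiv> value_function lam \<mu> c m M N \<sigma>"
  defines "\<Gamma> \<equiv> stopping_region v"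
  defines "\<gamma> \<equiv> boundary_function \<Gamma>"
  defines "\<xi> \<equiv> support_end \<gamma>"
  shows "C1_on_quadrant_part quadrant v \<and>
    (\<gamma> C1_differentiable_on interior {0..\<xi>} \<and>
     (\<forall>x\<in>{0..lam * sqrt 2 / (2 * c)}. \<gamma> x = a0 lam c x) \<and>
     fits_smoothly_at \<gamma> (a0 lam c) (lam * sqrt 2 / (2 * c))) \<and>
    (solves_variational_inequalities lam \<mu> c m \<Gamma> (boundary_curve \<gamma>) v \<and>
     (\<forall>w. solves_variational_inequalities lam \<mu> c m \<Gamma> (boundary_curve \<gamma>) w \<longrightarrow>
          (\<forall>p\<in>quadrant. w p = v p)))"
proof -
  interpret D: disorder lam \<mu> c m
    by unfold_locales (use assms(1-4,8) in auto)
  interpret L: disorder_value lam \<mu> c m D.v_lim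
    by unfold_locales (simp_all add: D.good_v_lim D.H_v_lim)
  interpret prob_space M by fact
  have eq: "v p = D.v_lim p" if "p \<in> quadrant" for p
  proof -
    interpret P: disorder_process lam \<mu> c m D.v_lim M N \<sigma> p
      by unfold_locales (use assms(6,7) that in auto)
    show ?thesis unfolding v_def by (rule P.value_function_eq)
  qed
  \<comment> \<open>Now that the value function equals the fixed point on the quadrant, it satisfies
    the locale assumptions itself, and its own \<Gamma>, \<gamma> and \<xi> are those of the
    locale.\<close>
  interpret V: disorder_value lam \<mu> c m v
  proof unfold_locales
    show "D.good v" by (rule D.good_cong[OF D.good_v_lim eq])
    show "D.H v p = v p" if "p \<in> quadrant" for p
      using D.H_cong[OF eq that] D.H_v_lim[OF that] eq[OF that] by simp
  qed
  have defs: "V.\<Gamma> = \<Gamma>" "V.\<gamma> = \<gamma>" "V.\<xi> = \<xi>"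
    by (simp_all only: V.\<Gamma>_def \<Gamma>_def V.\<gamma>_def \<gamma>_def V.\<xi>_def \<xi>_def)
  have "\<gamma> x = a0 lam c x" if "x \<in> {0..lam * sqrt 2 / (2 * c)}" for x
    using V.\<gamma>_near_axis[of x] that unfolding V.half_thr V.a0_eq defs by simp
  then show ?thesis
    using V.v_C1 V.\<gamma>_C1 V.\<gamma>_smooth_fit V.v_solves V.solution_unique unfolding defs by blast
qed

end
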